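(* For $n\in\mathbb N=\{1,2,3,\ldots\}$, the logarithmic monodromy of the closed leaf $S^1\times\{0\}$ in $\mathcal F_n$ equals $2\pi\mathrm i/n$.
   Context: $S^3\subset\mathbb C^2$ is the unit sphere with its standard orientation (as boundary of the unit ball). $\mathcal F_n$ is the oriented and cooriented $1$-dimensional foliation of $S^3$ tangent to the common kernel of the real and imaginary parts of the restriction to $TS^3$ of $\omega_n=nz_1\,\mathrm dz_2-z_2\,\mathrm dz_1+z_2^n\,\mathrm dz_2$; the coorientation is given by (real part)$\wedge$(imaginary part), and the leaves are oriented so that leaf orientation together with coorientation gives the standard orientation of $S^3$. The form $\omega_n$ (up to multiplication by nowhere zero complex functions) defines a transverse holomorphic structure, i.e. it makes the normal bundle $\nu$ of the foliation (the quotient of $TS^3$ by the tangent line field) a complex line bundle on which the flow along the leaves acts complex linearly. The Hopf circle $S^1\times\{0\}$ is a closed leaf. Logarithmic monodromy of an oriented closed leaf $\gamma$ of such a foliation of $S^3$: a Seifert surface of the knot $\gamma$ gives (up to homotopy) a nowhere zero section $Z$ of $\nu|_\gamma$ (a vector field along $\gamma$ tangent to the Seifert surface and nowhere tangent to $\gamma$), and hence a complex trivialisation of $\nu|_\gamma$. Use it to identify a neighbourhood of $\gamma$ with a neighbourhood of $S^1\times\{0\}$ in $S^1\times\mathbb C$, where $\gamma$ is identified with $S^1\times\{0\}$ respecting orientations, $Z$ with the constant section $1$, and the transverse complex structure with that of $\mathbb C$. For $t\in[0,2\pi]$ let $\varphi_t\colon(\mathbb C,0)\to(\mathbb C,0)$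 be the germ of a holomorphic map such that the leaf through $(1,z)$, followed in the positive direction, meets $\{\mathrm e^{\mathrm it}\}\times\mathbb C$ in $(\mathrm e^{\mathrm it},\varphi_t(z))$. (Equivalently, $\varphi_t'(0)\in\mathbb C^*$ is the linear holonomy of $\nu$ along $\gamma$ from time $0$ to time $t$, expressed in the trivialisation $Z$.) Choose $\log\varphi_t'(0)$ continuously in $t$ with $\log\varphi_0'(0)=0$. The logarithmic monodromy of $\gamma$ is $\log\varphi_{2\pi}'(0)$; it is independent of the choices. *)

theory Defs
  imports "HOL-Analysis.Analysis"
begin

section \<open>The oriented sphere in complex 2-space\<close>

text \<open>The inner product of \<^typ>\<open>complex \<times> complex\<close> is the real Euclidean one, the real part of
  the Hermitian product.\<close>

definition S3 :: "(complex \<times> complex) set" where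
  "S3 = sphere 0 1"

definition tangent_S3 :: "complex \<times> complex \<Rightarrow> (complex \<times> complex) set" where
  "tangent_S3 p = {v. inner p v = 0}"

definition real_coords :: "complex \<times> complex \<Rightarrow> real ^ 4" where
  "real_coords = (\<lambda>(z1, z2). vector [Re z1, Im z1, Re z2, Im z2])"

text \<open>For \<open>u\<close>, \<open>v\<close>, \<open>w\<close> tangent to the sphere at \<open>p\<close>, the number \<open>det4 p u v w\<close> is positive iff
  \<open>(u, v, w)\<close> is positively oriented in the orientation of the sphere as boundary of the ball:
  \<open>p\<close> is the outward normal, and it comes first.\<close>

definition det4 ::
  "complex \<times> complex \<Rightarrow> complex \<times> complex \<Rightarrow> complex \<times> complex \<Rightarrow> complex \<times> complex \<Rightarrow> real" where
  "det4 a b c d =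
     det (vector [real_coords a, real_coords b, real_coords c, real_coords d] :: real ^ 4 ^ 4)"


section \<open>Transversely holomorphic foliations\<close>

type_synonym complex_form = "complex \<times> complex \<Rightarrow> complex \<times> complex \<Rightarrow> complex"

definition ext_deriv ::
  "complex_form \<Rightarrow> complex \<times> complex \<Rightarrow> complex \<times> complex \<Rightarrow> complex \<times> complex \<Rightarrow> complex" where
  "ext_deriv \<omega> p u v =
     frechet_derivative (\<lambda>q. \<omega> q v) (at p) u - frechet_derivative (\<lambda>q. \<omega> q u) (at p) v"

text \<open>The form is only used through its restriction to the sphere. Surjectivity on the tangent
  spaces says that the real and imaginary parts are independent, so that their common kernel is
  a line field; the last condition is \<open>\<omega> \<and> d\<omega> = 0\<close> on the sphere, which says that the complex
  structure on the normal bundle is invariant under the flow along the leaves.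
  The normal space \<open>\<nu>\<close> at \<open>p\<close>, that is, the tangent space modulo the kernel, is never formed as a
  quotient: \<open>\<omega> p\<close> induces a complex linear isomorphism from it to \<open>\<complex>\<close>, so that for tangent
  vectors \<open>v\<close>, \<open>w\<close> and a complex number \<open>a\<close>, the classes satisfy \<open>[w] = a [v]\<close> in \<open>\<nu>\<close> iff
  \<open>\<omega> p w = a * \<omega> p v\<close>. This does not change if \<open>\<omega>\<close> is multiplied by a nowhere zero function.\<close>

definition transversely_holomorphic_form :: "complex_form \<Rightarrow> bool" where
  "transversely_holomorphic_form \<omega> \<longleftrightarrow>
     (\<forall>p\<in>S3. linear (\<omega> p) \<and> \<omega> p ` tangent_S3 p = UNIV) \<and>
     (\<forall>v. \<forall>p\<in>S3. (\<lambda>q. \<omega> q v) differentiable (at p)) \<and>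
     (\<forall>u v. continuous_on S3 (\<lambda>p. frechet_derivative (\<lambda>q. \<omega> q v) (at p) u)) \<and>
     (\<forall>p\<in>S3. \<forall>u\<in>tangent_S3 p. \<forall>v\<in>tangent_S3 p. \<forall>w\<in>tangent_S3 p.
        \<omega> p u * ext_deriv \<omega> p v w + \<omega> p v * ext_deriv \<omega> p w u + \<omega> p w * ext_deriv \<omega> p u v = 0)"

definition leaf_direction :: "complex_form \<Rightarrow> complex \<times> complex \<Rightarrow> (complex \<times> complex) set" where
  "leaf_direction \<omega> p = {u \<in> tangent_S3 p. \<omega> p u = 0}"

text \<open>The coorientation is the 2-form \<open>Re \<omega> \<and> Im \<omega>\<close>.\<close>

definition coorientation ::
  "complex_form \<Rightarrow> complex \<times> complex \<Rightarrow> complex \<times> complex \<Rightarrow> complex \<times> complex \<Rightarrow> real" where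
  "coorientation \<omega> p v w = Re (\<omega> p v) * Im (\<omega> p w) - Im (\<omega> p v) * Re (\<omega> p w)"

definition positive_leaf_vector :: "complex_form \<Rightarrow> complex \<times> complex \<Rightarrow> complex \<times> complex \<Rightarrow> bool" where
  "positive_leaf_vector \<omega> p u \<longleftrightarrow>
     u \<in> leaf_direction \<omega> p \<and> u \<noteq> 0 \<and>
     (\<forall>v\<in>tangent_S3 p. \<forall>w\<in>tangent_S3 p. coorientation \<omega> p v w > 0 \<longrightarrow> det4 p u v w > 0)"

definition C1_path_with_velocity ::
  "real set \<Rightarrow> (real \<Rightarrow> complex \<times> complex) \<Rightarrow> (real \<Rightarrow> complex \<times> complex) \<Rightarrow> bool" where
  "C1_path_with_velocity I c c' \<longleftrightarrow>
     continuous_on I c' \<and> (\<forall>t\<in>I. (c has_vector_derivative c' t) (at t within I))"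

definition leaf_path :: "complex_form \<Rightarrow> real set \<Rightarrow> (real \<Rightarrow> complex \<times> complex) \<Rightarrow> bool" where
  "leaf_path \<omega> I c \<longleftrightarrow>
     (\<exists>c'. C1_path_with_velocity I c c' \<and> (\<forall>t\<in>I. c t \<in> S3 \<and> c' t \<in> leaf_direction \<omega> (c t)))"

text \<open>A parametrisation over \<open>\<real>/2\<pi>\<int>\<close>, by a positively directed path, of a closed leaf.\<close>

definition closed_leaf_parametrisation ::
  "complex_form \<Rightarrow> (real \<Rightarrow> complex \<times> complex) \<Rightarrow> (real \<Rightarrow> complex \<times> complex) \<Rightarrow> bool" where
  "closed_leaf_parametrisation \<omega> \<gamma> \<gamma>' \<longleftrightarrow>
     (\<forall>t. \<gamma> (t + 2 * pi) = \<gamma> t) \<and> inj_on \<gamma> {0..<2 * pi} \<and>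
     C1_path_with_velocity UNIV \<gamma> \<gamma>' \<and>
     (\<forall>t. \<gamma> t \<in> S3 \<and> positive_leaf_vector \<omega> (\<gamma> t) (\<gamma>' t))"


section \<open>Seifert surfaces\<close>

definition C1_with_gradient ::
  "(complex \<times> complex) set \<Rightarrow> (complex \<times> complex \<Rightarrow> real) \<Rightarrow>
     (complex \<times> complex \<Rightarrow> complex \<times> complex) \<Rightarrow> bool" where
  "C1_with_gradient U f F \<longleftrightarrow> continuous_on U F \<and> (\<forall>x\<in>U. GDERIV f x :> F x)"

text \<open>On tangent vectors of the sphere, the differential of \<open>f\<close> at \<open>x\<close> is a positive multiple of
  the inner product with the normal vector \<open>N x\<close>.\<close>

definition positive_conormal ::
  "(complex \<times> complex \<Rightarrow> complex \<times> complex) \<Rightarrow> (complex \<times> complex \<Rightarrow> complex \<times> complex) \<Rightarrow>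
     complex \<times> complex \<Rightarrow> bool" where
  "positive_conormal F N x \<longleftrightarrow> (\<exists>c>0. \<forall>w\<in>tangent_S3 x. inner (F x) w = c * inner (N x) w)"

text \<open>\<open>S\<close> is a compact connected embedded \<open>C\<^sup>1\<close> surface in the sphere, oriented by the continuous
  unit normal field \<open>N\<close>, with oriented boundary the knot \<open>\<gamma>\<close> (with velocity \<open>\<gamma>'\<close>). Being an
  embedded surface is expressed by local regular equations: near an interior point \<open>S\<close> is the zero
  set of a function \<open>f\<close>; near a boundary point it is the part \<open>g \<ge> 0\<close> of such a zero set, where the
  differentials of \<open>f\<close> and \<open>g\<close> are independent (\<open>g\<close> decreases in some direction tangent to \<open>S\<close>,
  i.e. outward, along the boundary). A basis \<open>(u, v)\<close> of a tangent plane of \<open>S\<close> is positive iff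
  \<open>(N, u, v)\<close> is positive in the sphere, and \<open>\<gamma>'\<close> comes after the outward direction.\<close>

definition surface_tangent ::
  "(complex \<times> complex \<Rightarrow> complex \<times> complex) \<Rightarrow> complex \<times> complex \<Rightarrow> (complex \<times> complex) set" where
  "surface_tangent N p = {v \<in> tangent_S3 p. inner (N p) v = 0}"

definition seifert_surface ::
  "(real \<Rightarrow> complex \<times> complex) \<Rightarrow> (real \<Rightarrow> complex \<times> complex) \<Rightarrow> (complex \<times> complex) set \<Rightarrow>
     (complex \<times> complex \<Rightarrow> complex \<times> complex) \<Rightarrow> bool" where
  "seifert_surface \<gamma> \<gamma>' S N \<longleftrightarrow>
     compact S \<and> connected S \<and> range \<gamma> \<subseteq> S \<and> S \<subseteq> S3 \<and>
     continuous_on S N \<and> (\<forall>p\<in>S. N p \<in> tangent_S3 p \<and> norm (N p) = 1) \<and>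
     (\<forall>p\<in>S - range \<gamma>. \<exists>U f F. open U \<and> p \<in> U \<and> C1_with_gradient U f F \<and>
        S \<inter> U = {x \<in> S3 \<inter> U. f x = 0} \<and>
        (\<forall>x\<in>S \<inter> U. positive_conormal F N x)) \<and>
     (\<forall>p\<in>range \<gamma>. \<exists>U f F g G. open U \<and> p \<in> U \<and> C1_with_gradient U f F \<and> C1_with_gradient U g G \<and>
        S \<inter> U = {x \<in> S3 \<inter> U. f x = 0 \<and> g x \<ge> 0} \<and>
        range \<gamma> \<inter> U = {x \<in> S3 \<inter> U. f x = 0 \<and> g x = 0} \<and>
        (\<forall>x\<in>S \<inter> U. positive_conormal F N x) \<and>
        (\<forall>t. \<gamma> t \<in> U \<longrightarrow>
           (\<exists>w\<in>surface_tangent N (\<gamma> t). inner (G (\<gamma> t)) w < 0) \<and>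
           (\<forall>w\<in>surface_tangent N (\<gamma> t). inner (G (\<gamma> t)) w < 0 \<longrightarrow>
              det4 (\<gamma> t) (N (\<gamma> t)) w (\<gamma>' t) > 0)))"

text \<open>A vector field along \<open>\<gamma>\<close> tangent to the Seifert surface and nowhere tangent to \<open>\<gamma>\<close>.\<close>

definition seifert_framing ::
  "(real \<Rightarrow> complex \<times> complex) \<Rightarrow> (real \<Rightarrow> complex \<times> complex) \<Rightarrow>
     (complex \<times> complex \<Rightarrow> complex \<times> complex) \<Rightarrow> (real \<Rightarrow> complex \<times> complex) \<Rightarrow> bool" where
  "seifert_framing \<gamma> \<gamma>' N Z \<longleftrightarrow>
     continuous_on UNIV Z \<and> (\<forall>t. Z (t + 2 * pi) = Z t) \<and>
     (\<forall>t. Z t \<in> surface_tangent N (\<gamma> t) \<and> Z t \<notin> span {\<gamma>' t})"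


section \<open>Linear holonomy and logarithmic monodromy\<close>

text \<open>The classes of \<open>W t\<close> in the normal bundle are the images of the class of \<open>W 0\<close> under the linear
  holonomy along \<open>\<gamma>\<close>: \<open>W\<close> is the variation field, at \<open>s = 0\<close>, of a family \<open>c s\<close> of paths in leaves
  with \<open>c 0 = \<gamma>\<close>. The joint continuity of the family ensures that the leaves are followed close
  to \<open>\<gamma>\<close>.\<close>

definition holonomy_transport ::
  "complex_form \<Rightarrow> (real \<Rightarrow> complex \<times> complex) \<Rightarrow> (real \<Rightarrow> complex \<times> complex) \<Rightarrow> bool" where
  "holonomy_transport \<omega> \<gamma> W \<longleftrightarrow>
     (\<exists>c \<epsilon>. \<epsilon> > 0 \<and>
        continuous_on ({-\<epsilon><..<\<epsilon>} \<times> {0..2 * pi}) (\<lambda>(s, t). c s t) \<and>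
        (\<forall>s\<in>{-\<epsilon><..<\<epsilon>}. leaf_path \<omega> {0..2 * pi} (c s)) \<and>
        (\<forall>t\<in>{0..2 * pi}. c 0 t = \<gamma> t \<and> ((\<lambda>s. c s t) has_vector_derivative W t) (at 0)))"

text \<open>\<open>h t\<close> is the linear holonomy of the normal bundle along \<open>\<gamma>\<close> from time \<open>0\<close> to time \<open>t\<close>, as a
  complex number with respect to the trivialisation \<open>Z\<close>, i.e. \<open>h t = \<phi>\<^sub>t'(0)\<close>: the holonomy takes
  the class of \<open>Z 0\<close> to \<open>h t\<close> times the class of \<open>Z t\<close>.\<close>

definition linear_holonomy ::
  "complex_form \<Rightarrow> (real \<Rightarrow> complex \<times> complex) \<Rightarrow> (real \<Rightarrow> complex \<times> complex) \<Rightarrow> (real \<Rightarrow> complex) \<Rightarrow> bool" where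
  "linear_holonomy \<omega> \<gamma> Z h \<longleftrightarrow>
     (\<exists>W. holonomy_transport \<omega> \<gamma> W \<and> \<omega> (\<gamma> 0) (W 0) = \<omega> (\<gamma> 0) (Z 0) \<and>
        (\<forall>t\<in>{0..2 * pi}. \<omega> (\<gamma> t) (W t) = h t * \<omega> (\<gamma> t) (Z t)))"

text \<open>\<open>\<mu>\<close> is the logarithmic monodromy of the closed leaf \<open>K\<close>, computed with some choice of the
  parametrisation, the Seifert surface and the vector field \<open>Z\<close>.\<close>

definition has_log_monodromy :: "complex_form \<Rightarrow> (complex \<times> complex) set \<Rightarrow> complex \<Rightarrow> bool" where
  "has_log_monodromy \<omega> K \<mu> \<longleftrightarrow>
     transversely_holomorphic_form \<omega> \<and>
     (\<exists>\<gamma> \<gamma>' S N Z h L.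
        closed_leaf_parametrisation \<omega> \<gamma> \<gamma>' \<and> range \<gamma> = K \<and>
        seifert_surface \<gamma> \<gamma>' S N \<and> seifert_framing \<gamma> \<gamma>' N Z \<and>
        linear_holonomy \<omega> \<gamma> Z h \<and>
        continuous_on {0..2 * pi} L \<and> L 0 = 0 \<and> (\<forall>t\<in>{0..2 * pi}. exp (L t) = h t) \<and>
        \<mu> = L (2 * pi))"


section \<open>The foliations under consideration\<close>

definition omega :: "nat \<Rightarrow> complex_form" where
  "omega n = (\<lambda>(z1, z2) (v1, v2). of_nat n * z1 * v2 - z2 * v1 + z2 ^ n * v2)"

definition hopf_circle :: "(complex \<times> complex) set" where
  "hopf_circle = sphere 0 1 \<times> {0}"

end

theory Submission
  imports Defs
begin

text \<open>
  At a point \<open>(z, 0)\<close> of the Hopf circle the form \<open>\<omega>\<^sub>n\<close> is \<open>n z dz\<^sub>2\<close>. Hence the class of a vector in the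
  normal bundle is given by its second coordinate, the linear holonomy is a function of time with
  values in \<open>\<complex>\<close>, and two things have to be computed: how fast the holonomy turns, and how often
  the vector field \<open>Z\<close> of a Seifert surface turns around the circle.

  Holonomy. The leaf of \<open>\<omega>\<^sub>n = 0\<close> in \<open>\<complex>\<^sup>2\<close> through \<open>(p, q)\<close> is the holomorphic curve
  \<open>B \<mapsto> (e\<^sup>n\<^sup>B (p + q\<^sup>n B), q e\<^sup>B)\<close> (lemma \<open>leaf_path_eq\<close>). When \<open>q\<close> tends to \<open>0\<close>, the term \<open>q\<^sup>n B\<close>
  disappears: along a leaf that follows the Hopf circle, \<open>e\<^sup>n\<^sup>B\<close> follows the first coordinate, and so
  the second coordinate is multiplied by the \<open>n\<close>-th root of the rotation of the first
  (\<open>holonomy_transport_hopf_circle\<close>). The first coordinate turns exactly once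
  (\<open>closed_leaf_winds_once\<close>), and the logarithm of the holonomy in the coordinate frame grows by
  \<open>2\<pi>\<i>/n\<close>.

  Framing. It remains to see that the second coordinate of \<open>Z\<close> has winding number \<open>0\<close> for every
  Seifert surface \<open>S\<close>; it is enough to treat the unit normal \<open>N\<close> of \<open>S\<close>, as \<open>Z\<close> is orthogonal to it.
  The idea is to use the intersection number with \<open>S\<close> of loops in the complement of the circle. It is
  realised by a continuous map from the complement to \<open>\<complex> - {0}\<close> that takes a value on the negative
  real axis exactly at the points of \<open>S\<close>, and crosses this axis in the direction given by \<open>N\<close>
  (\<open>crossing_map\<close>). The complement is an open disc times a circle, so on its universal cover the map
  has a logarithm, which changes by a constant \<open>\<kappa>\<close> under the deck translation
  (\<open>log_on_solid_torus\<close>). A small meridian crosses \<open>S\<close> once, so that \<open>\<kappa> \<noteq> 0\<close>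
  (\<open>meridian_log_not_periodic\<close>). The Hopf circle pushed a little in the direction of \<open>N\<close> misses \<open>S\<close>
  (\<open>parallel_avoids_seifert_surface\<close>); along it the logarithm is the principal one and therefore
  periodic. If \<open>N\<close> turns \<open>m\<close> times, this says \<open>m \<kappa> = 0\<close>, whence \<open>m = 0\<close> (\<open>seifert_normal_unlinked\<close>).

  Existence. The page \<open>z\<^sub>2 \<ge> 0\<close> is a Seifert surface with \<open>Z = (0, 1)\<close>, and nearby leaves in the
  sphere are obtained by intersecting the holomorphic leaves above with the sphere by means of an
  implicit function (\<open>height_correction\<close>).
\<close>


section \<open>The forms on the sphere\<close>

lemma det4_expansion:
  "det4 (Complex a0 a1, Complex a2 a3) (Complex b0 b1, Complex b2 b3)
        (Complex c0 c1, Complex c2 c3) (Complex d0 d1, Complex d2 d3) =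
     (a0 * b1 - a1 * b0) * (c2 * d3 - c3 * d2) - (a0 * b2 - a2 * b0) * (c1 * d3 - c3 * d1)
   + (a0 * b3 - a3 * b0) * (c1 * d2 - c2 * d1) + (a1 * b2 - a2 * b1) * (c0 * d3 - c3 * d0)
   - (a1 * b3 - a3 * b1) * (c0 * d2 - c2 * d0) + (a2 * b3 - a3 * b2) * (c0 * d1 - c1 * d0)"
proof -
  have f1: "finite {2::4, 3, 4}" "1 \<notin> {2::4, 3, 4}"
    and f2: "finite {3::4, 4}" "2 \<notin> {3::4, 4}"
    and f3: "finite {4::4}" "3 \<notin> {4::4}" by auto
  have v: "(vector [a, b, c, d] :: 'z::zero ^ 4) $ 1 = a" "(vector [a, b, c, d] :: 'z ^ 4) $ 2 = b"
    "(vector [a, b, c, d] :: 'z ^ 4) $ 3 = c" "(vector [a, b, c, d] :: 'z ^ 4) $ 4 = d" for a b c d :: "'z::zero"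
    by (simp_all add: vector_def)
  show ?thesis
    unfolding det4_def det_def UNIV_4
    unfolding sum_over_permutations_insert[OF f1] sum_over_permutations_insert[OF f2]
      sum_over_permutations_insert[OF f3] permutes_sing
    by (simp add: sign_swap_id sign_compose permutation_compose permutation_swap_id transpose_eq_iff v real_coords_def
          algebra_simps Transposition.transpose_def sign_id)
qed

lemma det4_hopf_circle: "det4 (a, 0) (b, 0) (v1, v2) (w1, w2) = Im (cnj a * b) * Im (cnj v2 * w2)"
proof -
  have 0: "(0::complex) = Complex 0 0" by (simp add: complex_eq_iff)
  show ?thesis
    by (cases a; cases b; cases v1; cases v2; cases w1; cases w2;
        simp add: 0 det4_expansion algebra_simps)
qed

lemma inner_pair: "inner (p :: complex \<times> complex) v = Re (cnj (fst p) * fst v) + Re (cnj (snd p) * snd v)"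
  by (simp add: inner_prod_def inner_complex_def)

lemma S3_iff: "(z1, z2) \<in> S3 \<longleftrightarrow> (cmod z1)\<^sup>2 + (cmod z2)\<^sup>2 = 1"
  by (simp add: S3_def norm_prod_def)

lemma omega_eq: "omega n p v = (of_nat n * fst p + snd p ^ n) * snd v - snd p * fst v"
  by (simp add: omega_def case_prod_unfold algebra_simps)

text \<open>The vector field that spans the complex kernel of the form in \<open>\<complex>\<^sup>2\<close>.\<close>

definition omega_kernel :: "nat \<Rightarrow> complex \<times> complex \<Rightarrow> complex \<times> complex" where
  "omega_kernel n p = (of_nat n * fst p + snd p ^ n, snd p)"

text \<open>The kernel field points out of the ball, because \<open>|z\<^sub>1| |z\<^sub>2|\<^sup>n \<le> |z\<^sub>1| |z\<^sub>2| \<le> 1/2\<close> on the sphere. Hence the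
  complex kernel is never contained in a tangent space of the sphere, and the sphere inherits a line
  field.\<close>

lemma inner_omega_kernel_pos:
  assumes "n \<ge> 1" "p \<in> S3"
  shows "inner p (omega_kernel n p) > 0"
proof -
  obtain z1 z2 where p: "p = (z1, z2)" by force
  have eq: "(cmod z1)\<^sup>2 + (cmod z2)\<^sup>2 = 1" using assms p S3_iff by simp
  have le1: "cmod z2 \<le> 1"
    using eq by (smt (verit) power2_le_imp_le zero_le_power2 one_power2)
  have "\<bar>Re (cnj z1 * z2 ^ n)\<bar> \<le> cmod (cnj z1 * z2 ^ n)" by (rule abs_Re_le_cmod)
  also have "\<dots> = cmod z1 * cmod z2 ^ n" by (simp add: norm_mult norm_power)
  also have "\<dots> \<le> cmod z1 * cmod z2"
    using power_decreasing[OF assms(1) _ le1] by (simp add: mult_left_mono)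
  also have "\<dots> \<le> 1 / 2"
    using eq sum_squares_bound[of "cmod z1" "cmod z2"] by simp
  finally have b: "\<bar>Re (cnj z1 * z2 ^ n)\<bar> \<le> 1 / 2" .
  have "inner p (omega_kernel n p) = n * (cmod z1)\<^sup>2 + (cmod z2)\<^sup>2 + Re (cnj z1 * z2 ^ n)"
    unfolding inner_pair omega_kernel_def p cmod_power2
    by (simp add: algebra_simps power2_eq_square)
  moreover have "n * (cmod z1)\<^sup>2 \<ge> 1 * (cmod z1)\<^sup>2"
    using assms(1) by (intro mult_right_mono) auto
  ultimately show ?thesis using b eq by linarith
qed

lemma ext_deriv_omega:
  "(\<lambda>q. omega n q v) differentiable (at p)"
  "frechet_derivative (\<lambda>q. omega n q v) (at p) u =
     (of_nat n * fst u + of_nat n * snd p ^ (n - 1) * snd u) * snd v - snd u * fst v"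
proof -
  have d: "((\<lambda>q. omega n q v) has_derivative
     (\<lambda>u. (of_nat n * fst u + of_nat n * snd p ^ (n - 1) * snd u) * snd v - snd u * fst v)) (at p)"
    unfolding omega_eq
    by (rule derivative_eq_intros refl | force simp: algebra_simps)+
  show "(\<lambda>q. omega n q v) differentiable (at p)" using d differentiableI by blast
  show "frechet_derivative (\<lambda>q. omega n q v) (at p) u =
     (of_nat n * fst u + of_nat n * snd p ^ (n - 1) * snd u) * snd v - snd u * fst v"
    using fun_cong[OF frechet_derivative_at[OF d, symmetric]] by simp
qed

lemma transversely_holomorphic_form_omega:
  assumes "n \<ge> 1"
  shows "transversely_holomorphic_form (omega n)"
  unfolding transversely_holomorphic_form_def
proof (intro conjI ballI allI)
  fix p assume p: "p \<in> S3"
  show "linear (omega n p)"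
    by (rule linearI) (simp_all add: omega_eq algebra_simps scaleR_conv_of_real)
  show "omega n p ` tangent_S3 p = UNIV"
  proof (intro equalityI subset_UNIV subsetI)
    fix c :: complex
    have pos: "inner p (omega_kernel n p) > 0" using inner_omega_kernel_pos assms p by blast
    have "\<exists>v. omega n p v = c"
    proof (cases "snd p = 0")
      case True
      then have "fst p \<noteq> 0" using p by (cases p) (auto simp: S3_iff)
      then show ?thesis using True assms
        by (intro exI[of _ "(0, c / (of_nat n * fst p))"]) (simp add: omega_eq power_0_left)
    next
      case False
      then show ?thesis by (intro exI[of _ "(- c / snd p, 0)"]) (simp add: omega_eq)
    qed
    then obtain v where v: "omega n p v = c" by blast
    \<comment> \<open>a preimage in the ambient space is made tangent by moving it along the kernel\<close>
    define a where "a = inner p v / inner p (omega_kernel n p)"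
    have "inner p (v - a *\<^sub>R omega_kernel n p) = 0"
      using pos by (simp add: a_def inner_diff_right)
    moreover have "omega n p (v - a *\<^sub>R omega_kernel n p) = c"
      using v by (simp add: omega_eq omega_kernel_def algebra_simps scaleR_conv_of_real)
    ultimately show "c \<in> omega n p ` tangent_S3 p"
      unfolding tangent_S3_def by (intro image_eqI[of _ _ "v - a *\<^sub>R omega_kernel n p"]) auto
  qed
next
  fix v p show "(\<lambda>q. omega n q v) differentiable (at p)" by (rule ext_deriv_omega)
next
  fix u v show "continuous_on S3 (\<lambda>p. frechet_derivative (\<lambda>q. omega n q v) (at p) u)"
    unfolding ext_deriv_omega by (intro continuous_intros)
next
  fix p u v w
  \<comment> \<open>\<open>\<omega> \<and> d\<omega>\<close> is a holomorphic form of degree 3 in two variables\<close>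
  have e: "ext_deriv (omega n) p x y = of_nat (n + 1) * (fst x * snd y - snd x * fst y)" for x y
    unfolding ext_deriv_def ext_deriv_omega by (simp add: algebra_simps)
  show "omega n p u * ext_deriv (omega n) p v w + omega n p v * ext_deriv (omega n) p w u +
      omega n p w * ext_deriv (omega n) p u v = 0"
    unfolding e omega_eq by algebra
qed

lemma omega_hopf_circle:
  assumes "n \<ge> 1"
  shows "omega n (z, 0) v = of_nat n * z * snd v"
  using assms by (simp add: omega_eq)

text \<open>Only the orientation in the plane of the second coordinate matters, where the form is a complex
  multiple of the identity; hence the leaf is oriented counterclockwise.\<close>

lemma positive_leaf_vector_hopf_circle:
  assumes "n \<ge> 1" "cmod z = 1"
  shows "positive_leaf_vector (omega n) (z, 0) u \<longleftrightarrow> (\<exists>a>0. u = (of_real a * \<i> * z, 0))"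
proof
  assume pos: "positive_leaf_vector (omega n) (z, 0) u"
  have z0: "z \<noteq> 0" using assms by auto
  obtain u1 u2 where u: "u = (u1, u2)" by force
  have u2: "u2 = 0" using pos assms z0
    by (auto simp: positive_leaf_vector_def leaf_direction_def omega_hopf_circle u)
  have re: "Re (cnj z * u1) = 0"
    using pos by (simp add: positive_leaf_vector_def leaf_direction_def tangent_S3_def inner_pair u)
  \<comment> \<open>the frame \<open>1, \<i>\<close> of the second coordinate is positive for the coorientation and detects the direction of \<open>u\<close>\<close>
  have "det4 (z, 0) u (0, 1) (0, \<i>) > 0"
  proof -
    have "(0, 1) \<in> tangent_S3 (z, 0)" "(0, \<i>) \<in> tangent_S3 (z, 0)"
      by (auto simp: tangent_S3_def inner_pair)
    moreover have "coorientation (omega n) (z, 0) (0, 1) (0, \<i>) = n\<^sup>2 * (cmod z)\<^sup>2"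
      using assms(1) unfolding cmod_power2
      by (simp add: coorientation_def omega_hopf_circle power2_eq_square algebra_simps)
    ultimately show ?thesis using pos assms by (auto simp: positive_leaf_vector_def)
  qed
  then have im: "Im (cnj z * u1) > 0" by (simp add: u u2 det4_hopf_circle)
  have "u1 = (z * cnj z) * u1" using assms(2) by (simp add: complex_norm_square[symmetric])
  also have "\<dots> = z * (cnj z * u1)" by simp
  also have "cnj z * u1 = of_real (Im (cnj z * u1)) * \<i>" using re by (simp add: complex_eq_iff)
  finally show "\<exists>a>0. u = (of_real a * \<i> * z, 0)" using im u u2
    by (intro exI[of _ "Im (cnj z * u1)"]) (simp add: mult_ac)
next
  assume "\<exists>a>0. u = (of_real a * \<i> * z, 0)"
  then obtain a where a: "a > 0" "u = (of_real a * \<i> * z, 0)" by blast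
  have zz: "cnj z * z = 1" using assms(2) by (metis complex_norm_square mult.commute of_real_1 one_power2)
  have i: "cnj z * (of_real a * \<i> * z) = of_real a * \<i>" using zz by (simp add: mult_ac)
  show "positive_leaf_vector (omega n) (z, 0) u"
    unfolding positive_leaf_vector_def
  proof (intro conjI ballI impI)
    show "u \<in> leaf_direction (omega n) (z, 0)"
      using assms i by (simp add: leaf_direction_def tangent_S3_def inner_pair omega_hopf_circle a)
    show "u \<noteq> 0" using a assms(2) by (auto simp: prod_eq_iff)
    fix v w assume "coorientation (omega n) (z, 0) v w > 0"
    moreover have "coorientation (omega n) (z, 0) v w = n\<^sup>2 * (cmod z)\<^sup>2 * Im (cnj (snd v) * snd w)"
      using assms(1) unfolding cmod_power2
      by (simp add: coorientation_def omega_hopf_circle power2_eq_square algebra_simps)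
    ultimately have "Im (cnj (snd v) * snd w) > 0"
      using assms by (simp add: zero_less_mult_iff)
    moreover have "det4 (z, 0) u v w = a * Im (cnj (snd v) * snd w)"
      by (cases v; cases w) (simp add: a(2) det4_hopf_circle i del: complex_cnj_mult)
    ultimately show "det4 (z, 0) u v w > 0" using a(1) by simp
  qed
qed

section \<open>Holonomy along the Hopf circle\<close>

lemma has_vector_derivative_exp:
  assumes "(B has_vector_derivative b) (at t within T)"
  shows "((\<lambda>t. exp (k * B t) :: complex) has_vector_derivative k * b * exp (k * B t)) (at t within T)"
proof -
  have 1: "((\<lambda>t. k * B t) has_vector_derivative k * b) (at t within T)"
    by (rule has_vector_derivative_mult_right[OF assms])
  have "(exp \<circ> (\<lambda>t. k * B t) has_vector_derivative k * b * exp (k * B t)) (at t within T)"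
    by (rule field_vector_diff_chain_within[OF 1])
      (auto intro!: DERIV_exp[THEN DERIV_subset] simp: DERIV_exp has_field_derivative_at_within)
  then show ?thesis by (simp add: o_def)
qed

lemma linear_ode_solution:
  fixes y a :: "real \<Rightarrow> complex"
  assumes T: "0 \<le> T" and a: "continuous_on {0..T} a"
    and y: "\<And>t. t \<in> {0..T} \<Longrightarrow> (y has_vector_derivative a t * y t) (at t within {0..T})"
  obtains B where "B 0 = 0" "\<And>t. t \<in> {0..T} \<Longrightarrow> (B has_vector_derivative a t) (at t within {0..T})"
    "\<And>t. t \<in> {0..T} \<Longrightarrow> y t = y 0 * exp (B t)"
proof -
  define B where "B = (\<lambda>t. integral {0..t} a)"
  have B: "(B has_vector_derivative a t) (at t within {0..T})" if "t \<in> {0..T}" for t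
    unfolding B_def using a that by (rule integral_has_vector_derivative)
  have B0: "B 0 = 0" by (simp add: B_def)
  have "((\<lambda>t. y t * exp (- 1 * B t)) has_vector_derivative 0) (at t within {0..T})" if "t \<in> {0..T}" for t
    using has_vector_derivative_mult[OF y[OF that] has_vector_derivative_exp[OF B[OF that], of "-1"]]
    by (simp add: algebra_simps)
  then obtain c where c: "\<And>t. t \<in> {0..T} \<Longrightarrow> y t * exp (- 1 * B t) = c"
    using has_vector_derivative_zero_constant[of "{0..T}" "\<lambda>t. y t * exp (- 1 * B t)"] by auto
  have "y t = y 0 * exp (B t)" if "t \<in> {0..T}" for t
  proof -
    have "y t * exp (- 1 * B t) = y 0" using c[OF that] c[of 0] T B0 by simp
    moreover have "exp (- 1 * B t) * exp (B t) = 1" by (simp only: exp_add[symmetric]) simp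
    ultimately show ?thesis by (metis mult.assoc mult.right_neutral)
  qed
  then show thesis using that B0 B by blast
qed

text \<open>The first coordinate moves counterclockwise, so it turns a positive number of times; injectivity
  on a period excludes more than one turn.\<close>

lemma closed_leaf_winds_once:
  assumes n: "n \<ge> 1" and leaf: "closed_leaf_parametrisation (omega n) \<gamma> \<gamma>'"
    and range: "range \<gamma> = hopf_circle"
  obtains l where "continuous_on {0..2 * pi} l" "l 0 = 0" "l (2 * pi) = 2 * of_real pi * \<i>"
    "\<And>t. t \<in> {0..2 * pi} \<Longrightarrow> \<gamma> t = (fst (\<gamma> 0) * exp (l t), 0)"
proof -
  define z where "z = (\<lambda>t. fst (\<gamma> t))"
  have \<gamma>: "\<gamma> t = (z t, 0)" "cmod (z t) = 1" for t
  proof -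
    have "\<gamma> t \<in> hopf_circle" using range by blast
    then show "\<gamma> t = (z t, 0)" "cmod (z t) = 1" by (auto simp: hopf_circle_def z_def)
  qed
  have z0: "z t \<noteq> 0" for t using \<gamma>(2)[of t] by auto
  define a where "a = (\<lambda>t. fst (\<gamma>' t) / z t)"
  have a: "\<exists>r>0. a t = of_real r * \<i>" for t
  proof -
    have "positive_leaf_vector (omega n) (z t, 0) (\<gamma>' t)"
      using leaf \<gamma>(1) by (simp add: closed_leaf_parametrisation_def)
    then show ?thesis using positive_leaf_vector_hopf_circle[OF n \<gamma>(2)] z0[of t] by (auto simp: a_def)
  qed
  have D: "(\<gamma> has_vector_derivative \<gamma>' t) (at t)" and C: "continuous_on UNIV \<gamma>'" for t
    using leaf by (auto simp: closed_leaf_parametrisation_def C1_path_with_velocity_def)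
  have zD: "(z has_vector_derivative a t * z t) (at t within A)" for t A
  proof -
    have "(z has_vector_derivative fst (\<gamma>' t)) (at t)"
      unfolding z_def using bounded_linear.has_vector_derivative[OF bounded_linear_fst D[of t]] .
    then show ?thesis using z0[of t] by (simp add: a_def has_vector_derivative_at_within)
  qed
  have zC: "continuous_on UNIV z"
    by (rule continuous_on_vector_derivative) (rule zD)
  have aC: "continuous_on {0..2 * pi} a"
    unfolding a_def using z0
    by (intro continuous_intros continuous_on_subset[OF C] continuous_on_subset[OF zC]) auto
  obtain B where B: "B 0 = 0"
    "\<And>t. t \<in> {0..2 * pi} \<Longrightarrow> (B has_vector_derivative a t) (at t within {0..2 * pi})"
    "\<And>t. t \<in> {0..2 * pi} \<Longrightarrow> z t = z 0 * exp (B t)"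
    using linear_ode_solution[OF _ aC, of z] zD by auto
  have BC: "continuous_on {0..2 * pi} B"
    by (rule continuous_on_vector_derivative) (rule B(2))
  have per: "\<gamma> (2 * pi) = \<gamma> 0"
    using leaf unfolding closed_leaf_parametrisation_def by (metis add_0)
  have inj: "inj_on \<gamma> {0..<2 * pi}" using leaf by (simp add: closed_leaf_parametrisation_def)
  have "exp (B (2 * pi)) = 1" using B(3)[of "2 * pi"] per z0[of 0] by (simp add: z_def)
  then obtain m :: int where m: "Re (B (2 * pi)) = 0" "Im (B (2 * pi)) = 2 * m * pi"
    by (auto simp: exp_eq_1)
  have "Im (B 0) < Im (B (2 * pi))"
  proof (rule DERIV_pos_imp_increasing_open[where f = "\<lambda>t. Im (B t)"])
    show "continuous_on {0..2 * pi} (\<lambda>t. Im (B t))" by (intro continuous_intros BC)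
    fix t assume t: "0 < t" "t < 2 * pi"
    have "((\<lambda>t. Im (B t)) has_vector_derivative Im (a t)) (at t within {0..2 * pi})"
      using t by (intro bounded_linear.has_vector_derivative[OF bounded_linear_Im] B(2)) auto
    then have "((\<lambda>t. Im (B t)) has_real_derivative Im (a t)) (at t)"
      using t at_within_Icc_at[of 0 t "2 * pi"] by (simp add: has_real_derivative_iff_has_vector_derivative)
    moreover have "Im (a t) > 0" using a[of t] by auto
    ultimately show "\<exists>y. DERIV (\<lambda>t. Im (B t)) t :> y \<and> 0 < y" by blast
  qed auto
  then have m1: "m \<ge> 1" using m B(1) by (simp add: zero_less_mult_iff)
  have "m < 2"
  proof (rule ccontr)
    assume "\<not> m < 2"
    then have "real_of_int m * (2 * pi) \<ge> 2 * (2 * pi)" by (intro mult_right_mono) auto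
    then have big: "Im (B (2 * pi)) \<ge> 4 * pi" using m by simp
    then obtain t where t: "0 \<le> t" "t \<le> 2 * pi" "Im (B t) = 2 * pi"
      using IVT'[of "\<lambda>t. Im (B t)" 0 "2 * pi" "2 * pi"] B(1) BC by (auto intro: continuous_intros)
    have "t \<noteq> 2 * pi" using t(3) big pi_gt_zero by auto
    have "cmod (exp (B t)) = 1"
      using B(3)[of t] \<gamma>(2)[of t] \<gamma>(2)[of 0] t by (auto simp: norm_mult)
    then have "exp (B t) = 1" using t(3) by (auto simp: exp_eq_1)
    then have "\<gamma> t = \<gamma> 0" using B(3)[of t] \<gamma>(1) t by simp
    then have "t = 0" using inj t \<open>t \<noteq> 2 * pi\<close> by (auto simp: inj_on_def)
    then show False using t(3) B(1) by simp
  qed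
  then have "m = 1" using m1 by simp
  then have "B (2 * pi) = 2 * of_real pi * \<i>" using m by (simp add: complex_eq_iff)
  moreover have "\<gamma> t = (fst (\<gamma> 0) * exp (B t), 0)" if "t \<in> {0..2 * pi}" for t
  proof -
    have "fst (\<gamma> 0) = z 0" by (simp add: z_def)
    then show ?thesis using B(3)[OF that] \<gamma>(1)[of t] by metis
  qed
  ultimately show thesis using that BC B(1) by blast
qed

text \<open>On a leaf \<open>z\<^sub>2' / z\<^sub>2\<close> and \<open>z\<^sub>1' / (n z\<^sub>1 + z\<^sub>2\<^sup>n)\<close> agree. With \<open>B\<close> as the primitive of this function,
  the equation for \<open>z\<^sub>2\<close> is homogeneous linear, and variation of constants solves the one for \<open>z\<^sub>1\<close>.
  No division by \<open>z\<^sub>2\<close> is involved, which keeps the statement valid on the Hopf circle itself.\<close>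

lemma leaf_path_eq:
  assumes T: "0 \<le> T" and c: "leaf_path (omega n) {0..T} c"
    and nz: "\<And>t. t \<in> {0..T} \<Longrightarrow> of_nat n * fst (c t) + snd (c t) ^ n \<noteq> 0"
  obtains B where "B 0 = 0" "continuous_on {0..T} B"
    "\<And>t. t \<in> {0..T} \<Longrightarrow> snd (c t) = snd (c 0) * exp (B t)"
    "\<And>t. t \<in> {0..T} \<Longrightarrow> fst (c t) = exp (of_nat n * B t) * (fst (c 0) + snd (c 0) ^ n * B t)"
proof -
  obtain c' where c': "continuous_on {0..T} c'"
    "\<And>t. t \<in> {0..T} \<Longrightarrow> (c has_vector_derivative c' t) (at t within {0..T})"
    "\<And>t. t \<in> {0..T} \<Longrightarrow> omega n (c t) (c' t) = 0"
    using c unfolding leaf_path_def C1_path_with_velocity_def leaf_direction_def by blast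
  define A where "A = (\<lambda>t. of_nat n * fst (c t) + snd (c t) ^ n)"
  define a where "a = (\<lambda>t. fst (c' t) / A t)"
  have cC: "continuous_on {0..T} c" by (rule continuous_on_vector_derivative) (rule c')
  have aC: "continuous_on {0..T} a"
    unfolding a_def A_def using nz by (intro continuous_intros c'(1) cC) auto
  have D1: "((\<lambda>t. fst (c t)) has_vector_derivative a t * A t) (at t within {0..T})"
    and D2: "((\<lambda>t. snd (c t)) has_vector_derivative a t * snd (c t)) (at t within {0..T})"
    if "t \<in> {0..T}" for t
  proof -
    have e: "fst (c' t) = a t * A t" "snd (c' t) = a t * snd (c t)"
      using c'(3)[OF that] nz[OF that] by (auto simp: a_def A_def omega_eq field_simps)
    show "((\<lambda>t. fst (c t)) has_vector_derivative a t * A t) (at t within {0..T})"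
      using bounded_linear.has_vector_derivative[OF bounded_linear_fst c'(2)[OF that]] e by simp
    show "((\<lambda>t. snd (c t)) has_vector_derivative a t * snd (c t)) (at t within {0..T})"
      using bounded_linear.has_vector_derivative[OF bounded_linear_snd c'(2)[OF that]] e by simp
  qed
  obtain B where B: "B 0 = 0" "\<And>t. t \<in> {0..T} \<Longrightarrow> (B has_vector_derivative a t) (at t within {0..T})"
    "\<And>t. t \<in> {0..T} \<Longrightarrow> snd (c t) = snd (c 0) * exp (B t)"
    using linear_ode_solution[OF T aC D2] by blast
  define x where "x = (\<lambda>t. fst (c t) * exp (- of_nat n * B t) - snd (c 0) ^ n * B t)"
  have "(x has_vector_derivative 0) (at t within {0..T})" if t: "t \<in> {0..T}" for t
  proof -
    have xD: "(x has_vector_derivative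
        fst (c t) * (- of_nat n * a t * exp (- of_nat n * B t)) + a t * A t * exp (- of_nat n * B t)
        - snd (c 0) ^ n * a t) (at t within {0..T})"
      unfolding x_def
      by (intro has_vector_derivative_diff has_vector_derivative_mult has_vector_derivative_exp
          has_vector_derivative_mult_right D1 B t)
    have "exp (- of_nat n * B t) * exp (B t) ^ n = 1"
      by (simp only: exp_of_nat_mult[symmetric] exp_add[symmetric]) simp
    then have e: "exp (- of_nat n * B t) * snd (c t) ^ n = snd (c 0) ^ n"
      unfolding B(3)[OF t] power_mult_distrib by (simp add: mult.left_commute)
    have "fst (c t) * (- of_nat n * a t * exp (- of_nat n * B t)) + a t * A t * exp (- of_nat n * B t)
        - snd (c 0) ^ n * a t = a t * (exp (- of_nat n * B t) * snd (c t) ^ n - snd (c 0) ^ n)"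
      unfolding A_def by algebra
    also have "\<dots> = 0" unfolding e by simp
    finally have "fst (c t) * (- of_nat n * a t * exp (- of_nat n * B t)) + a t * A t * exp (- of_nat n * B t)
        - snd (c 0) ^ n * a t = 0" .
    then show ?thesis using xD by metis
  qed
  then obtain k where k: "\<And>t. t \<in> {0..T} \<Longrightarrow> x t = k"
    using has_vector_derivative_zero_constant[of "{0..T}" x] by auto
  have "fst (c t) = exp (of_nat n * B t) * (fst (c 0) + snd (c 0) ^ n * B t)" if "t \<in> {0..T}" for t
  proof -
    have "x t = fst (c 0)" using k[OF that] k[of 0] T B(1) by (simp add: x_def)
    then have "fst (c 0) + snd (c 0) ^ n * B t = fst (c t) * exp (- of_nat n * B t)"
      by (simp add: x_def diff_eq_eq)
    moreover have "exp (of_nat n * B t) * exp (- of_nat n * B t) = 1"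
      by (simp only: exp_add[symmetric]) simp
    ultimately show ?thesis by (metis mult.left_commute mult.right_neutral)
  qed
  moreover have "continuous_on {0..T} B"
    by (rule continuous_on_vector_derivative) (rule B(2))
  ultimately show thesis using that B by blast
qed

text \<open>A bootstrap: where \<open>|E| \<le> 1\<close>, the equation forces \<open>|E| \<le> 6 \<epsilon> < 1/2\<close>; so \<open>|E|\<close>, which starts
  at \<open>0\<close>, cannot take the value \<open>1/2\<close>, and never reaches \<open>1\<close>. This excludes that logarithms jump by a period.\<close>

lemma exp_perturbation_bound:
  fixes E B \<delta> :: "real \<Rightarrow> complex"
  assumes "0 \<le> T" "continuous_on {0..T} E" "E 0 = 0"
    and B: "\<And>t. t \<in> {0..T} \<Longrightarrow> cmod (B t) \<le> M + cmod (E t)"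
    and eq: "\<And>t. t \<in> {0..T} \<Longrightarrow> exp (E t) * (1 + \<eta> * B t) = 1 + \<delta> t"
    and \<eta>: "cmod \<eta> * (M + 1) \<le> \<epsilon>" and \<delta>: "\<And>t. t \<in> {0..T} \<Longrightarrow> cmod (\<delta> t) \<le> \<epsilon>"
    and \<epsilon>: "\<epsilon> \<le> 1 / 16" and t: "t \<in> {0..T}"
  shows "cmod (E t) \<le> 6 * \<epsilon>"
proof -
  have small: "cmod (E u) \<le> 6 * \<epsilon>" if u: "u \<in> {0..T}" and le: "cmod (E u) \<le> 1" for u
  proof -
    have "cmod \<eta> * cmod (B u) \<le> cmod \<eta> * (M + 1)" using B[OF u] le by (intro mult_left_mono) auto
    then have b: "cmod (\<eta> * B u) \<le> \<epsilon>" using \<eta> by (simp add: norm_mult)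
    have ge: "cmod (1 + \<eta> * B u) \<ge> 15 / 16"
      using norm_triangle_ineq2[of 1 "- (\<eta> * B u)"] b \<epsilon> by simp
    then have ne: "1 + \<eta> * B u \<noteq> 0" by force
    define w where "w = (\<delta> u - \<eta> * B u) / (1 + \<eta> * B u)"
    have ew: "exp (E u) = 1 + w" using eq[OF u] ne by (simp add: w_def field_simps)
    have "cmod (\<delta> u - \<eta> * B u) \<le> 2 * \<epsilon>" using \<delta>[OF u] b norm_triangle_ineq4[of "\<delta> u" "\<eta> * B u"] by linarith
    moreover have \<epsilon>0: "0 \<le> \<epsilon>" using \<delta>[OF u] norm_ge_zero[of "\<delta> u"] by linarith
    ultimately have "cmod w \<le> 2 * \<epsilon> / (15 / 16)"
      unfolding w_def norm_divide using ge \<epsilon>0 by (intro frac_le) auto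
    also have "\<dots> \<le> 3 * \<epsilon>" using \<epsilon>0 by simp
    finally have w: "cmod w \<le> 3 * \<epsilon>" .
    have "\<bar>Im (E u)\<bar> < pi" using abs_Im_le_cmod[of "E u"] le pi_gt3 by linarith
    then have "Ln (exp (E u)) = E u" by (intro Ln_exp) auto
    then have "cmod (E u) \<le> 2 * cmod w" using norm_Ln_le[of w] w \<epsilon> ew by simp
    then show ?thesis using w by simp
  qed
  have "cmod (E t) \<le> 1"
  proof (rule ccontr)
    assume "\<not> cmod (E t) \<le> 1"
    moreover have "continuous_on {0..t} (\<lambda>u. cmod (E u))"
      using t by (intro continuous_on_norm continuous_on_subset[OF assms(2)]) auto
    \<comment> \<open>the forbidden value between the two regimes\<close>
    ultimately obtain u where "0 \<le> u" "u \<le> t" "cmod (E u) = 1 / 2"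
      using IVT'[of "\<lambda>u. cmod (E u)" 0 "1 / 2" t] assms(3) t by auto
    then show False using small[of u] t \<epsilon> by auto
  qed
  then show ?thesis using small t by blast
qed

lemma holonomy_family_uniform:
  assumes e: "\<epsilon> > (0::real)" and c: "continuous_on ({-\<epsilon><..<\<epsilon>} \<times> {0..T::real}) (\<lambda>(s, t). c s t :: 'a::metric_space)"
    and r: "r > 0"
  shows "\<exists>d>0. d \<le> \<epsilon> \<and> (\<forall>s t. \<bar>s\<bar> < d \<longrightarrow> t \<in> {0..T} \<longrightarrow> dist (c s t) (c 0 t) < r)"
proof -
  have "uniformly_continuous_on ({-\<epsilon>/2..\<epsilon>/2} \<times> {0..T}) (\<lambda>(s, t). c s t)"
    using e by (intro compact_uniformly_continuous continuous_on_subset[OF c] compact_Times) auto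
  then obtain d where d: "d > 0" "\<And>x x'. x \<in> {-\<epsilon>/2..\<epsilon>/2} \<times> {0..T} \<Longrightarrow> x' \<in> {-\<epsilon>/2..\<epsilon>/2} \<times> {0..T} \<Longrightarrow>
      dist x' x < d \<Longrightarrow> dist ((\<lambda>(s, t). c s t) x') ((\<lambda>(s, t). c s t) x) < r"
    using r unfolding uniformly_continuous_on_def by metis
  have "dist (c s t) (c 0 t) < r" if "\<bar>s\<bar> < min d (\<epsilon> / 2)" "t \<in> {0..T}" for s t
  proof -
    have "(0, t) \<in> {-\<epsilon>/2..\<epsilon>/2} \<times> {0..T}" "(s, t) \<in> {-\<epsilon>/2..\<epsilon>/2} \<times> {0..T}" "dist (s, t) (0, t) < d"
      using that e by (auto simp: dist_Pair_Pair abs_less_iff)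
    then show ?thesis using d(2) by fastforce
  qed
  then show ?thesis using d(1) e by (intro exI[of _ "min d (\<epsilon> / 2)"]) auto
qed

text \<open>On a leaf close to the circle write \<open>z\<^sub>2 = z\<^sub>2(0) e\<^sup>B\<close>. The first coordinate is
  \<open>z\<^sub>1(0) e\<^sup>n\<^sup>B (1 + \<eta> B)\<close> with \<open>\<eta> = z\<^sub>2(0)\<^sup>n / z\<^sub>1(0)\<close> tending to \<open>0\<close>, and it is uniformly close to
  \<open>z\<^sub>1(0) e\<^sup>l\<close>; hence \<open>n B\<close> tends to \<open>l\<close>. The time derivatives of the leaves need not depend continuously
  on the leaf, which is why the explicit solution is used instead of a linearised equation.\<close>

lemma holonomy_transport_hopf_circle:
  assumes n: "n \<ge> 1" and W: "holonomy_transport (omega n) \<gamma> W"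
    and l: "continuous_on {0..2 * pi} l" "l 0 = 0"
    and \<gamma>: "\<And>t. t \<in> {0..2 * pi} \<Longrightarrow> \<gamma> t = (z0 * exp (l t), 0)" and \<gamma>S: "\<And>t. \<gamma> t \<in> S3"
    and W0: "snd (W 0) \<noteq> 0" and t: "t \<in> {0..2 * pi}"
  shows "snd (W t) = snd (W 0) * exp (l t / of_nat n)"
proof -
  obtain c e where e: "e > 0" and cC: "continuous_on ({-e<..<e} \<times> {0..2 * pi}) (\<lambda>(s, t). c s t)"
    and leaf: "\<And>s. s \<in> {-e<..<e} \<Longrightarrow> leaf_path (omega n) {0..2 * pi} (c s)"
    and c0: "\<And>t. t \<in> {0..2 * pi} \<Longrightarrow> c 0 t = \<gamma> t"
    and cW: "\<And>t. t \<in> {0..2 * pi} \<Longrightarrow> ((\<lambda>s. c s t) has_vector_derivative W t) (at 0)"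
    using W unfolding holonomy_transport_def by blast
  have "compact ((\<lambda>t. cmod (l t)) ` {0..2 * pi})"
    by (intro compact_continuous_image continuous_intros l) auto
  then obtain M where M: "\<And>t. t \<in> {0..2 * pi} \<Longrightarrow> cmod (l t) \<le> M"
    using bounded_iff[of "(\<lambda>t. cmod (l t)) ` {0..2 * pi}"] compact_imp_bounded by fastforce
  have M0: "M \<ge> 0" using M[of 0] l(2) by auto
  have z1: "cmod z0 = 1" and l1: "u \<in> {0..2 * pi} \<Longrightarrow> cmod (exp (l u)) = 1" for u
  proof -
    show z1: "cmod z0 = 1" using \<gamma>[of 0] \<gamma>S[of 0] l(2) by (auto simp: S3_def norm_prod_def)
    show "cmod (exp (l u)) = 1" if "u \<in> {0..2 * pi}"
      using \<gamma>[OF that] \<gamma>S[of u] z1 by (auto simp: S3_def norm_prod_def norm_mult)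
  qed
  note uniform = holonomy_family_uniform[OF e cC]
  have key: "\<exists>d>0. \<forall>s. \<bar>s\<bar> < d \<longrightarrow>
      (\<exists>b. snd (c s t) = snd (c s 0) * exp (l t / of_nat n + b) \<and> cmod b \<le> r)" if r: "r > 0" for r
  proof -
    define \<epsilon> where "\<epsilon> = min (1 / 16) (r / 6)"
    define q where "q = min (1 / 4) (\<epsilon> / (4 * (M + 1)))"
    have eps: "\<epsilon> > 0" "\<epsilon> \<le> 1 / 16" "6 * \<epsilon> \<le> r" using r by (auto simp: \<epsilon>_def)
    have q: "q > 0" "q \<le> 1 / 4" "4 * q * (M + 1) \<le> \<epsilon>"
      using eps M0 by (auto simp: q_def min_def field_simps)
    have q4: "4 * q \<le> \<epsilon>" using q M0 mult_left_mono[of 1 "M + 1" "4 * q"] by linarith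
    obtain d where d: "d > 0" "d \<le> e"
      "\<And>s u. \<bar>s\<bar> < d \<Longrightarrow> u \<in> {0..2 * pi} \<Longrightarrow> dist (c s u) (c 0 u) < q"
      using uniform[OF q(1)] by blast
    have "\<exists>b. snd (c s t) = snd (c s 0) * exp (l t / of_nat n + b) \<and> cmod b \<le> r" if s: "\<bar>s\<bar> < d" for s
    proof -
      have near: "cmod (fst (c s u) - z0 * exp (l u)) \<le> q" "cmod (snd (c s u)) \<le> q"
        if u: "u \<in> {0..2 * pi}" for u
        using d(3)[OF s u] c0[OF u] \<gamma>[OF u] dist_fst_le[of "c s u" "\<gamma> u"] dist_snd_le[of "c s u" "\<gamma> u"]
        by (auto simp: dist_norm)
      have fge: "cmod (fst (c s u)) \<ge> 3 / 4" if u: "u \<in> {0..2 * pi}" for u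
        using norm_triangle_ineq2[of "z0 * exp (l u)" "z0 * exp (l u) - fst (c s u)"] near(1)[OF u] q(2) l1[OF u] z1
        by (simp add: norm_mult norm_minus_commute)
      have sn: "cmod (snd (c s u) ^ n) \<le> q" if u: "u \<in> {0..2 * pi}" for u
      proof -
        have "cmod (snd (c s u)) ^ n \<le> cmod (snd (c s u)) ^ 1"
          using near(2)[OF u] q n by (intro power_decreasing) auto
        then show ?thesis using near(2)[OF u] by (simp add: norm_power)
      qed
      have nz: "of_nat n * fst (c s u) + snd (c s u) ^ n \<noteq> 0" if u: "u \<in> {0..2 * pi}" for u
      proof
        assume "of_nat n * fst (c s u) + snd (c s u) ^ n = 0"
        then have "cmod (of_nat n * fst (c s u)) = cmod (snd (c s u) ^ n)"
          by (metis add_eq_0_iff norm_minus_cancel)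
        moreover have "cmod (of_nat n * fst (c s u)) \<ge> 1 * (3 / 4)"
          unfolding norm_mult using fge[OF u] n by (intro mult_mono) auto
        ultimately show False using sn[OF u] q(2) by simp
      qed
      have T: "0 \<le> 2 * pi" by simp
      have lp: "leaf_path (omega n) {0..2 * pi} (c s)" using leaf[of s] s d(2) by (simp add: abs_less_iff)
      obtain B where B: "B 0 = 0" "continuous_on {0..2 * pi} B"
        "\<And>u. u \<in> {0..2 * pi} \<Longrightarrow> snd (c s u) = snd (c s 0) * exp (B u)"
        "\<And>u. u \<in> {0..2 * pi} \<Longrightarrow> fst (c s u) = exp (of_nat n * B u) * (fst (c s 0) + snd (c s 0) ^ n * B u)"
        using leaf_path_eq[OF T lp nz] by blast
      \<comment> \<open>the error of the logarithm, which solves \<open>e\<^sup>E (1 + \<eta> B) = 1 + \<delta>\<close>\<close>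
      define E where "E = (\<lambda>u. of_nat n * B u - l u)"
      define \<eta> where "\<eta> = snd (c s 0) ^ n / fst (c s 0)"
      define \<delta> where "\<delta> = (\<lambda>u. fst (c s u) * exp (- l u) / fst (c s 0) - 1)"
      have f0: "fst (c s 0) \<noteq> 0" using fge[of 0] by auto
      have "cmod (E t) \<le> 6 * \<epsilon>"
      proof (rule exp_perturbation_bound[where T = "2 * pi" and M = M and B = B and \<eta> = \<eta> and \<delta> = \<delta>])
        show "continuous_on {0..2 * pi} E" unfolding E_def by (intro continuous_intros B l)
        show "E 0 = 0" by (simp add: E_def B l)
        show "\<epsilon> \<le> 1 / 16" by (fact eps)
        have "cmod \<eta> \<le> q / (3 / 4)"
          unfolding \<eta>_def norm_divide using sn[of 0] fge[of 0] q(1) by (intro frac_le) auto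
        then have "cmod \<eta> \<le> 4 * q" using q(1) by simp
        then have "cmod \<eta> * (M + 1) \<le> 4 * q * (M + 1)" using M0 by (intro mult_right_mono) auto
        then show "cmod \<eta> * (M + 1) \<le> \<epsilon>" using q(3) by simp
      next
        fix u assume u: "u \<in> {0..2 * pi}"
        have nB: "of_nat n * B u = E u + l u" by (simp add: E_def)
        have "cmod (B u) * 1 \<le> cmod (B u) * n" using n by (intro mult_left_mono) auto
        also have "\<dots> = cmod (of_nat n * B u)" by (simp add: norm_mult)
        also have "\<dots> \<le> cmod (E u) + cmod (l u)" unfolding nB by (rule norm_triangle_ineq)
        finally show "cmod (B u) \<le> M + cmod (E u)" using M[OF u] by simp
        have "fst (c s u) * exp (- l u) = exp (E u) * (fst (c s 0) + snd (c s 0) ^ n * B u)"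
          unfolding B(4)[OF u] nB by (simp add: exp_add exp_minus)
        then show "exp (E u) * (1 + \<eta> * B u) = 1 + \<delta> u"
          using f0 by (simp add: \<eta>_def \<delta>_def field_simps)
        have \<delta>u: "\<delta> u = ((fst (c s u) - z0 * exp (l u)) * exp (- l u) - (fst (c s 0) - z0 * exp (l 0))) / fst (c s 0)"
          using f0 l(2) by (simp add: \<delta>_def field_simps exp_minus)
        have num: "cmod ((fst (c s u) - z0 * exp (l u)) * exp (- l u) - (fst (c s 0) - z0 * exp (l 0))) \<le> q + q"
          by (rule order.trans[OF norm_triangle_ineq4] add_mono)+
            (use near(1)[OF u] near(1)[of 0] l1[OF u] in \<open>auto simp: norm_mult exp_minus norm_inverse\<close>)
        have "cmod (\<delta> u) \<le> (q + q) / (3 / 4)"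
          unfolding \<delta>u norm_divide using fge[of 0] q(1) num by (intro frac_le) auto
        then show "cmod (\<delta> u) \<le> \<epsilon>" using q4 q(1) by simp
      qed (use t in auto)
      moreover have "cmod (E t) / n \<le> cmod (E t) / 1" using n by (intro divide_left_mono) auto
      ultimately have "cmod (E t / of_nat n) \<le> r" using eps(3) by (simp add: norm_divide)
      moreover have "B t = l t / of_nat n + E t / of_nat n" using n by (simp add: E_def field_simps)
      ultimately show ?thesis using B(3)[OF t] by auto
    qed
    then show ?thesis using d(1) by blast
  qed
  have lim: "((\<lambda>s. snd (c s u) / of_real s) \<longlongrightarrow> snd (W u)) (at 0)" if u: "u \<in> {0..2 * pi}" for u
  proof -
    have "((\<lambda>s. snd (c s u)) has_vector_derivative snd (W u)) (at 0)"
      using bounded_linear.has_vector_derivative[OF bounded_linear_snd cW[OF u]] .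
    then have "(\<lambda>s. norm (snd (c s u) - s *\<^sub>R snd (W u)) / norm s) \<midarrow>0\<rightarrow> 0"
      using c0[OF u] \<gamma>[OF u] by (simp add: has_vector_derivative_def has_derivative_at)
    then have "((\<lambda>s. norm (snd (c s u) / of_real s - snd (W u))) \<longlongrightarrow> 0) (at 0)"
    proof (rule Lim_transform_eventually)
      have "norm (snd (c s u) - s *\<^sub>R snd (W u)) / norm s = norm (snd (c s u) / of_real s - snd (W u))"
        if "s \<noteq> 0" for s :: real
      proof -
        have "snd (c s u) / of_real s - snd (W u) = (snd (c s u) - s *\<^sub>R snd (W u)) / of_real s"
          using that by (simp add: scaleR_conv_of_real field_simps)
        then show ?thesis by (simp add: norm_divide)
      qed
      then show "eventually (\<lambda>s. norm (snd (c s u) - s *\<^sub>R snd (W u)) / norm s =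
          norm (snd (c s u) / of_real s - snd (W u))) (at 0)"
        by (simp add: eventually_at_filter)
    qed
    then show ?thesis by (simp add: tendsto_norm_zero_iff LIM_zero_iff)
  qed
  define R where "R = (\<lambda>s. snd (c s t) / snd (c s 0) * exp (- (l t / of_nat n)))"
  have "((\<lambda>s. (snd (c s t) / of_real s) / (snd (c s 0) / of_real s) * exp (- (l t / of_nat n))) \<longlongrightarrow>
      snd (W t) / snd (W 0) * exp (- (l t / of_nat n))) (at 0)"
    using t W0 by (intro tendsto_intros lim) auto
  then have R1: "(R \<longlongrightarrow> snd (W t) / snd (W 0) * exp (- (l t / of_nat n))) (at 0)"
    unfolding R_def by (rule Lim_transform_eventually) (auto simp: eventually_at_filter)
  have "(R \<longlongrightarrow> 1) (at 0)"
  proof (rule tendstoI)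
    fix \<rho> :: real assume "\<rho> > 0"
    have "isCont (exp :: complex \<Rightarrow> complex) 0" by simp
    then obtain r where r: "r > 0" "\<And>b. cmod b < r \<Longrightarrow> dist (exp b) 1 < \<rho>"
      using \<open>\<rho> > 0\<close> unfolding continuous_at_eps_delta by (auto simp: dist_norm)
    obtain d where d: "d > 0" "\<And>s. \<bar>s\<bar> < d \<Longrightarrow>
        \<exists>b. snd (c s t) = snd (c s 0) * exp (l t / of_nat n + b) \<and> cmod b \<le> r / 2"
      using key[of "r / 2"] r(1) by auto
    have "eventually (\<lambda>s. snd (c s 0) / of_real s \<noteq> 0) (at 0)"
      using lim[of 0] W0 by (intro tendsto_imp_eventually_ne) auto
    moreover have "eventually (\<lambda>s. \<bar>s\<bar> < d) (at (0::real))"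
      using d(1) by (auto simp: eventually_at intro!: exI[of _ d])
    ultimately show "eventually (\<lambda>s. dist (R s) 1 < \<rho>) (at 0)"
    proof eventually_elim
      case (elim s)
      then obtain b where "snd (c s t) = snd (c s 0) * exp (l t / of_nat n + b)" "cmod b \<le> r / 2"
        using d(2) by blast
      then have "R s = exp b" "cmod b < r"
        using elim r(1) by (auto simp: R_def exp_add exp_minus)
      then show ?case using r(2) by simp
    qed
  qed
  then have "snd (W t) / snd (W 0) * exp (- (l t / of_nat n)) = 1"
    using R1 tendsto_unique by (metis at_neq_bot)
  then show ?thesis using W0 by (simp add: exp_minus field_simps)
qed

section \<open>The two sides of a cooriented surface\<close>

text \<open>The linear approximation of a \<open>C\<^sup>1\<close> function is uniform in both points, by the mean value
  inequality for \<open>f\<close> minus its linear part at \<open>q\<close>.\<close>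

lemma C1_strict_linearization:
  assumes U: "open U" "q \<in> U" and C: "C1_with_gradient U f F" and \<eta>: "\<eta> > 0"
  shows "\<exists>\<delta>>0. ball q \<delta> \<subseteq> U \<and>
    (\<forall>x\<in>ball q \<delta>. \<forall>y\<in>ball q \<delta>. \<bar>f x - f y - inner (F q) (x - y)\<bar> \<le> \<eta> * norm (x - y))"
proof -
  have FC: "continuous_on U F" and D: "\<And>x. x \<in> U \<Longrightarrow> (f has_derivative (\<lambda>h. inner h (F x))) (at x)"
    using C by (auto simp: C1_with_gradient_def gderiv_def)
  obtain e where e: "e > 0" "ball q e \<subseteq> U" using U open_contains_ball by metis
  obtain d where d: "d > 0" "\<And>x. x \<in> U \<Longrightarrow> dist x q < d \<Longrightarrow> dist (F x) (F q) < \<eta>"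
    using FC U(2) \<eta> unfolding continuous_on_iff by metis
  define \<delta> where "\<delta> = min d e"
  have sub: "ball q \<delta> \<subseteq> U" using e by (auto simp: \<delta>_def)
  have "norm ((f x - inner x (F q)) - (f y - inner y (F q))) \<le> \<eta> * norm (x - y)"
    if "x \<in> ball q \<delta>" "y \<in> ball q \<delta>" for x y
  proof (rule differentiable_bound[OF convex_ball _ _ that])
    fix u assume u: "u \<in> ball q \<delta>"
    have "((\<lambda>x. f x - inner x (F q)) has_derivative (\<lambda>h. inner h (F u) - inner h (F q))) (at u)"
      using u sub by (intro derivative_intros D) auto
    then show "((\<lambda>x. f x - inner x (F q)) has_derivative (\<lambda>h. inner h (F u) - inner h (F q))) (at u within ball q \<delta>)"
      by (rule has_derivative_at_withinI)
    show "onorm (\<lambda>h. inner h (F u) - inner h (F q)) \<le> \<eta>"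
    proof (rule onorm_le)
      fix h
      have "norm (inner h (F u - F q)) \<le> norm h * norm (F u - F q)" by (simp add: Cauchy_Schwarz_ineq2)
      also have "\<dots> \<le> norm h * \<eta>"
        using d(2)[of u] u sub by (intro mult_left_mono) (auto simp: \<delta>_def dist_norm norm_minus_commute)
      finally show "norm (inner h (F u) - inner h (F q)) \<le> \<eta> * norm h"
        by (simp add: inner_diff_right mult.commute)
    qed
  qed
  then show ?thesis using d(1) e(1) sub
    by (intro exI[of _ \<delta>]) (auto simp: \<delta>_def inner_diff_right inner_commute algebra_simps)
qed

text \<open>On the sphere the gradient may be replaced by a multiple of the unit normal: the difference
  is a multiple of \<open>q\<close>, and a chord \<open>x - y\<close> of the sphere is orthogonal to \<open>x + y\<close>, hence almost orthogonal
  to \<open>q\<close>.\<close>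

lemma conormal_linearization:
  assumes U: "open U" "q \<in> U" and C: "C1_with_gradient U f F"
    and q: "q \<in> S3" "N q \<in> tangent_S3 q" and pos: "positive_conormal F N q"
  obtains c where "c > 0" "\<And>\<eta>. \<eta> > 0 \<Longrightarrow> \<exists>\<delta>>0. ball q \<delta> \<subseteq> U \<and>
    (\<forall>x\<in>S3 \<inter> ball q \<delta>. \<forall>y\<in>S3 \<inter> ball q \<delta>. \<bar>f x - f y - c * inner (N q) (x - y)\<bar> \<le> \<eta> * norm (x - y))"
proof -
  obtain c where c: "c > 0" "\<And>w. inner q w = 0 \<Longrightarrow> inner (F q) w = c * inner (N q) w"
    using pos by (auto simp: positive_conormal_def tangent_S3_def)
  have Nq: "inner (N q) q = 0" using q(2) by (simp add: tangent_S3_def inner_commute)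
  have qq: "inner q q = 1" using q(1) by (simp add: S3_def dot_square_norm)
  define a where "a = inner (F q) q"
  have dec: "inner (F q) v = c * inner (N q) v + inner q v * a" for v
    using c(2)[of "v - inner q v *\<^sub>R q"] qq Nq by (simp add: inner_diff_right a_def)
  show thesis
  proof (rule that[OF c(1)])
    fix \<eta> :: real assume \<eta>: "\<eta> > 0"
    obtain d where d: "d > 0" "ball q d \<subseteq> U"
      "\<And>x y. x \<in> ball q d \<Longrightarrow> y \<in> ball q d \<Longrightarrow> \<bar>f x - f y - inner (F q) (x - y)\<bar> \<le> \<eta> / 2 * norm (x - y)"
      using C1_strict_linearization[OF U C half_gt_zero[OF \<eta>]] by blast
    define \<delta> where "\<delta> = min d (\<eta> / (2 * (\<bar>a\<bar> + 1)))"
    have "\<delta> > 0" using d \<eta> by (simp add: \<delta>_def add_nonneg_pos)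
    moreover have "\<bar>f x - f y - c * inner (N q) (x - y)\<bar> \<le> \<eta> * norm (x - y)"
      if x: "x \<in> S3" "x \<in> ball q \<delta>" and y: "y \<in> S3" "y \<in> ball q \<delta>" for x y
    proof -
      have "inner (x + y) (x - y) = 0"
        using x y by (simp add: S3_def inner_add_left inner_diff_right dot_square_norm) (simp add: inner_commute)
      then have "inner q (x - y) = inner ((1/2) *\<^sub>R (q - x) + (1/2) *\<^sub>R (q - y)) (x - y)"
        by (simp add: algebra_simps)
      also have "\<bar>\<dots>\<bar> \<le> norm ((1/2) *\<^sub>R (q - x) + (1/2) *\<^sub>R (q - y)) * norm (x - y)"
        by (rule Cauchy_Schwarz_ineq2)
      also have "norm ((1/2) *\<^sub>R (q - x) + (1/2) *\<^sub>R (q - y)) \<le> \<delta>"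
        by (rule norm_triangle_le) (use x y in \<open>auto simp: dist_norm\<close>)
      finally have "\<bar>inner q (x - y)\<bar> \<le> \<delta> * norm (x - y)" by (simp add: mult_right_mono)
      then have "\<bar>inner q (x - y) * a\<bar> \<le> \<delta> * norm (x - y) * \<bar>a\<bar>"
        unfolding abs_mult by (intro mult_right_mono) auto
      also have "\<dots> = (\<delta> * \<bar>a\<bar>) * norm (x - y)" by simp
      also have "\<delta> * \<bar>a\<bar> \<le> \<eta> / (2 * (\<bar>a\<bar> + 1)) * (\<bar>a\<bar> + 1)"
        using \<eta> by (intro mult_mono) (auto simp: \<delta>_def)
      also have "\<dots> = \<eta> / 2" by (simp add: field_simps add_nonneg_pos)
      finally have "\<bar>inner q (x - y) * a\<bar> \<le> \<eta> / 2 * norm (x - y)" by (simp add: mult_right_mono)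
      moreover have "\<bar>f x - f y - inner (F q) (x - y)\<bar> \<le> \<eta> / 2 * norm (x - y)"
        using d(3) x y by (auto simp: \<delta>_def)
      ultimately show ?thesis unfolding dec by linarith
    qed
    ultimately show "\<exists>\<delta>>0. ball q \<delta> \<subseteq> U \<and>
        (\<forall>x\<in>S3 \<inter> ball q \<delta>. \<forall>y\<in>S3 \<inter> ball q \<delta>. \<bar>f x - f y - c * inner (N q) (x - y)\<bar> \<le> \<eta> * norm (x - y))"
      using d(2) by (intro exI[of _ \<delta>]) (auto simp: \<delta>_def)
  qed
qed

text \<open>The normal line through \<open>x\<close>, projected radially to the sphere, is a curve on which \<open>f\<close> changes with
  speed about \<open>c\<close>; so \<open>f\<close> vanishes at distance of the order of \<open>|f x| / c\<close> from \<open>x\<close>.\<close>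

lemma zero_near_point:
  assumes x: "x \<in> S3" "norm n0 = 1" "\<bar>inner x n0\<bar> \<le> 1 / 16" and c: "c > 0"
    and t: "\<tau> = 2 * \<bar>f x\<bar> / c" "\<tau> \<le> 1 / 32"
    and f: "continuous_on (S3 \<inter> cball x (5 / 4 * \<tau>)) f"
    and lin: "\<And>y. y \<in> S3 \<inter> cball x (5 / 4 * \<tau>) \<Longrightarrow> \<bar>f y - f x - c * inner n0 (y - x)\<bar> \<le> c / 16 * norm (y - x)"
  obtains y where "y \<in> S3" "dist x y \<le> 5 / 4 * \<tau>" "f y = (0::real)"
proof -
  define \<rho> where "\<rho> = (\<lambda>u. (x + u *\<^sub>R n0) /\<^sub>R norm (x + u *\<^sub>R n0))"
  have nx: "norm x = 1" using x by (simp add: S3_def)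
  have \<tau>0: "\<tau> \<ge> 0" using t c by simp
  have pos: "norm (x + u *\<^sub>R n0) > 0" if "\<bar>u\<bar> \<le> \<tau>" for u
  proof -
    have "norm (x + u *\<^sub>R n0) \<ge> 1 - \<bar>u\<bar>"
      using norm_triangle_ineq2[of x "- (u *\<^sub>R n0)"] nx x(2) by simp
    then show ?thesis using t(2) that by linarith
  qed
  have near: "norm (\<rho> u - x - u *\<^sub>R n0) \<le> \<bar>u\<bar> / 4" if u: "\<bar>u\<bar> \<le> \<tau>" for u
  proof -
    define r where "r = norm (x + u *\<^sub>R n0)"
    have r: "r > 0" using pos[OF u] by (simp add: r_def)
    have "r\<^sup>2 = 1 + u * (2 * inner x n0 + u)"
      unfolding r_def power2_norm_eq_inner inner_add_left inner_add_right using nx x(2)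
      by (simp add: dot_square_norm inner_commute[of n0 x] algebra_simps power2_eq_square)
    then have "\<bar>r\<^sup>2 - 1\<bar> = \<bar>u\<bar> * \<bar>2 * inner x n0 + u\<bar>" by (simp add: abs_mult)
    also have "\<dots> \<le> \<bar>u\<bar> * (1 / 4)" using x(3) u t(2) by (intro mult_left_mono) linarith+
    finally have r2: "\<bar>r\<^sup>2 - 1\<bar> \<le> \<bar>u\<bar> / 4" by simp
    have "\<bar>r - 1\<bar> * 1 \<le> \<bar>r - 1\<bar> * \<bar>r + 1\<bar>" using r by (intro mult_left_mono) auto
    also have "\<dots> = \<bar>r\<^sup>2 - 1\<bar>" by (simp add: abs_mult[symmetric] algebra_simps power2_eq_square)
    finally have r1: "\<bar>r - 1\<bar> \<le> \<bar>u\<bar> / 4" using r2 by simp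
    have "\<rho> u - x - u *\<^sub>R n0 = (1 / r - 1) *\<^sub>R (x + u *\<^sub>R n0)"
      by (simp add: \<rho>_def r_def algebra_simps inverse_eq_divide)
    then have "norm (\<rho> u - x - u *\<^sub>R n0) = \<bar>1 / r - 1\<bar> * r" by (simp add: r_def)
    also have "\<dots> = \<bar>(1 / r - 1) * r\<bar>" using r by (simp add: abs_mult)
    also have "\<dots> = \<bar>r - 1\<bar>" using r by (simp add: algebra_simps abs_minus_commute)
    finally show ?thesis using r1 by simp
  qed
  have dist: "norm (\<rho> u - x) \<le> 5 / 4 * \<bar>u\<bar>" if u: "\<bar>u\<bar> \<le> \<tau>" for u
    using norm_triangle_ineq[of "\<rho> u - x - u *\<^sub>R n0" "u *\<^sub>R n0"] near[OF u] x(2) by simp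
  have in_S3: "\<rho> u \<in> S3" if "\<bar>u\<bar> \<le> \<tau>" for u
    using pos[OF that] by (simp add: \<rho>_def S3_def)
  have in_cball: "\<rho> u \<in> S3 \<inter> cball x (5 / 4 * \<tau>)" if "\<bar>u\<bar> \<le> \<tau>" for u
    using dist[OF that] in_S3[OF that] that by (auto simp: dist_norm norm_minus_commute)
  have dir: "\<bar>inner n0 (\<rho> u - x) - u\<bar> \<le> \<bar>u\<bar> / 4" if u: "\<bar>u\<bar> \<le> \<tau>" for u
  proof -
    have "inner n0 (\<rho> u - x) - u = inner n0 (\<rho> u - x - u *\<^sub>R n0)"
      using x(2) by (simp add: inner_diff_right dot_square_norm)
    then show ?thesis
      using Cauchy_Schwarz_ineq2[of n0 "\<rho> u - x - u *\<^sub>R n0"] near[OF u] x(2) by simp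
  qed
  have val: "\<bar>f (\<rho> u) - f x - c * u\<bar> \<le> c / 2 * \<bar>u\<bar>" if u: "\<bar>u\<bar> \<le> \<tau>" for u
  proof -
    have "\<bar>f (\<rho> u) - f x - c * inner n0 (\<rho> u - x)\<bar> \<le> c / 16 * norm (\<rho> u - x)"
      by (rule lin[OF in_cball[OF u]])
    also have "\<dots> \<le> c / 16 * (5 / 4 * \<bar>u\<bar>)" using dist[OF u] c by (intro mult_left_mono) auto
    finally have 1: "\<bar>f (\<rho> u) - f x - c * inner n0 (\<rho> u - x)\<bar> \<le> c / 16 * (5 / 4 * \<bar>u\<bar>)" .
    have "\<bar>c * (inner n0 (\<rho> u - x) - u)\<bar> \<le> c * (\<bar>u\<bar> / 4)"
      unfolding abs_mult using dir[OF u] c by (simp add: mult_left_mono)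
    then have 2: "\<bar>c * inner n0 (\<rho> u - x) - c * u\<bar> \<le> c * (\<bar>u\<bar> / 4)" by (simp add: right_diff_distrib)
    have "c / 16 * (5 / 4 * \<bar>u\<bar>) + c * (\<bar>u\<bar> / 4) \<le> c / 2 * \<bar>u\<bar>" using c by (simp add: field_simps)
    then show ?thesis using 1 2 by linarith
  qed
  have ct: "c * \<tau> = 2 * \<bar>f x\<bar>" using t(1) c by simp
  have "\<bar>f (\<rho> \<tau>) - f x - c * \<tau>\<bar> \<le> c * \<tau> / 2" "\<bar>f (\<rho> (- \<tau>)) - f x + c * \<tau>\<bar> \<le> c * \<tau> / 2"
    using val[of \<tau>] val[of "- \<tau>"] \<tau>0 by simp_all
  then have "f (\<rho> \<tau>) \<ge> 0" "f (\<rho> (- \<tau>)) \<le> 0"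
    unfolding ct by linarith+
  moreover have "continuous_on {-\<tau>..\<tau>} (\<lambda>u. f (\<rho> u))"
  proof (rule continuous_on_compose2[OF f])
    show "continuous_on {-\<tau>..\<tau>} \<rho>"
      unfolding \<rho>_def using pos by (intro continuous_intros) force
    show "\<rho> ` {-\<tau>..\<tau>} \<subseteq> S3 \<inter> cball x (5 / 4 * \<tau>)"
      using in_cball by (auto simp: abs_le_iff)
  qed
  ultimately obtain u where u: "- \<tau> \<le> u" "u \<le> \<tau>" "f (\<rho> u) = 0"
    using IVT'[of "\<lambda>u. f (\<rho> u)" "- \<tau>" 0 \<tau>] \<tau>0 by auto
  then have "\<bar>u\<bar> \<le> \<tau>" by simp
  then show thesis using that[of "\<rho> u"] in_cball[of u] u by auto
qed

text \<open>The condition at interior points of a Seifert surface, with the neighbourhood and the equation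
  made explicit.\<close>

definition local_equation ::
  "(complex \<times> complex) set \<Rightarrow> (complex \<times> complex \<Rightarrow> complex \<times> complex) \<Rightarrow>
     (complex \<times> complex) set \<Rightarrow> (complex \<times> complex \<Rightarrow> real) \<Rightarrow> bool" where
  "local_equation S N U f \<longleftrightarrow> open U \<and> S \<inter> U = {x \<in> S3 \<inter> U. f x = 0} \<and>
     (\<exists>F. C1_with_gradient U f F \<and> (\<forall>x\<in>S \<inter> U. positive_conormal F N x))"

text \<open>The sign of a local equation is intrinsic: it tells on which side of \<open>S\<close> the point lies with
  respect to a nearest point \<open>y\<close>. By the preceding lemma \<open>|x - y|\<close> is at most a multiple of \<open>|f x|\<close>; this
  makes the error of \<open>f x \<approx> c \<langle>N y, x - y\<rangle>\<close> smaller than \<open>|f x|\<close> itself. The statement is about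
  all nearest points, which need not be unique for a \<open>C\<^sup>1\<close> surface.\<close>

lemma local_equation_sign:
  assumes S: "S \<subseteq> S3" and N: "continuous_on S N" "\<And>p. p \<in> S \<Longrightarrow> N p \<in> tangent_S3 p \<and> norm (N p) = 1"
    and eq: "local_equation S N U f" and q: "q \<in> S" "q \<in> U"
  obtains \<delta> where "\<delta> > 0" "ball q \<delta> \<subseteq> U"
    "\<And>x y. x \<in> S3 \<inter> ball q \<delta> \<Longrightarrow> y \<in> S \<Longrightarrow> (\<And>y'. y' \<in> S \<Longrightarrow> dist x y \<le> dist x y') \<Longrightarrow>
       sgn (inner (x - y) (N y)) = sgn (f x)"
proof -
  obtain F where U: "open U" and SU: "S \<inter> U = {x \<in> S3 \<inter> U. f x = 0}"
    and C: "C1_with_gradient U f F" and pos: "\<And>x. x \<in> S \<inter> U \<Longrightarrow> positive_conormal F N x"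
    using eq by (auto simp: local_equation_def)
  have qS: "q \<in> S3" "N q \<in> tangent_S3 q" "norm (N q) = 1" using S N q by auto
  obtain c where c: "c > 0" and lin: "\<And>\<eta>. \<eta> > 0 \<Longrightarrow> \<exists>\<delta>>0. ball q \<delta> \<subseteq> U \<and>
    (\<forall>x\<in>S3 \<inter> ball q \<delta>. \<forall>y\<in>S3 \<inter> ball q \<delta>. \<bar>f x - f y - c * inner (N q) (x - y)\<bar> \<le> \<eta> * norm (x - y))"
    using conormal_linearization[OF U q(2) C qS(1,2) pos] q by blast
  obtain d1 where d1: "d1 > 0" "ball q d1 \<subseteq> U" "\<And>x y. x \<in> S3 \<inter> ball q d1 \<Longrightarrow> y \<in> S3 \<inter> ball q d1 \<Longrightarrow>
      \<bar>f x - f y - c * inner (N q) (x - y)\<bar> \<le> c / 16 * norm (x - y)"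
    using lin[OF divide_pos_pos[OF c zero_less_numeral]] by blast
  obtain d2 where d2: "d2 > 0" "\<And>y. y \<in> S \<Longrightarrow> dist y q < d2 \<Longrightarrow> dist (N y) (N q) < 1 / 16"
    using N(1) q(1) unfolding continuous_on_iff by (metis zero_less_divide_1_iff zero_less_numeral)
  define \<delta> where "\<delta> = min (min d1 d2) (1 / 8) / 20"
  have \<delta>: "\<delta> > 0" "20 * \<delta> \<le> d1" "20 * \<delta> \<le> d2" "20 * \<delta> \<le> 1 / 8" using d1 d2 by (auto simp: \<delta>_def)
  have fC: "continuous_on U f"
    using C unfolding C1_with_gradient_def gderiv_def
    by (meson continuous_at_imp_continuous_on has_derivative_continuous)
  show thesis
  proof (rule that[OF \<delta>(1)])
    show "ball q \<delta> \<subseteq> U" using d1(2) \<delta> by force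
    fix x y assume x: "x \<in> S3 \<inter> ball q \<delta>" and y: "y \<in> S" and min: "\<And>y'. y' \<in> S \<Longrightarrow> dist x y \<le> dist x y'"
    define \<tau> where "\<tau> = 2 * \<bar>f x\<bar> / c"
    have fq: "f q = 0" using q SU by blast
    have xq: "norm (x - q) < \<delta>" using x by (simp add: dist_norm norm_minus_commute)
    have xd: "x \<in> S3 \<inter> ball q d1" "q \<in> S3 \<inter> ball q d1" using x \<delta> d1(1) qS by auto
    have "\<bar>f x - f q - c * inner (N q) (x - q)\<bar> \<le> c / 16 * norm (x - q)" by (rule d1(3)[OF xd])
    moreover have "\<bar>c * inner (N q) (x - q)\<bar> \<le> c * norm (x - q)"
      using Cauchy_Schwarz_ineq2[of "N q" "x - q"] qS c by (simp add: abs_mult)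
    moreover have "c * norm (x - q) + c / 16 * norm (x - q) \<le> c * (2 * norm (x - q))"
      using c by (simp add: algebra_simps)
    moreover have "c * (2 * norm (x - q)) \<le> c * (2 * \<delta>)" using xq c by (intro mult_left_mono) auto
    ultimately have "\<bar>f x\<bar> \<le> c * (2 * \<delta>)" using fq by linarith
    then have \<tau>: "\<tau> \<le> 4 * \<delta>" "\<tau> \<ge> 0" using c by (auto simp: \<tau>_def field_simps)
    have sub: "cball x (5 / 4 * \<tau>) \<subseteq> ball q d1"
    proof
      fix y assume "y \<in> cball x (5 / 4 * \<tau>)"
      then show "y \<in> ball q d1" using dist_triangle[of q y x] x \<tau> \<delta> by (simp add: dist_commute)
    qed
    have "inner x (N q) = inner (x - q) (N q)"
      using qS by (simp add: inner_diff_left tangent_S3_def)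
    then have b: "\<bar>inner x (N q)\<bar> \<le> 1 / 16"
      using Cauchy_Schwarz_ineq2[of "x - q" "N q"] xq qS \<delta> by simp
    obtain y' where y': "y' \<in> S3" "dist x y' \<le> 5 / 4 * \<tau>" "f y' = 0"
    proof (rule zero_near_point[where f = f and x = x and ?n0.0 = "N q" and c = c and \<tau> = \<tau>])
      show "x \<in> S3" using x by simp
      show "\<tau> \<le> 1 / 32" using \<tau> \<delta> by simp
      show "continuous_on (S3 \<inter> cball x (5 / 4 * \<tau>)) f"
        using sub d1(2) by (intro continuous_on_subset[OF fC]) auto
      show "\<bar>f y - f x - c * inner (N q) (y - x)\<bar> \<le> c / 16 * norm (y - x)"
        if "y \<in> S3 \<inter> cball x (5 / 4 * \<tau>)" for y
        using that sub xd by (intro d1(3)) auto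
    qed (use b c qS in \<open>simp_all add: \<tau>_def\<close>)
    have "y' \<in> cball x (5 / 4 * \<tau>)" using y'(2) by simp
    then have "y' \<in> U" using sub d1(2) by blast
    then have "y' \<in> S" using SU y' by blast
    then have "norm (x - y) \<le> 5 / 4 * \<tau>" using min[of y'] y' by (simp add: dist_norm)
    then have "c / 8 * norm (x - y) \<le> c / 8 * (5 / 4 * \<tau>)" using c by (intro mult_left_mono) auto
    also have "\<dots> = 5 / 16 * \<bar>f x\<bar>" using c by (simp add: \<tau>_def)
    finally have small: "c / 8 * norm (x - y) \<le> 5 / 16 * \<bar>f x\<bar>" .
    have "dist x y < \<delta>" using min[OF q(1)] x by (simp add: dist_commute)
    then have yq: "dist y q < 2 * \<delta>" using dist_triangle[of y q x] x by (simp add: dist_commute)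
    then have yd: "y \<in> S3 \<inter> ball q d1" using y S \<delta> by (auto simp: dist_commute)
    then have "f y = 0" using y SU d1(2) by auto
    then have 1: "\<bar>f x - c * inner (N q) (x - y)\<bar> \<le> c / 16 * norm (x - y)" using d1(3)[OF xd(1) yd] by simp
    have "dist (N y) (N q) < 1 / 16" using d2(2)[OF y] yq \<delta> by simp
    then have "\<bar>inner (N q - N y) (x - y)\<bar> \<le> 1 / 16 * norm (x - y)"
      using Cauchy_Schwarz_ineq2[of "N q - N y" "x - y"]
      by (smt (verit) dist_norm mult_right_mono norm_ge_zero norm_minus_commute)
    then have "c * \<bar>inner (N q - N y) (x - y)\<bar> \<le> c * (1 / 16 * norm (x - y))" using c by (intro mult_left_mono) auto
    then have "\<bar>c * inner (N q) (x - y) - c * inner (N y) (x - y)\<bar> \<le> c / 16 * norm (x - y)"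
      using c by (simp add: inner_diff_left abs_mult right_diff_distrib[symmetric])
    then have "\<bar>f x - c * inner (N y) (x - y)\<bar> \<le> c / 16 * norm (x - y) + c / 16 * norm (x - y)"
      using 1 by linarith
    also have "\<dots> = c / 8 * norm (x - y)" by simp
    finally have "\<bar>f x - c * inner (N y) (x - y)\<bar> \<le> c / 8 * norm (x - y)" .
    then have "\<bar>f x - c * inner (N y) (x - y)\<bar> \<le> 5 / 16 * \<bar>f x\<bar>" using small by linarith
    moreover have "sgn b = sgn a" if "\<bar>a - b\<bar> \<le> 5 / 16 * \<bar>a\<bar>" for a b :: real
      using that by (auto simp: sgn_if abs_if split: if_splits)
    ultimately have "sgn (c * inner (N y) (x - y)) = sgn (f x)" by blast
    then show "sgn (inner (x - y) (N y)) = sgn (f x)" using c by (simp add: sgn_mult inner_commute)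
  qed
qed

text \<open>The side of \<open>S\<close> on which a point lies, seen from some nearest point of \<open>S\<close>. Near interior points
  of the surface the choice of this point does not matter.\<close>

definition side :: "(complex \<times> complex) set \<Rightarrow> (complex \<times> complex \<Rightarrow> complex \<times> complex) \<Rightarrow> complex \<times> complex \<Rightarrow> real" where
  "side S N x = sgn (inner (x - closest_point S x) (N (closest_point S x)))"

text \<open>The complement of an open set in which \<open>side\<close> is locally the sign of a continuous equation of \<open>S\<close>.
  The point \<open>0\<close> is added to have a nonempty closed set in any case; it is far from the sphere.\<close>

definition off_collar :: "(complex \<times> complex) set \<Rightarrow> (complex \<times> complex \<Rightarrow> complex \<times> complex) \<Rightarrow> (complex \<times> complex) set" where
  "off_collar S N = insert 0 (- \<Union>{B. open B \<and> (\<exists>f. continuous_on B f \<and>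
     S \<inter> B = {x \<in> S3 \<inter> B. f x = 0} \<and> (\<forall>x\<in>S3 \<inter> B. side S N x = sgn (f x)))})"

text \<open>The real part compares the distances to \<open>S\<close> and to the outside of the collar; it is negative
  at the points of \<open>S\<close> in the collar and positive outside the collar. The imaginary part carries the side of \<open>S\<close> and is damped to \<open>0\<close>
  where the side changes or is meaningless. Passing through the collar from the negative to the
  positive side, the value makes a full turn around \<open>0\<close>, across the negative real axis at \<open>S\<close>.\<close>

definition crossing_map :: "(complex \<times> complex) set \<Rightarrow> (complex \<times> complex \<Rightarrow> complex \<times> complex) \<Rightarrow> complex \<times> complex \<Rightarrow> complex" where
  "crossing_map S N x = Complex (infdist x S - infdist x (off_collar S N))
     (side S N x * (infdist x S * infdist x (off_collar S N)))"

lemma closed_off_collar: "closed (off_collar S N)"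
  unfolding off_collar_def closed_def Compl_insert Compl_Diff_eq
  by (auto simp: Compl_insert intro!: open_Diff)

locale cooriented_surface =
  fixes S :: "(complex \<times> complex) set" and N :: "complex \<times> complex \<Rightarrow> complex \<times> complex"
    and K :: "(complex \<times> complex) set"
  assumes S: "closed S" "S \<noteq> {}" "S \<subseteq> S3"
    and N: "continuous_on S N" "\<And>p. p \<in> S \<Longrightarrow> N p \<in> tangent_S3 p \<and> norm (N p) = 1"
    and eq: "\<And>p. p \<in> S - K \<Longrightarrow> \<exists>U f. p \<in> U \<and> local_equation S N U f"
begin

text \<open>Independence of the choice of local equations: this is what makes the sides near different
  points of \<open>S\<close> fit together.\<close>

lemma side_eq_sgn:
  assumes "local_equation S N U f" "q \<in> S" "q \<in> U"
  obtains \<delta> where "\<delta> > 0" "ball q \<delta> \<subseteq> U" "\<And>x. x \<in> S3 \<inter> ball q \<delta> \<Longrightarrow> side S N x = sgn (f x)"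
proof -
  obtain \<delta> where \<delta>: "\<delta> > 0" "ball q \<delta> \<subseteq> U"
    "\<And>x y. x \<in> S3 \<inter> ball q \<delta> \<Longrightarrow> y \<in> S \<Longrightarrow> (\<And>y'. y' \<in> S \<Longrightarrow> dist x y \<le> dist x y') \<Longrightarrow>
       sgn (inner (x - y) (N y)) = sgn (f x)"
    using local_equation_sign[OF S(3) N assms] by blast
  show thesis
  proof (rule that[OF \<delta>(1,2)])
    fix x assume "x \<in> S3 \<inter> ball q \<delta>"
    then show "side S N x = sgn (f x)"
      unfolding side_def using closest_point_exists[OF S(1,2), of x] by (intro \<delta>(3)) auto
  qed
qed

lemma off_collar_disjoint:
  assumes "q \<in> S - K" shows "q \<notin> off_collar S N"
proof -
  obtain U f where U: "q \<in> U" and f: "local_equation S N U f" using eq assms by blast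
  obtain \<delta> where \<delta>: "\<delta> > 0" "ball q \<delta> \<subseteq> U" "\<And>x. x \<in> S3 \<inter> ball q \<delta> \<Longrightarrow> side S N x = sgn (f x)"
    using side_eq_sgn[OF f _ U] assms by blast
  have "S \<inter> ball q \<delta> = {x \<in> S3 \<inter> ball q \<delta>. f x = 0}"
    using f \<delta>(2) unfolding local_equation_def by blast
  moreover have "continuous_on (ball q \<delta>) f"
  proof (rule continuous_on_subset[OF _ \<delta>(2)])
    show "continuous_on U f"
      using f unfolding local_equation_def C1_with_gradient_def gderiv_def
      by (meson continuous_at_imp_continuous_on has_derivative_continuous)
  qed
  ultimately have "ball q \<delta> \<in> {B. open B \<and> (\<exists>f. continuous_on B f \<and>
     S \<inter> B = {x \<in> S3 \<inter> B. f x = 0} \<and> (\<forall>x\<in>S3 \<inter> B. side S N x = sgn (f x)))}"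
    using \<delta>(3) by blast
  moreover have "q \<in> ball q \<delta>" using \<delta>(1) by simp
  moreover have "q \<noteq> 0" using assms S(3) by (auto simp: S3_def)
  ultimately show ?thesis unfolding off_collar_def by blast
qed

lemma off_collar_pos:
  assumes "q \<in> S - K" shows "infdist q (off_collar S N) > 0"
  using off_collar_disjoint[OF assms] closed_off_collar
  by (intro infdist_pos_not_in_closed) (auto simp: off_collar_def)

lemma side_locally_constant:
  assumes x: "x \<in> S3" "x \<notin> S" "x \<notin> off_collar S N"
  shows "side S N x \<noteq> 0" "eventually (\<lambda>y. side S N y = side S N x) (at x within S3)"
proof -
  obtain B f where B: "open B" "x \<in> B" "continuous_on B f" "S \<inter> B = {x \<in> S3 \<inter> B. f x = 0}"
    "\<And>x. x \<in> S3 \<inter> B \<Longrightarrow> side S N x = sgn (f x)"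
    using x(3) unfolding off_collar_def by auto
  have fx: "f x \<noteq> 0" using x B by auto
  then show "side S N x \<noteq> 0" using B(2,5) x by (simp add: sgn_zero_iff)
  have "isCont f x" using B continuous_on_eq_continuous_at by blast
  then have "((\<lambda>y. sgn (f y)) \<longlongrightarrow> sgn (f x)) (at x)"
    using fx by (intro tendsto_intros) (auto simp: isCont_def)
  then have "eventually (\<lambda>y. dist (sgn (f y)) (sgn (f x)) < 1) (at x)"
    by (rule tendstoD) simp
  then have "eventually (\<lambda>y. sgn (f y) = sgn (f x)) (at x)"
    by eventually_elim (use fx in \<open>auto simp: dist_real_def sgn_if split: if_splits\<close>)
  then have "eventually (\<lambda>y. sgn (f y) = sgn (f x)) (at x within S3)"
    by (rule filter_leD[OF at_le[OF subset_UNIV]])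
  moreover have "eventually (\<lambda>y. y \<in> S3 \<and> y \<in> B) (at x within S3)"
    using B(1,2) by (auto simp: eventually_at_topological)
  ultimately show "eventually (\<lambda>y. side S N y = side S N x) (at x within S3)"
    by eventually_elim (use B x in auto)
qed

lemma crossing_map_nonpos_Reals:
  assumes "x \<in> S3 - K"
  shows "crossing_map S N x \<in> \<real>\<^sub>\<le>\<^sub>0 \<longleftrightarrow> x \<in> S" "crossing_map S N x \<noteq> 0"
proof -
  have "crossing_map S N x \<in> \<real>\<^sub>\<le>\<^sub>0 \<and> crossing_map S N x \<noteq> 0" if "x \<in> S"
    using off_collar_pos[of x] that assms
    by (auto simp: crossing_map_def complex_nonpos_Reals_iff complex_eq_iff)
  moreover have "crossing_map S N x \<notin> \<real>\<^sub>\<le>\<^sub>0" if "x \<notin> S"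
  proof -
    have d: "infdist x S > 0" using S that by (intro infdist_pos_not_in_closed) auto
    show ?thesis
    proof (cases "x \<in> off_collar S N")
      case True
      then show ?thesis using d by (simp add: crossing_map_def complex_nonpos_Reals_iff)
    next
      case False
      then have "infdist x (off_collar S N) > 0" using closed_off_collar
        by (intro infdist_pos_not_in_closed) (auto simp: off_collar_def)
      then show ?thesis
        using d side_locally_constant(1)[OF _ that False] assms by (auto simp: crossing_map_def complex_nonpos_Reals_iff)
    qed
  qed
  ultimately show "crossing_map S N x \<in> \<real>\<^sub>\<le>\<^sub>0 \<longleftrightarrow> x \<in> S" "crossing_map S N x \<noteq> 0"
    by (blast, metis nonpos_Reals_zero_I)
qed

lemma continuous_on_crossing_map: "continuous_on (S3 - K) (crossing_map S N)"
proof (unfold continuous_on_def, rule ballI)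
  fix x assume x: "x \<in> S3 - K"
  define P where "P = (\<lambda>y. infdist y S * infdist y (off_collar S N))"
  have P: "(P \<longlongrightarrow> P x) (at x within A)" for A
    unfolding P_def by (intro tendsto_intros)
  have "((\<lambda>y. side S N y * P y) \<longlongrightarrow> side S N x * P x) (at x within S3 - K)"
  proof (cases "x \<in> S \<or> x \<in> off_collar S N")
    case True
    then have P0: "P x = 0" by (auto simp: P_def)
    have "((\<lambda>y. side S N y * P y) \<longlongrightarrow> 0) (at x within S3 - K)"
    proof (rule Lim_null_comparison)
      show "(P \<longlongrightarrow> 0) (at x within S3 - K)" using P P0 by metis
      show "eventually (\<lambda>y. norm (side S N y * P y) \<le> P y) (at x within S3 - K)"
        by (auto simp: P_def side_def abs_mult sgn_if infdist_nonneg)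
    qed
    then show ?thesis by (simp add: P0)
  next
    case False
    then have "eventually (\<lambda>y. side S N y = side S N x) (at x within S3 - K)"
      using side_locally_constant(2)[of x] x by (auto simp: eventually_at_topological)
    then have "eventually (\<lambda>y. side S N x * P y = side S N y * P y) (at x within S3 - K)"
      by eventually_elim simp
    moreover have "((\<lambda>y. side S N x * P y) \<longlongrightarrow> side S N x * P x) (at x within S3 - K)"
      by (intro tendsto_intros P)
    ultimately show ?thesis by (rule Lim_transform_eventually[rotated])
  qed
  then show "(crossing_map S N \<longlongrightarrow> crossing_map S N x) (at x within S3 - K)"
    unfolding crossing_map_def P_def
    by (intro tendsto_Complex tendsto_diff tendsto_infdist tendsto_ident_at)
qed

text \<open>The direction of crossing. It is stated for an arbitrary local equation, in order to be applied
  to the equation given near a boundary point.\<close>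

lemma sgn_Im_crossing_map:
  assumes f: "local_equation S N U f" and q: "q \<in> S - K" "q \<in> U"
  shows "eventually (\<lambda>x. x \<in> S3 \<longrightarrow> sgn (Im (crossing_map S N x)) = sgn (f x)) (nhds q)"
proof -
  obtain \<delta> where \<delta>: "\<delta> > 0" "ball q \<delta> \<subseteq> U" "\<And>x. x \<in> S3 \<inter> ball q \<delta> \<Longrightarrow> side S N x = sgn (f x)"
    using side_eq_sgn[OF f] q by blast
  have "eventually (\<lambda>x. x \<in> ball q \<delta>) (nhds q)" using \<delta>(1) by (intro eventually_nhds_in_open) auto
  moreover have "eventually (\<lambda>x. x \<in> - off_collar S N) (nhds q)"
    using off_collar_disjoint[OF q(1)] closed_off_collar by (intro eventually_nhds_in_open) auto
  ultimately show ?thesis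
  proof eventually_elim
    case (elim x)
    have T: "infdist x (off_collar S N) > 0" using elim closed_off_collar
      by (intro infdist_pos_not_in_closed) (auto simp: off_collar_def)
    show ?case
    proof
      assume x: "x \<in> S3"
      show "sgn (Im (crossing_map S N x)) = sgn (f x)"
      proof (cases "x \<in> S")
        case True
        then have "f x = 0" using f \<delta>(2) elim by (auto simp: local_equation_def)
        then show ?thesis using True by (simp add: crossing_map_def)
      next
        case False
        then have "infdist x S > 0" using S by (intro infdist_pos_not_in_closed) auto
        then show ?thesis using T \<delta>(3)[of x] x elim by (simp add: crossing_map_def sgn_mult)
      qed
    qed
  qed
qed

end

section \<open>Logarithms along loops\<close>

lemma continuous_logs_differ_by_constant:
  fixes a b :: "'a::topological_space \<Rightarrow> complex"
  assumes T: "connected T" "continuous_on T a" "continuous_on T b"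
    and e: "\<And>t. t \<in> T \<Longrightarrow> exp (a t) = exp (b t)" and st: "s \<in> T" "t \<in> T"
  shows "a t - a s = b t - b s"
proof -
  have "(\<lambda>t. a t - b t) constant_on T"
  proof (rule continuous_discrete_range_constant[OF T(1)])
    show "continuous_on T (\<lambda>t. a t - b t)" by (intro continuous_intros T)
    fix x assume x: "x \<in> T"
    have "2 * pi \<le> norm ((a y - b y) - (a x - b x))" if y: "y \<in> T" "a y - b y \<noteq> a x - b x" for y
    proof -
      have "exp ((a y - b y) - (a x - b x)) = 1"
        using e[OF x] e[OF y(1)] by (simp add: exp_diff)
      then obtain n :: int where n: "Re ((a y - b y) - (a x - b x)) = 0" "Im ((a y - b y) - (a x - b x)) = of_int (2 * n) * pi"
        unfolding exp_eq_1 by blast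
      then have "n \<noteq> 0" using y(2) by (auto simp: complex_eq_iff)
      then have "1 \<le> \<bar>real_of_int n\<bar>" by linarith
      then have "2 * pi * 1 \<le> 2 * pi * \<bar>real_of_int n\<bar>" by (intro mult_left_mono) auto
      also have "\<dots> = \<bar>Im ((a y - b y) - (a x - b x))\<bar>" unfolding n(2) by (simp add: abs_mult)
      also have "\<dots> \<le> norm ((a y - b y) - (a x - b x))" by (rule abs_Im_le_cmod)
      finally show ?thesis by simp
    qed
    then show "\<exists>e>0. \<forall>y. y \<in> T \<and> a y - b y \<noteq> a x - b x \<longrightarrow> e \<le> norm ((a y - b y) - (a x - b x))"
      by (intro exI[of _ "2 * pi"]) auto
  qed
  then show ?thesis using st by (auto simp: constant_on_def algebra_simps)
qed

text \<open>Principal logarithms of two functions jump at the negative real axis; when both functions reach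
  it at the same times and from the same side, the jumps cancel.\<close>

lemma continuous_Ln_difference:
  fixes A B :: "real \<Rightarrow> complex"
  assumes A: "continuous_on T A" and B: "continuous_on T B"
    and nz: "\<And>t. t \<in> T \<Longrightarrow> A t \<noteq> 0" "\<And>t. t \<in> T \<Longrightarrow> B t \<noteq> 0"
    and iff: "\<And>t. t \<in> T \<Longrightarrow> A t \<in> \<real>\<^sub>\<le>\<^sub>0 \<longleftrightarrow> B t \<in> \<real>\<^sub>\<le>\<^sub>0"
    and sg: "\<And>t. t \<in> T \<Longrightarrow> A t \<in> \<real>\<^sub>\<le>\<^sub>0 \<Longrightarrow> eventually (\<lambda>u. sgn (Im (A u)) = sgn (Im (B u))) (at t within T)"
  shows "continuous_on T (\<lambda>t. Ln (A t) - Ln (B t))"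
proof (unfold continuous_on_def, rule ballI)
  fix t assume t: "t \<in> T"
  have At: "(A \<longlongrightarrow> A t) (at t within T)" and Bt: "(B \<longlongrightarrow> B t) (at t within T)"
    using A B t by (auto simp: continuous_on_def)
  show "((\<lambda>t. Ln (A t) - Ln (B t)) \<longlongrightarrow> Ln (A t) - Ln (B t)) (at t within T)"
  proof (cases "A t \<in> \<real>\<^sub>\<le>\<^sub>0")
    case False
    then show ?thesis using iff[OF t] by (intro tendsto_diff tendsto_Ln At Bt) auto
  next
    case True
    then have neg: "Im (A t) = 0" "Re (A t) < 0" "Im (B t) = 0" "Re (B t) < 0"
      using iff[OF t] nz[OF t] by (auto simp: complex_nonpos_Reals_iff complex_eq_iff order.order_iff_strict)
    \<comment> \<open>both arguments lie in the left half plane on the same side of the axis\<close>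
    have Ln: "Ln (A t) - Ln (B t) = Ln (A t / B t)"
      if "sgn (Im (A t)) = sgn (Im (B t))" "Re (A t) < 0" "Re (B t) < 0" for t
    proof -
      have nz': "A t \<noteq> 0" "B t \<noteq> 0" using that by auto
      have "Im (Ln (A t)) > 0 \<longleftrightarrow> Im (Ln (B t)) > 0"
        using that nz' Im_Ln_pos_le[of "A t"] Im_Ln_pos_le[of "B t"]
          Im_Ln_eq_0[of "A t"] Im_Ln_eq_0[of "B t"] Im_Ln_le_pi[OF nz'(1)] Im_Ln_le_pi[OF nz'(2)]
        by (auto simp: sgn_if order.order_iff_strict split: if_splits)
      then have "\<bar>Im (Ln (A t) - Ln (B t))\<bar> < pi"
        using mpi_less_Im_Ln[OF nz'(1)] Im_Ln_le_pi[OF nz'(1)] mpi_less_Im_Ln[OF nz'(2)] Im_Ln_le_pi[OF nz'(2)]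
        by (auto simp: abs_if not_less)
      then have "Ln (exp (Ln (A t) - Ln (B t))) = Ln (A t) - Ln (B t)" by (intro Ln_exp) auto
      then show ?thesis using nz' by (simp add: exp_diff)
    qed
    have "((\<lambda>u. Ln (A u / B u)) \<longlongrightarrow> Ln (A t / B t)) (at t within T)"
    proof (intro tendsto_Ln tendsto_divide At Bt)
      show "B t \<noteq> 0" using nz t by blast
      have "A t / B t = of_real (Re (A t) / Re (B t))" using neg by (simp add: complex_eq_iff Re_divide Im_divide power2_eq_square)
      moreover have "Re (A t) / Re (B t) > 0" using neg by (simp add: divide_neg_neg)
      ultimately show "A t / B t \<notin> \<real>\<^sub>\<le>\<^sub>0" by (simp add: complex_nonpos_Reals_iff)
    qed
    moreover have "eventually (\<lambda>u. Re (A u) < 0) (at t within T)" "eventually (\<lambda>u. Re (B u) < 0) (at t within T)"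
      using neg by (auto intro!: order_tendstoD(2)[OF tendsto_Re[OF At]] order_tendstoD(2)[OF tendsto_Re[OF Bt]])
    then have "eventually (\<lambda>u. Ln (A u / B u) = Ln (A u) - Ln (B u)) (at t within T)"
      using sg[OF t True] by eventually_elim (use Ln in auto)
    ultimately show ?thesis using Ln[of t] neg by (auto intro: Lim_transform_eventually)
  qed
qed

text \<open>The map \<open>u \<mapsto> a u + b u*\<close> is an invertible real linear map of the plane if \<open>|a| \<noteq> |b|\<close>, and the image
  of the unit circle turns once, in the direction of the dominant term. The loop \<open>B\<close> stays closer to
  that image than the latter to \<open>0\<close>.\<close>

lemma log_near_real_linear_loop:
  fixes B :: "real \<Rightarrow> complex"
  assumes B: "continuous_on {0..2 * pi} B" "B (2 * pi) = B 0"
    and near: "\<And>t. t \<in> {0..2 * pi} \<Longrightarrow> cmod (B t - (a * cis t + b * cis (- t))) < \<bar>cmod a - cmod b\<bar>"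
  obtains l where "continuous_on {0..2 * pi} l" "\<And>t. t \<in> {0..2 * pi} \<Longrightarrow> B t = exp (l t)"
    "l (2 * pi) - l 0 \<noteq> 0"
proof -
  have main: "\<exists>l. continuous_on {0..2 * pi} l \<and> (\<forall>t\<in>{0..2 * pi}. B t = exp (l t)) \<and> l (2 * pi) - l 0 \<noteq> 0"
    if k: "k = 1 \<or> k = (-1::real)" and ab: "cmod a > cmod b"
      and near: "\<And>t. t \<in> {0..2 * pi} \<Longrightarrow> cmod (B t - (a * cis (k * t) + b * cis (- k * t))) < cmod a - cmod b"
    for k a b
  proof -
    have a0: "a \<noteq> 0" using ab by auto
    have pos: "B t / (a * cis (k * t)) \<notin> \<real>\<^sub>\<le>\<^sub>0" if t: "t \<in> {0..2 * pi}" for t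
    proof -
      have "cmod (B t - a * cis (k * t)) \<le> cmod (B t - (a * cis (k * t) + b * cis (- k * t))) + cmod (b * cis (- k * t))"
        using norm_triangle_ineq[of "B t - (a * cis (k * t) + b * cis (- k * t))" "b * cis (- k * t)"] by simp
      then have "cmod (B t - a * cis (k * t)) < cmod a" using near[OF t] by (simp add: norm_mult)
      moreover have "B t / (a * cis (k * t)) - 1 = (B t - a * cis (k * t)) / (a * cis (k * t))"
        using a0 by (simp add: field_simps)
      ultimately have "cmod (B t / (a * cis (k * t)) - 1) < 1"
        using a0 by (simp add: norm_divide norm_mult)
      then have "Re (B t / (a * cis (k * t))) > 0"
        using abs_Re_le_cmod[of "B t / (a * cis (k * t)) - 1"] by simp
      then show ?thesis by (auto simp: complex_nonpos_Reals_iff)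
    qed
    \<comment> \<open>divided by the dominant term, the loop stays in the right half plane\<close>
    define l where "l = (\<lambda>t. Ln (B t / (a * cis (k * t))) + Ln a + \<i> * of_real (k * t))"
    have "continuous_on {0..2 * pi} l"
      unfolding l_def using pos a0 by (intro continuous_intros B) auto
    moreover have "B t = exp (l t)" if t: "t \<in> {0..2 * pi}" for t
    proof -
      have "B t \<noteq> 0" using pos[OF t] by auto
      then show ?thesis using a0 by (simp add: l_def exp_add cis_conv_exp)
    qed
    moreover have "cis (k * (2 * pi)) = 1" using k by (auto simp: complex_eq_iff)
    then have "l (2 * pi) - l 0 \<noteq> 0" using k B(2) by (auto simp: l_def)
    ultimately show ?thesis by blast
  qed
  consider "cmod a > cmod b" | "cmod b > cmod a" using near[of 0] norm_ge_zero[of "B 0 - (a * cis 0 + b * cis (- 0))"] by fastforce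
  then show thesis
  proof cases
    case 1
    then show ?thesis using main[of 1 b a] near that by (auto simp: abs_if)
  next
    case 2
    then show ?thesis using main[of "-1" a b] near that by (auto simp: abs_if add.commute)
  qed
qed

text \<open>The universal covering of the complement of the Hopf circle.\<close>

definition solid_torus_param :: "complex \<times> real \<Rightarrow> complex \<times> complex" where
  "solid_torus_param = (\<lambda>(z, \<phi>). (z, of_real (sqrt (1 - (cmod z)\<^sup>2)) * cis \<phi>))"

lemma solid_torus_param_in:
  assumes "cmod z < 1"
  shows "solid_torus_param (z, \<phi>) \<in> S3 - hopf_circle"
proof -
  have "(cmod z)\<^sup>2 < 1" using assms by (simp add: abs_square_less_1)
  then show ?thesis
    by (auto simp: solid_torus_param_def S3_iff hopf_circle_def norm_mult cis_zero)
qed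

text \<open>The covering space is convex, so a logarithm exists there; two logarithms that differ by a deck
  translation differ by a constant.\<close>

lemma log_on_solid_torus:
  assumes H: "continuous_on (S3 - hopf_circle) H" "\<And>x. x \<in> S3 - hopf_circle \<Longrightarrow> H x \<noteq> (0::complex)"
  obtains G \<kappa> where "continuous_on (ball 0 1 \<times> UNIV) G"
    "\<And>z \<phi>. cmod z < 1 \<Longrightarrow> exp (G (z, \<phi>)) = H (solid_torus_param (z, \<phi>))"
    "\<And>z \<phi> m. cmod z < 1 \<Longrightarrow> G (z, \<phi> + 2 * pi * of_int m) = G (z, \<phi>) + of_int m * \<kappa>"
proof -
  define A where "A = ball (0::complex) 1 \<times> (UNIV :: real set)"
  have A: "convex A" "connected A" unfolding A_def by (auto intro!: convex_Times convex_connected)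
  have cp: "continuous_on A solid_torus_param"
    unfolding solid_torus_param_def case_prod_unfold
    by (intro continuous_intros)
  have im: "solid_torus_param x \<in> S3 - hopf_circle" if "x \<in> A" for x
    using that solid_torus_param_in by (auto simp: A_def)
  obtain G where G: "continuous_on A G" "\<And>x. x \<in> A \<Longrightarrow> H (solid_torus_param x) = exp (G x)"
  proof (rule continuous_logarithm_on_contractible)
    show "continuous_on A (\<lambda>x. H (solid_torus_param x))"
      by (rule continuous_on_compose2[OF H(1) cp]) (use im in auto)
    show "contractible A" by (rule convex_imp_contractible[OF A(1)])
    show "H (solid_torus_param x) \<noteq> 0" if "x \<in> A" for x using H(2) im that by blast
  qed blast
  define \<kappa> where "\<kappa> = G (0, 2 * pi) - G (0, 0)"
  have step: "G (z, \<phi> + 2 * pi) = G (z, \<phi>) + \<kappa>" if z: "cmod z < 1" for z \<phi>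
  proof -
    have "G (fst (z, \<phi>), snd (z, \<phi>) + 2 * pi) - G (fst (0::complex, 0::real), snd (0::complex, 0::real) + 2 * pi) =
        G (z, \<phi>) - G (0, 0)"
    proof (rule continuous_logs_differ_by_constant[where T = A and a = "\<lambda>x. G (fst x, snd x + 2 * pi)"
          and b = G and s = "(0, 0)" and t = "(z, \<phi>)"])
      show "continuous_on A (\<lambda>x. G (fst x, snd x + 2 * pi))"
        by (intro continuous_on_compose2[OF G(1)] continuous_intros) (auto simp: A_def)
      have periodic: "cis (u + 2 * pi) = cis u" for u by (simp add: complex_eq_iff)
      fix x assume "x \<in> A"
      moreover then have "(fst x, snd x + 2 * pi) \<in> A" by (auto simp: A_def)
      ultimately show "exp (G (fst x, snd x + 2 * pi)) = exp (G x)"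
        using periodic by (simp flip: G(2) add: solid_torus_param_def case_prod_unfold)
    qed (use z A G in \<open>auto simp: A_def\<close>)
    then show ?thesis by (simp add: \<kappa>_def algebra_simps)
  qed
  have nat: "G (z, \<phi> + 2 * pi * of_nat m) = G (z, \<phi>) + of_nat m * \<kappa>" if z: "cmod z < 1" for z \<phi> m
  proof (induction m)
    case (Suc m)
    then show ?case using step[OF z, of "\<phi> + 2 * pi * of_nat m"] by (simp add: algebra_simps)
  qed simp
  have "G (z, \<phi> + 2 * pi * of_int m) = G (z, \<phi>) + of_int m * \<kappa>" if z: "cmod z < 1" for z \<phi> m
  proof (cases m rule: int_cases2)
    case (nonneg k)
    then show ?thesis using nat[OF z] by simp
  next
    case (nonpos k)
    then show ?thesis using nat[OF z, of "\<phi> + 2 * pi * of_int m" k] by simp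
  qed
  then show thesis using that[of G \<kappa>] G unfolding A_def by auto
qed

section \<open>Seifert framings of the Hopf circle are unlinked\<close>

text \<open>For unit vectors \<open>z\<close> and \<open>v\<close>, the point of the sphere at height \<open>\<epsilon>\<close> over the point \<open>(z, 0)\<close> of the Hopf
  circle, in the direction \<open>v\<close>. With moving \<open>z\<close> these are curves parallel to the circle, with moving
  \<open>v\<close> meridians.\<close>

definition parallel :: "real \<Rightarrow> complex \<Rightarrow> complex \<Rightarrow> complex \<times> complex" where
  "parallel \<epsilon> z v = (of_real (sqrt (1 - \<epsilon>\<^sup>2)) * z, of_real \<epsilon> * v)"

lemma parallel_properties:
  assumes "0 < \<epsilon>" "\<epsilon> < 1" "cmod z = 1" "cmod v = 1"
  shows "parallel \<epsilon> z v \<in> S3 - hopf_circle" "norm (parallel \<epsilon> z v - (z, 0)) \<le> 2 * \<epsilon>"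
    "cmod (fst (parallel \<epsilon> z v)) < 1" "cmod (fst (parallel \<epsilon> z v) - z) \<le> \<epsilon>\<^sup>2"
    "parallel \<epsilon> z (cis \<phi>) = solid_torus_param (fst (parallel \<epsilon> z v), \<phi>)"
proof -
  have "\<epsilon>\<^sup>2 < 1" using assms by (simp add: abs_square_less_1)
  moreover have "\<epsilon>\<^sup>2 \<le> \<epsilon>" using assms by (simp add: power2_eq_square mult_left_le)
  ultimately have e2: "\<epsilon>\<^sup>2 < 1" "\<epsilon>\<^sup>2 \<le> \<epsilon>" by auto
  define r where "r = sqrt (1 - \<epsilon>\<^sup>2)"
  have r: "0 \<le> r" "r\<^sup>2 = 1 - \<epsilon>\<^sup>2" "r < 1" using e2 assms by (auto simp: r_def real_sqrt_lt_1_iff)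
  have "(1 - r) * 1 \<le> (1 - r) * (1 + r)" using r by (intro mult_left_mono) auto
  also have "\<dots> = \<epsilon>\<^sup>2" using r(2) by (simp add: algebra_simps power2_eq_square)
  finally have r1: "1 - r \<le> \<epsilon>\<^sup>2" by simp
  show "parallel \<epsilon> z v \<in> S3 - hopf_circle"
    using assms r by (auto simp: parallel_def S3_iff hopf_circle_def norm_mult r_def[symmetric] power_mult_distrib)
  show "cmod (fst (parallel \<epsilon> z v)) < 1"
    using assms r by (simp add: parallel_def norm_mult r_def[symmetric])
  have "fst (parallel \<epsilon> z v) - z = of_real (r - 1) * z" by (simp add: parallel_def r_def algebra_simps)
  then have "cmod (fst (parallel \<epsilon> z v) - z) = \<bar>r - 1\<bar> * cmod z" by (simp only: norm_mult norm_of_real)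
  then show f: "cmod (fst (parallel \<epsilon> z v) - z) \<le> \<epsilon>\<^sup>2" using r r1 assms by simp
  have "norm (parallel \<epsilon> z v - (z, 0)) \<le> cmod (fst (parallel \<epsilon> z v) - z) + cmod (snd (parallel \<epsilon> z v))"
    using norm_Pair_le[of "fst (parallel \<epsilon> z v) - z" "snd (parallel \<epsilon> z v)"] by (simp add: parallel_def)
  also have "\<dots> \<le> \<epsilon>\<^sup>2 + \<epsilon>" using f assms by (simp add: parallel_def norm_mult)
  finally show "norm (parallel \<epsilon> z v - (z, 0)) \<le> 2 * \<epsilon>" using e2 by simp
  have "1 - (cmod (fst (parallel \<epsilon> z v)))\<^sup>2 = \<epsilon>\<^sup>2"
    using assms r by (simp add: parallel_def norm_mult r_def[symmetric])
  then show "parallel \<epsilon> z (cis \<phi>) = solid_torus_param (fst (parallel \<epsilon> z v), \<phi>)"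
    using assms by (simp add: solid_torus_param_def parallel_def)
qed

lemma gradient_along_zero_curve:
  assumes "open U" "C1_with_gradient U f F" "\<gamma> t \<in> U" "(\<gamma> has_vector_derivative \<gamma>') (at t)"
    and "\<And>x. x \<in> range \<gamma> \<inter> U \<Longrightarrow> f x = 0"
  shows "inner (F (\<gamma> t)) \<gamma>' = 0"
proof -
  have "(f has_derivative (\<lambda>h. inner h (F (\<gamma> t)))) (at (\<gamma> t))"
    using assms by (auto simp: C1_with_gradient_def gderiv_def)
  then have "(f \<circ> \<gamma> has_derivative (\<lambda>h. inner h (F (\<gamma> t))) \<circ> (\<lambda>h. h *\<^sub>R \<gamma>')) (at t)"
    using assms(4) unfolding has_vector_derivative_def by (intro diff_chain_at)
  then have D: "DERIV (f \<circ> \<gamma>) t :> inner (F (\<gamma> t)) \<gamma>'"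
    by (simp add: has_field_derivative_def o_def inner_commute mult_commute_abs)
  have "isCont \<gamma> t" using assms(4) by (rule has_vector_derivative_continuous)
  then have "eventually (\<lambda>u. \<gamma> u \<in> U) (nhds t)"
    using assms(1,3) by (auto simp: isCont_def tendsto_def at_within_def[symmetric] eventually_at_filter
      intro: eventually_mono topological_tendstoD dest!: tendsto_at_iff_tendsto_nhds[THEN iffD1])
  then obtain d where d: "d > 0" "\<And>u. dist u t < d \<Longrightarrow> \<gamma> u \<in> U" unfolding eventually_nhds_metric by blast
  show ?thesis
    by (rule DERIV_local_const[OF D d(1)]) (use d assms(3,5) in \<open>auto simp: dist_real_def abs_minus_commute\<close>)
qed

locale hopf_seifert_surface =
  fixes \<gamma> \<gamma>' :: "real \<Rightarrow> complex \<times> complex" and S N z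
  assumes seifert: "seifert_surface \<gamma> \<gamma>' S N" and range: "range \<gamma> = hopf_circle"
    and \<gamma>: "\<And>t. \<gamma> t = (z t, 0)" "\<And>t. cmod (z t) = 1"
    and \<gamma>': "\<And>t. \<exists>a>0. \<gamma>' t = (of_real a * \<i> * z t, 0)"
    and D: "\<And>t. (\<gamma> has_vector_derivative \<gamma>' t) (at t)"
begin

lemma seifert_basic:
  "closed S" "S \<noteq> {}" "S \<subseteq> S3" "continuous_on S N" "p \<in> S \<Longrightarrow> N p \<in> tangent_S3 p \<and> norm (N p) = 1"
  "\<gamma> t \<in> S"
proof -
  have "compact S \<and> range \<gamma> \<subseteq> S \<and> S \<subseteq> S3 \<and> continuous_on S N \<and>
    (\<forall>p\<in>S. N p \<in> tangent_S3 p \<and> norm (N p) = 1)"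
    using seifert unfolding seifert_surface_def by (elim conjE) (intro conjI; assumption)
  then show "closed S" "S \<noteq> {}" "S \<subseteq> S3" "continuous_on S N"
    "p \<in> S \<Longrightarrow> N p \<in> tangent_S3 p \<and> norm (N p) = 1" "\<gamma> t \<in> S"
    by (auto simp: compact_imp_closed)
qed

lemma seifert_boundary_equations:
  obtains U f F g G where "open U" "\<gamma> t \<in> U" "C1_with_gradient U f F" "C1_with_gradient U g G"
    "S \<inter> U = {x \<in> S3 \<inter> U. f x = 0 \<and> g x \<ge> 0}"
    "range \<gamma> \<inter> U = {x \<in> S3 \<inter> U. f x = 0 \<and> g x = 0}"
    "\<And>x. x \<in> S \<inter> U \<Longrightarrow> positive_conormal F N x"
    "\<exists>w\<in>surface_tangent N (\<gamma> t). inner (G (\<gamma> t)) w < 0"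
proof -
  have "\<forall>p\<in>range \<gamma>. \<exists>U f F g G. open U \<and> p \<in> U \<and> C1_with_gradient U f F \<and> C1_with_gradient U g G \<and>
        S \<inter> U = {x \<in> S3 \<inter> U. f x = 0 \<and> g x \<ge> 0} \<and>
        range \<gamma> \<inter> U = {x \<in> S3 \<inter> U. f x = 0 \<and> g x = 0} \<and>
        (\<forall>x\<in>S \<inter> U. positive_conormal F N x) \<and>
        (\<forall>t. \<gamma> t \<in> U \<longrightarrow> (\<exists>w\<in>surface_tangent N (\<gamma> t). inner (G (\<gamma> t)) w < 0) \<and>
           (\<forall>w\<in>surface_tangent N (\<gamma> t). inner (G (\<gamma> t)) w < 0 \<longrightarrow> det4 (\<gamma> t) (N (\<gamma> t)) w (\<gamma>' t) > 0))"
    using seifert unfolding seifert_surface_def by (elim conjE)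
  from bspec[OF this rangeI, of t] show thesis
    by (elim exE conjE)
      (rule that, assumption+, erule (1) bspec, drule spec[of _ t], drule (1) mp, erule conjunct1)
qed

lemma seifert_interior_equation:
  assumes "p \<in> S - hopf_circle"
  shows "\<exists>U f. p \<in> U \<and> local_equation S N U f"
proof -
  have "\<forall>p\<in>S - range \<gamma>. \<exists>U f F. open U \<and> p \<in> U \<and> C1_with_gradient U f F \<and>
        S \<inter> U = {x \<in> S3 \<inter> U. f x = 0} \<and> (\<forall>x\<in>S \<inter> U. positive_conormal F N x)"
    using seifert unfolding seifert_surface_def by (elim conjE)
  moreover have "p \<in> S - range \<gamma>" using assms range by simp
  ultimately have "\<exists>U f F. open U \<and> p \<in> U \<and> C1_with_gradient U f F \<and>
        S \<inter> U = {x \<in> S3 \<inter> U. f x = 0} \<and> (\<forall>x\<in>S \<inter> U. positive_conormal F N x)"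
    by (rule bspec)
  then show ?thesis unfolding local_equation_def
    by (elim exE conjE, intro exI conjI) assumption+
qed

sublocale cooriented_surface S N hopf_circle
  by unfold_locales (use seifert_basic seifert_interior_equation in blast)+

lemma orthogonal_to_hopf_circle:
  assumes "inner (v, w) (\<gamma>' t) = 0"
  shows "Im (cnj v * z t) = 0"
proof -
  obtain a where a: "a > 0" "\<gamma>' t = (of_real a * \<i> * z t, 0)" using \<gamma>' by blast
  have "inner (v, w) (\<gamma>' t) = - a * Im (cnj v * z t)" unfolding a(2) inner_pair
    by (simp add: algebra_simps)
  then show ?thesis using assms a(1) by simp
qed

lemma tangent_and_orthogonal_to_hopf_circle:
  assumes "(v, w) \<in> tangent_S3 (\<gamma> t)" "inner (v, w) (\<gamma>' t) = 0"
  shows "v = 0"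
proof -
  have "Re (cnj v * z t) = 0" using assms(1) unfolding tangent_S3_def \<gamma>(1) inner_pair by (simp add: algebra_simps)
  then have "cnj v * z t = 0" using orthogonal_to_hopf_circle[OF assms(2)] by (simp add: complex_eq_iff)
  then show ?thesis using \<gamma>(2)[of t] by auto
qed

text \<open>The equation of the surface vanishes along the circle, so its conormal annihilates the velocity;
  being tangent to the sphere as well, the normal lies in the plane of the second coordinate.\<close>

lemma seifert_normal_on_boundary:
  shows "fst (N (\<gamma> t)) = 0" "cmod (snd (N (\<gamma> t))) = 1"
proof -
  obtain U f F g where U: "open U" "\<gamma> t \<in> U" "C1_with_gradient U f F"
    "range \<gamma> \<inter> U = {x \<in> S3 \<inter> U. f x = 0 \<and> g x = (0::real)}"
    and pos: "\<And>x. x \<in> S \<inter> U \<Longrightarrow> positive_conormal F N x"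
    by (rule seifert_boundary_equations[of t]) (rule that, assumption+)
  have z: "inner (F (\<gamma> t)) (\<gamma>' t) = 0"
    by (rule gradient_along_zero_curve[OF U(1,3,2) D]) (use U(4) in blast)
  obtain a where a: "\<gamma>' t = (of_real a * \<i> * z t, 0)" using \<gamma>' by blast
  have "\<gamma>' t \<in> tangent_S3 (\<gamma> t)"
    by (simp add: tangent_S3_def \<gamma>(1) a inner_pair algebra_simps)
  then have o: "inner (N (\<gamma> t)) (\<gamma>' t) = 0"
    using pos[of "\<gamma> t"] z U(2) seifert_basic(6)[of t] by (auto simp: positive_conormal_def)
  have b: "N (\<gamma> t) \<in> tangent_S3 (\<gamma> t)" "norm (N (\<gamma> t)) = 1" using seifert_basic by auto
  show f: "fst (N (\<gamma> t)) = 0"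
    using tangent_and_orthogonal_to_hopf_circle[of "fst (N (\<gamma> t))" "snd (N (\<gamma> t))" t] o b(1) by simp
  show "cmod (snd (N (\<gamma> t))) = 1" using b(2) f by (simp add: norm_prod_def)
qed

text \<open>Near a point of the circle, the equation \<open>f\<close> at height \<open>\<epsilon>\<close> in the direction \<open>\<plusminus>N\<close> is about \<open>\<plusminus>c \<epsilon>\<close>,
  hence not \<open>0\<close>. Compactness gives a common bound for \<open>\<epsilon>\<close>.\<close>

lemma parallel_avoids_seifert_surface:
  assumes v: "continuous_on {a..b} v" "a \<le> b"
    and vN: "\<And>t. t \<in> {a..b} \<Longrightarrow> v t = snd (N (\<gamma> t)) \<or> v t = - snd (N (\<gamma> t))"
  shows "\<exists>e>0. \<forall>t\<in>{a..b}. \<forall>\<epsilon>. 0 < \<epsilon> \<longrightarrow> \<epsilon> < e \<longrightarrow> parallel \<epsilon> (z t) (v t) \<notin> S"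
proof -
  define P where "P = (\<lambda>l u. \<exists>e>0. \<forall>t\<in>{l..u} \<inter> {a..b}. \<forall>\<epsilon>. 0 < \<epsilon> \<longrightarrow> \<epsilon> < e \<longrightarrow> parallel \<epsilon> (z t) (v t) \<notin> S)"
  have v1: "cmod (v t) = 1" if "t \<in> {a..b}" for t
    using vN[OF that] seifert_normal_on_boundary(2)[of t] by (metis norm_minus_cancel)
  have "P a b" using v(2)
  proof (induction rule: Bolzano)
    case (trans l m u)
    then obtain e e' where e: "e > 0" "\<forall>t\<in>{l..m} \<inter> {a..b}. \<forall>\<epsilon>. 0 < \<epsilon> \<longrightarrow> \<epsilon> < e \<longrightarrow> parallel \<epsilon> (z t) (v t) \<notin> S"
      "e' > 0" "\<forall>t\<in>{m..u} \<inter> {a..b}. \<forall>\<epsilon>. 0 < \<epsilon> \<longrightarrow> \<epsilon> < e' \<longrightarrow> parallel \<epsilon> (z t) (v t) \<notin> S"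
      unfolding P_def by blast
    show ?case unfolding P_def
    proof (intro exI[of _ "min e e'"] conjI ballI allI impI)
      show "min e e' > 0" using e by simp
      fix t \<epsilon> assume "t \<in> {l..u} \<inter> {a..b}" "0 < \<epsilon>" "\<epsilon> < min e e'"
      then show "parallel \<epsilon> (z t) (v t) \<notin> S" using e(2,4) by (cases "t \<le> m") auto
    qed
  next
    case (local s)
    then have s: "s \<in> {a..b}" by simp
    obtain U f F g where U: "open U" "\<gamma> s \<in> U" "C1_with_gradient U f F"
      "S \<inter> U = {x \<in> S3 \<inter> U. f x = 0 \<and> g x \<ge> (0::real)}"
      and pos: "\<And>x. x \<in> S \<inter> U \<Longrightarrow> positive_conormal F N x"
      by (rule seifert_boundary_equations[of s]) (rule that, assumption+)
    have \<gamma>S: "\<gamma> t \<in> S3" "\<gamma> t \<in> S" for t using seifert_basic by blast+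
    have "N (\<gamma> s) \<in> tangent_S3 (\<gamma> s)" using seifert_basic(5)[OF \<gamma>S(2)] by blast
    from conormal_linearization[OF U(1,2,3) \<gamma>S(1) this pos]
    obtain c where c: "c > 0" "\<And>\<eta>. \<eta> > 0 \<Longrightarrow> \<exists>\<delta>>0. ball (\<gamma> s) \<delta> \<subseteq> U \<and>
        (\<forall>x\<in>S3 \<inter> ball (\<gamma> s) \<delta>. \<forall>y\<in>S3 \<inter> ball (\<gamma> s) \<delta>. \<bar>f x - f y - c * inner (N (\<gamma> s)) (x - y)\<bar> \<le> \<eta> * norm (x - y))"
      using \<gamma>S U(2) by (metis IntI)
    obtain \<delta> where \<delta>: "\<delta> > 0" "ball (\<gamma> s) \<delta> \<subseteq> U" "\<And>x y. x \<in> S3 \<inter> ball (\<gamma> s) \<delta> \<Longrightarrow> y \<in> S3 \<inter> ball (\<gamma> s) \<delta> \<Longrightarrow>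
        \<bar>f x - f y - c * inner (N (\<gamma> s)) (x - y)\<bar> \<le> c / 4 * norm (x - y)"
      using c(2)[OF divide_pos_pos[OF c(1) zero_less_numeral]] by blast
    have "continuous (at s) \<gamma>" using D by (rule has_vector_derivative_continuous)
    then obtain d1 where d1: "d1 > 0" "\<And>t. dist t s < d1 \<Longrightarrow> dist (\<gamma> t) (\<gamma> s) < \<delta> / 2"
      using \<delta>(1) unfolding continuous_at_eps_delta by (metis half_gt_zero)
    obtain d2 where d2: "d2 > 0" "\<And>t. t \<in> {a..b} \<Longrightarrow> dist t s < d2 \<Longrightarrow> dist (v t) (v s) < 1 / 4"
      using v(1) s unfolding continuous_on_iff by (metis zero_less_divide_1_iff zero_less_numeral)
    have avoid: "parallel \<epsilon> (z t) (v t) \<notin> S"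
      if t: "t \<in> {a..b}" "dist t s < min d1 d2" and \<epsilon>: "0 < \<epsilon>" "\<epsilon> < min 1 (\<delta> / 4)" for t \<epsilon>
    proof
      let ?x = "parallel \<epsilon> (z t) (v t)"
      assume x: "?x \<in> S"
      note pf = parallel_properties[of \<epsilon> "z t" "v t"]
      have n: "norm (?x - \<gamma> t) \<le> 2 * \<epsilon>" using pf(2) \<epsilon> \<gamma> v1 t by simp
      have tb: "\<gamma> t \<in> S3 \<inter> ball (\<gamma> s) \<delta>" using d1(2)[of t] t \<delta>(1) \<gamma>S by (auto simp: dist_commute)
      have "dist (\<gamma> s) ?x \<le> dist (\<gamma> t) (\<gamma> s) + norm (?x - \<gamma> t)"
        by (metis dist_commute dist_norm dist_triangle)
      then have xb: "?x \<in> S3 \<inter> ball (\<gamma> s) \<delta>"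
        using d1(2)[of t] t \<epsilon> n x seifert_basic(3) by auto
      have "\<gamma> t \<in> S \<inter> U" "?x \<in> S \<inter> U" using x xb tb \<delta>(2) \<gamma>S by blast+
      then have f0: "f ?x = 0" "f (\<gamma> t) = 0" unfolding U(4) by blast+
      let ?\<nu> = "snd (N (\<gamma> s))"
      have ip: "inner (N (\<gamma> s)) (?x - \<gamma> t) = \<epsilon> * inner ?\<nu> (v t)"
      proof -
        have "snd (?x - \<gamma> t) = \<epsilon> *\<^sub>R v t" by (simp add: parallel_def \<gamma>(1) scaleR_conv_of_real)
        then show ?thesis unfolding inner_prod_def seifert_normal_on_boundary(1) by simp
      qed
      have "\<bar>inner ?\<nu> (v s)\<bar> = 1"
      proof -
        have "inner ?\<nu> ?\<nu> = 1" by (simp only: dot_square_norm seifert_normal_on_boundary(2)) simp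
        then show ?thesis using vN[OF s] by (metis abs_minus_cancel abs_one inner_minus_right)
      qed
      moreover have "\<bar>inner ?\<nu> (v t - v s)\<bar> \<le> 1 / 4"
        using Cauchy_Schwarz_ineq2[of ?\<nu> "v t - v s"] d2(2)[of t] t seifert_normal_on_boundary(2)[of s]
        by (simp add: dist_norm)
      ultimately have big: "\<bar>inner ?\<nu> (v t)\<bar> \<ge> 3 / 4" unfolding inner_diff_right by linarith
      have "c * (\<epsilon> * (3 / 4)) \<le> c * (\<epsilon> * \<bar>inner ?\<nu> (v t)\<bar>)"
        using big c(1) \<epsilon>(1) by (intro mult_left_mono) auto
      also have "\<dots> = \<bar>f ?x - f (\<gamma> t) - c * inner (N (\<gamma> s)) (?x - \<gamma> t)\<bar>"
        unfolding ip f0 using c(1) \<epsilon>(1) by (simp add: abs_mult)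
      also have "\<dots> \<le> c / 4 * norm (?x - \<gamma> t)" by (rule \<delta>(3)[OF xb tb])
      also have "\<dots> \<le> c / 4 * (2 * \<epsilon>)" using n c(1) by (intro mult_left_mono) auto
      finally have "c * \<epsilon> * (3 / 4) \<le> c * \<epsilon> * (1 / 2)" by simp
      moreover have "c * \<epsilon> > 0" using c(1) \<epsilon>(1) by simp
      ultimately show False by linarith
    qed
    show ?case
    proof (intro exI[of _ "min d1 d2"] conjI allI impI)
      show "0 < min d1 d2" using d1 d2 by simp
      fix l u assume lu: "l \<le> s \<and> s \<le> u \<and> u - l < min d1 d2"
      have *: "dist t s < min d1 d2" if "t \<in> {l..u}" for t
        using that lu unfolding dist_real_def by (cases "t \<le> s") auto
      show "P l u" unfolding P_def
      proof (intro exI[of _ "min 1 (\<delta> / 4)"] conjI ballI allI impI)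
        show "min 1 (\<delta> / 4) > 0" using \<delta>(1) by simp
        fix t \<epsilon> assume "t \<in> {l..u} \<inter> {a..b}" "0 < \<epsilon>" "\<epsilon> < min 1 (\<delta> / 4)"
        then show "parallel \<epsilon> (z t) (v t) \<notin> S" using * by (intro avoid) auto
      qed
    qed
  qed
  then show ?thesis unfolding P_def by simp
qed

end

context hopf_seifert_surface
begin

text \<open>Near a boundary point the surface is \<open>f = 0, g \<ge> 0\<close>, so that \<open>- g + \<i> f\<close> has the same crossings
  of the negative real axis, in the same direction, as the crossing map; the difference of the principal
  logarithms is then continuous and periodic on a meridian. On a small meridian \<open>- g + \<i> f\<close> is close to a
  real linear map, which is invertible since the differentials of \<open>f\<close> and \<open>g\<close> are independent.\<close>

lemma meridian_log_not_periodic: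
  obtains r where "0 < r" "r < 1"
    "\<forall>G. continuous_on {0..2 * pi} G \<and>
      (\<forall>\<phi>\<in>{0..2 * pi}. exp (G \<phi>) = crossing_map S N (parallel r (z 0) (cis \<phi>))) \<longrightarrow>
      G (2 * pi) \<noteq> G 0"
proof -
  obtain U f F g R where U: "open U" "\<gamma> 0 \<in> U" and f: "C1_with_gradient U f F" and g: "C1_with_gradient U g R"
    and SU: "S \<inter> U = {x \<in> S3 \<inter> U. f x = 0 \<and> g x \<ge> 0}"
    and \<gamma>U: "range \<gamma> \<inter> U = {x \<in> S3 \<inter> U. f x = 0 \<and> g x = 0}"
    and pos: "\<And>x. x \<in> S \<inter> U \<Longrightarrow> positive_conormal F N x"
    and out: "\<exists>w\<in>surface_tangent N (\<gamma> 0). inner (R (\<gamma> 0)) w < 0"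
    by (rule seifert_boundary_equations[of 0]) (rule that, assumption+)
  have p: "\<gamma> 0 \<in> S3" "\<gamma> 0 \<in> S \<inter> U" "N (\<gamma> 0) \<in> tangent_S3 (\<gamma> 0)"
    using seifert_basic(3) seifert_basic(6)[of 0] seifert_basic(5)[OF seifert_basic(6)[of 0]] U(2) by auto
  have "\<gamma> 0 \<in> range \<gamma> \<inter> U" using U(2) by blast
  then have fg0: "f (\<gamma> 0) = 0" "g (\<gamma> 0) = 0" unfolding \<gamma>U by blast+
  define \<nu> where "\<nu> = snd (N (\<gamma> 0))"
  define \<rho> where "\<rho> = snd (R (\<gamma> 0))"
  have \<nu>: "cmod \<nu> = 1" "N (\<gamma> 0) = (0, \<nu>)"
    using seifert_normal_on_boundary[of 0] by (auto simp: \<nu>_def prod_eq_iff)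
  \<comment> \<open>otherwise \<open>g\<close> would have derivative \<open>0\<close> in all directions tangent to the surface, against the existence of an outward one\<close>
  have indep: "Im (cnj \<rho> * \<nu>) \<noteq> 0"
  proof
    assume 0: "Im (cnj \<rho> * \<nu>) = 0"
    obtain w where w: "w \<in> tangent_S3 (\<gamma> 0)" "inner (N (\<gamma> 0)) w = 0" "inner (R (\<gamma> 0)) w < 0"
      using out by (auto simp: surface_tangent_def)
    have "inner (R (\<gamma> 0)) (\<gamma>' 0) = 0"
      by (rule gradient_along_zero_curve[OF U(1) g U(2) D]) (use \<gamma>U in blast)
    then have i1: "Im (cnj (fst (R (\<gamma> 0))) * z 0) = 0"
      using orthogonal_to_hopf_circle[of "fst (R (\<gamma> 0))" "snd (R (\<gamma> 0))" 0] by simp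
    have w1: "Re (cnj (z 0) * fst w) = 0"
      using w(1) by (simp add: tangent_S3_def \<gamma>(1) inner_pair)
    have zz: "z 0 * cnj (z 0) = 1" using \<gamma>(2)[of 0] by (simp add: complex_norm_square[symmetric])
    have "cnj (fst (R (\<gamma> 0))) * fst w = (cnj (fst (R (\<gamma> 0))) * z 0) * (cnj (z 0) * fst w)"
      using zz by (simp add: mult_ac)
    then have r1: "Re (cnj (fst (R (\<gamma> 0))) * fst w) = 0" using i1 w1 by (simp add: complex_eq_iff)
    have w2: "Re (cnj \<nu> * snd w) = 0" using w(2) \<nu>(2) by (simp add: inner_pair)
    have nn: "\<nu> * cnj \<nu> = 1" using \<nu>(1) by (simp add: complex_norm_square[symmetric])
    have "cnj \<rho> * snd w = (cnj \<rho> * \<nu>) * (cnj \<nu> * snd w)"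
      using nn by (simp add: mult_ac)
    then have "Re (cnj \<rho> * snd w) = 0" using 0 w2 by (simp add: complex_eq_iff)
    then show False using w(3) r1 by (simp add: inner_pair \<rho>_def)
  qed
  obtain c where c: "c > 0" and lin: "\<And>\<eta>. \<eta> > 0 \<Longrightarrow> \<exists>\<delta>>0. ball (\<gamma> 0) \<delta> \<subseteq> U \<and>
      (\<forall>x\<in>S3 \<inter> ball (\<gamma> 0) \<delta>. \<forall>y\<in>S3 \<inter> ball (\<gamma> 0) \<delta>. \<bar>f x - f y - c * inner (N (\<gamma> 0)) (x - y)\<bar> \<le> \<eta> * norm (x - y))"
    using conormal_linearization[OF U f p(1,3) pos[OF p(2)]] by blast
  \<comment> \<open>the complex linear and antilinear parts of the derivative of \<open>- g + \<i> f\<close> across the circle\<close>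
  define a where "a = (- cnj \<rho> + \<i> * of_real c * cnj \<nu>) / 2"
  define b where "b = (- \<rho> + \<i> * of_real c * \<nu>) / 2"
  have ab: "a * cis \<phi> + b * cis (- \<phi>) = Complex (- inner \<rho> (cis \<phi>)) (c * inner \<nu> (cis \<phi>))" for \<phi>
    by (simp add: a_def b_def complex_eq_iff inner_complex_def field_simps)
  have "(cmod a)\<^sup>2 - (cmod b)\<^sup>2 = - c * Im (cnj \<rho> * \<nu>)"
    unfolding cmod_power2 by (simp add: a_def b_def power2_eq_square field_simps)
  then have "cmod a \<noteq> cmod b" using c indep by auto
  then have ne: "\<bar>cmod a - cmod b\<bar> > 0" by simp
  define \<eta> where "\<eta> = \<bar>cmod a - cmod b\<bar> / 6"
  have \<eta>: "\<eta> > 0" using ne by (simp add: \<eta>_def)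
  obtain \<delta>1 where \<delta>1: "\<delta>1 > 0" "ball (\<gamma> 0) \<delta>1 \<subseteq> U"
    "\<And>x y. x \<in> S3 \<inter> ball (\<gamma> 0) \<delta>1 \<Longrightarrow> y \<in> S3 \<inter> ball (\<gamma> 0) \<delta>1 \<Longrightarrow>
      \<bar>f x - f y - c * inner (N (\<gamma> 0)) (x - y)\<bar> \<le> \<eta> * norm (x - y)"
    using lin[OF \<eta>] by blast
  obtain \<delta>2 where \<delta>2: "\<delta>2 > 0"
    "\<And>x y. x \<in> ball (\<gamma> 0) \<delta>2 \<Longrightarrow> y \<in> ball (\<gamma> 0) \<delta>2 \<Longrightarrow>
      \<bar>g x - g y - inner (R (\<gamma> 0)) (x - y)\<bar> \<le> \<eta> * norm (x - y)"
    using C1_strict_linearization[OF U g \<eta>] by blast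
  define r where "r = min (min (1 / 2) (\<eta> / (norm (R (\<gamma> 0)) + 1))) (min (\<delta>1 / 4) (\<delta>2 / 4))"
  have r: "0 < r" "r < 1" "2 * r < \<delta>1" "2 * r < \<delta>2" "r \<le> \<eta> / (norm (R (\<gamma> 0)) + 1)"
    using \<eta> \<delta>1(1) \<delta>2(1) by (auto simp: r_def add_nonneg_pos)
  have "r * norm (R (\<gamma> 0)) \<le> r * (norm (R (\<gamma> 0)) + 1)" using r(1) by (intro mult_left_mono) auto
  also have "\<dots> \<le> \<eta>" using r(5) by (simp add: pos_le_divide_eq add_nonneg_pos)
  finally have rR: "r * norm (R (\<gamma> 0)) \<le> \<eta>" .
  define x where "x = (\<lambda>\<phi>. parallel r (z 0) (cis \<phi>))"
  have x: "x \<phi> \<in> S3 - hopf_circle" "norm (x \<phi> - \<gamma> 0) \<le> 2 * r" "cmod (fst (x \<phi>) - z 0) \<le> r\<^sup>2"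
    "snd (x \<phi> - \<gamma> 0) = r *\<^sub>R cis \<phi>" for \<phi>
    using parallel_properties(1,2,4)[OF r(1,2) \<gamma>(2), of "cis \<phi>" 0] unfolding \<gamma>(1)
    by (auto simp: x_def) (simp add: parallel_def scaleR_conv_of_real)
  have xb: "x \<phi> \<in> ball (\<gamma> 0) \<delta>1" "x \<phi> \<in> ball (\<gamma> 0) \<delta>2" for \<phi>
    using x(2)[of \<phi>] r(3,4) by (auto simp: dist_norm norm_minus_commute)
  have xU: "x \<phi> \<in> U" for \<phi> using xb(1) \<delta>1(2) by blast
  define B where "B = (\<lambda>\<phi>. Complex (- g (x \<phi>)) (f (x \<phi>)))"
  define A where "A = (\<lambda>\<phi>. crossing_map S N (x \<phi>))"
  have xC: "continuous_on T x" for T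
    unfolding x_def parallel_def by (intro continuous_intros)
  have fgC: "continuous_on U f" "continuous_on U g"
    using f g unfolding C1_with_gradient_def gderiv_def
    by (meson continuous_at_imp_continuous_on has_derivative_continuous)+
  have BC: "continuous_on T B" for T
    unfolding B_def using xU
    by (intro continuous_intros continuous_on_compose2[OF fgC(1) xC] continuous_on_compose2[OF fgC(2) xC]) auto
  have AC: "continuous_on T A" for T
    unfolding A_def using x(1) by (intro continuous_on_compose2[OF continuous_on_crossing_map xC]) auto
  have near: "cmod (B \<phi> - (of_real r * a * cis \<phi> + of_real r * b * cis (- \<phi>))) < \<bar>cmod (of_real r * a) - cmod (of_real r * b)\<bar>" for \<phi>
  proof -
    have "\<bar>f (x \<phi>) - f (\<gamma> 0) - c * inner (N (\<gamma> 0)) (x \<phi> - \<gamma> 0)\<bar> \<le> \<eta> * norm (x \<phi> - \<gamma> 0)"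
      using x(1)[of \<phi>] xb p(1) \<delta>1(1) by (intro \<delta>1(3)) auto
    also have "\<dots> \<le> \<eta> * (2 * r)" using x(2) \<eta> by (intro mult_left_mono) auto
    also have "inner (N (\<gamma> 0)) (x \<phi> - \<gamma> 0) = r * inner \<nu> (cis \<phi>)"
      unfolding inner_prod_def x(4) \<nu>(2) by simp
    finally have 1: "\<bar>f (x \<phi>) - c * (r * inner \<nu> (cis \<phi>))\<bar> \<le> 2 * (\<eta> * r)" using fg0 by simp
    have "\<bar>g (x \<phi>) - g (\<gamma> 0) - inner (R (\<gamma> 0)) (x \<phi> - \<gamma> 0)\<bar> \<le> \<eta> * norm (x \<phi> - \<gamma> 0)"
      using xb \<delta>2(1) by (intro \<delta>2(2)) auto
    also have "\<dots> \<le> \<eta> * (2 * r)" using x(2) \<eta> by (intro mult_left_mono) auto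
    also have "inner (R (\<gamma> 0)) (x \<phi> - \<gamma> 0) = inner (fst (R (\<gamma> 0))) (fst (x \<phi>) - z 0) + r * inner \<rho> (cis \<phi>)"
      unfolding inner_prod_def x(4) by (simp add: \<gamma>(1) flip: \<rho>_def) (simp add: \<rho>_def \<gamma>(1))
    finally have 2: "\<bar>g (x \<phi>) - inner (fst (R (\<gamma> 0))) (fst (x \<phi>) - z 0) - r * inner \<rho> (cis \<phi>)\<bar> \<le> 2 * (\<eta> * r)"
      using fg0 by simp
    have "\<bar>inner (fst (R (\<gamma> 0))) (fst (x \<phi>) - z 0)\<bar> \<le> cmod (fst (R (\<gamma> 0))) * cmod (fst (x \<phi>) - z 0)"
      by (rule Cauchy_Schwarz_ineq2)
    also have "\<dots> \<le> norm (R (\<gamma> 0)) * r\<^sup>2"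
      using x(3) norm_fst_le[of "fst (R (\<gamma> 0))" "snd (R (\<gamma> 0))"] by (intro mult_mono) auto
    also have "\<dots> = r * norm (R (\<gamma> 0)) * r" by (simp add: power2_eq_square)
    also have "\<dots> \<le> \<eta> * r" using rR r(1) by (intro mult_right_mono) auto
    finally have 3: "\<bar>inner (fst (R (\<gamma> 0))) (fst (x \<phi>) - z 0)\<bar> \<le> \<eta> * r" .
    have e: "B \<phi> - (of_real r * a * cis \<phi> + of_real r * b * cis (- \<phi>)) =
        Complex (- (g (x \<phi>) - r * inner \<rho> (cis \<phi>))) (f (x \<phi>) - c * (r * inner \<nu> (cis \<phi>)))"
    proof -
      have "of_real r * a * cis \<phi> + of_real r * b * cis (- \<phi>) = of_real r * (a * cis \<phi> + b * cis (- \<phi>))"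
        by (simp add: algebra_simps)
      then show ?thesis unfolding ab B_def by (simp add: complex_eq_iff)
    qed
    have "cmod (B \<phi> - (of_real r * a * cis \<phi> + of_real r * b * cis (- \<phi>))) \<le>
        \<bar>g (x \<phi>) - r * inner \<rho> (cis \<phi>)\<bar> + \<bar>f (x \<phi>) - c * (r * inner \<nu> (cis \<phi>))\<bar>"
      unfolding e by (rule order.trans[OF cmod_le]) simp
    also have "\<dots> \<le> 5 * (\<eta> * r)" using 1 2 3 by linarith
    also have "\<dots> < 6 * (\<eta> * r)" using \<eta> r(1) by simp
    also have "\<dots> = r * \<bar>cmod a - cmod b\<bar>" by (simp add: \<eta>_def)
    also have "\<dots> = \<bar>r * (cmod a - cmod b)\<bar>" using r(1) by (simp add: abs_mult)
    also have "\<dots> = \<bar>cmod (of_real r * a) - cmod (of_real r * b)\<bar>"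
      using r(1) by (simp add: norm_mult right_diff_distrib)
    finally show ?thesis .
  qed
  have per: "x (2 * pi) = x 0" by (simp add: x_def)
  obtain l where l: "continuous_on {0..2 * pi} l" "\<And>t. t \<in> {0..2 * pi} \<Longrightarrow> B t = exp (l t)" "l (2 * pi) - l 0 \<noteq> 0"
    using log_near_real_linear_loop[OF BC _ near] per by (auto simp: B_def)
  have xS: "x \<phi> \<in> S \<longleftrightarrow> f (x \<phi>) = 0 \<and> g (x \<phi>) \<ge> 0" for \<phi>
  proof -
    have "x \<phi> \<in> S \<longleftrightarrow> x \<phi> \<in> S \<inter> U" using xU by blast
    then show ?thesis unfolding SU using xU x(1) by blast
  qed
  have B0: "B \<phi> \<noteq> 0" for \<phi>
  proof
    assume "B \<phi> = 0"
    then have "f (x \<phi>) = 0" "g (x \<phi>) = 0" by (auto simp: B_def complex_eq_iff)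
    then have "x \<phi> \<in> range \<gamma> \<inter> U" unfolding \<gamma>U using xU x(1) by blast
    then show False using x(1) range by blast
  qed
  have A0: "A \<phi> \<noteq> 0" "A \<phi> \<in> \<real>\<^sub>\<le>\<^sub>0 \<longleftrightarrow> x \<phi> \<in> S" for \<phi>
    using crossing_map_nonpos_Reals[OF x(1)] by (auto simp: A_def)
  have DC: "continuous_on {0..2 * pi} (\<lambda>\<phi>. Ln (A \<phi>) - Ln (B \<phi>))"
  proof (rule continuous_Ln_difference[OF AC BC A0(1) B0])
    show "A \<phi> \<in> \<real>\<^sub>\<le>\<^sub>0 \<longleftrightarrow> B \<phi> \<in> \<real>\<^sub>\<le>\<^sub>0" for \<phi>
      unfolding A0(2) xS by (auto simp: B_def complex_nonpos_Reals_iff)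
    fix \<phi> assume "\<phi> \<in> {0..2 * pi}" "A \<phi> \<in> \<real>\<^sub>\<le>\<^sub>0"
    then have \<phi>: "x \<phi> \<in> S" "f (x \<phi>) = 0" "g (x \<phi>) \<ge> 0" using A0(2) xS by auto
    moreover have "g (x \<phi>) \<noteq> 0" using B0[of \<phi>] \<phi>(2) by (auto simp: B_def complex_eq_iff)
    ultimately have gpos: "g (x \<phi>) > 0" by simp
    define V where "V = U \<inter> g -` {0<..}"
    have V: "open V" unfolding V_def using fgC(2) U(1) by (intro continuous_open_preimage) auto
    have "local_equation S N V f"
      unfolding local_equation_def
    proof (intro conjI exI[of _ F] ballI)
      show "S \<inter> V = {x \<in> S3 \<inter> V. f x = 0}"
      proof -
        have "S \<inter> V = (S \<inter> U) \<inter> V" by (auto simp: V_def)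
        also have "\<dots> = {x \<in> S3 \<inter> V. f x = 0}" unfolding SU by (auto simp: V_def)
        finally show ?thesis .
      qed
      show "C1_with_gradient V f F"
        using f continuous_on_subset[of U F V] unfolding C1_with_gradient_def V_def by auto
      show "positive_conormal F N y" if "y \<in> S \<inter> V" for y using pos that by (auto simp: V_def)
    qed (rule V)
    moreover have "x \<phi> \<in> S - hopf_circle" "x \<phi> \<in> V" using \<phi>(1) x(1)[of \<phi>] xU gpos by (auto simp: V_def)
    ultimately have ev: "eventually (\<lambda>y. y \<in> S3 \<longrightarrow> sgn (Im (crossing_map S N y)) = sgn (f y)) (nhds (x \<phi>))"
      by (rule sgn_Im_crossing_map)
    have "(x \<longlongrightarrow> x \<phi>) (at \<phi> within {0..2 * pi})"
      using xC[of UNIV] by (auto simp: continuous_on_def intro: tendsto_within_subset)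
    then have "eventually (\<lambda>u. x u \<in> S3 \<longrightarrow> sgn (Im (crossing_map S N (x u))) = sgn (f (x u))) (at \<phi> within {0..2 * pi})"
      using ev by (rule eventually_compose_filterlim[rotated])
    then show "eventually (\<lambda>u. sgn (Im (A u)) = sgn (Im (B u))) (at \<phi> within {0..2 * pi})"
      by eventually_elim (use x(1) in \<open>auto simp: A_def B_def\<close>)
  qed
  show thesis
  proof (rule that[OF r(1,2)], intro allI impI, elim conjE)
    fix G assume G: "continuous_on {0..2 * pi} G"
      "\<forall>\<phi>\<in>{0..2 * pi}. exp (G \<phi>) = crossing_map S N (parallel r (z 0) (cis \<phi>))"
    have "G (2 * pi) - G 0 = (l (2 * pi) + (Ln (A (2 * pi)) - Ln (B (2 * pi)))) - (l 0 + (Ln (A 0) - Ln (B 0)))"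
    proof (rule continuous_logs_differ_by_constant[where T = "{0..2 * pi}" and a = G
          and b = "\<lambda>\<phi>. l \<phi> + (Ln (A \<phi>) - Ln (B \<phi>))"])
      show "exp (G \<phi>) = exp (l \<phi> + (Ln (A \<phi>) - Ln (B \<phi>)))" if "\<phi> \<in> {0..2 * pi}" for \<phi>
        using G(2)[rule_format, OF that] l(2)[OF that] A0(1)[of \<phi>] B0[of \<phi>]
        by (simp add: exp_add exp_diff A_def x_def)
    qed (use G l DC in \<open>auto intro: continuous_on_add\<close>)
    also have "\<dots> = l (2 * pi) - l 0" by (simp add: A_def B_def per)
    finally show "G (2 * pi) \<noteq> G 0" using l(3) by auto
  qed
qed

text \<open>The parallel curve in the direction \<open>\<psi>\<close> lifts to a path in the covering space that ends \<open>m\<close> deck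
  translations away from its start, if \<open>\<psi>\<close> grows by \<open>2\<pi>m\<close>. Along it the crossing map avoids the negative
  real axis, so the lifted logarithm differs from the principal one by a constant and returns to its
  initial value.\<close>

lemma seifert_normal_unlinked:
  assumes \<psi>: "continuous_on {0..2 * pi} \<psi>"
    and N\<psi>: "\<And>t. t \<in> {0..2 * pi} \<Longrightarrow> cis (\<psi> t) = snd (N (\<gamma> t)) \<or> cis (\<psi> t) = - snd (N (\<gamma> t))"
    and per: "cis (\<psi> (2 * pi)) = cis (\<psi> 0)" "z (2 * pi) = z 0"
  shows "\<psi> (2 * pi) = \<psi> 0"
proof -
  obtain G \<kappa> where G: "continuous_on (ball 0 1 \<times> UNIV) G"
    "\<And>w \<phi>. cmod w < 1 \<Longrightarrow> exp (G (w, \<phi>)) = crossing_map S N (solid_torus_param (w, \<phi>))"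
    "\<And>w \<phi> m. cmod w < 1 \<Longrightarrow> G (w, \<phi> + 2 * pi * of_int m) = G (w, \<phi>) + of_int m * \<kappa>"
    using log_on_solid_torus[OF continuous_on_crossing_map crossing_map_nonpos_Reals(2)] by blast
  have "\<kappa> \<noteq> 0"
  proof -
    obtain r where r: "0 < r" "r < 1"
      "\<forall>G. continuous_on {0..2 * pi} G \<and>
        (\<forall>\<phi>\<in>{0..2 * pi}. exp (G \<phi>) = crossing_map S N (parallel r (z 0) (cis \<phi>))) \<longrightarrow>
        G (2 * pi) \<noteq> G 0"
      by (rule meridian_log_not_periodic) (rule that)
    define w where "w = fst (parallel r (z 0) 1)"
    have w: "cmod w < 1" "parallel r (z 0) (cis \<phi>) = solid_torus_param (w, \<phi>)" for \<phi>
      using parallel_properties[OF r(1,2) \<gamma>(2), of 1 0] by (auto simp: w_def)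
    have "G (w, 2 * pi) \<noteq> G (w, 0)"
    proof (rule r(3)[rule_format, of "\<lambda>\<phi>. G (w, \<phi>)"], intro conjI ballI)
      show "continuous_on {0..2 * pi} (\<lambda>\<phi>. G (w, \<phi>))"
        using w(1) by (intro continuous_on_compose2[OF G(1)] continuous_intros) auto
    qed (use G(2) w in auto)
    then show ?thesis using G(3)[OF w(1), of 0 1] by auto
  qed
  obtain e where e: "e > 0" "\<And>t \<epsilon>. t \<in> {0..2 * pi} \<Longrightarrow> 0 < \<epsilon> \<Longrightarrow> \<epsilon> < e \<Longrightarrow> parallel \<epsilon> (z t) (cis (\<psi> t)) \<notin> S"
  proof -
    have "continuous_on {0..2 * pi} (\<lambda>t. cis (\<psi> t))" by (intro continuous_intros \<psi>)
    from parallel_avoids_seifert_surface[OF this _ N\<psi>] show thesis using that by auto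
  qed
  define \<epsilon> where "\<epsilon> = min e 1 / 2"
  have \<epsilon>: "0 < \<epsilon>" "\<epsilon> < 1" "\<epsilon> < e" using e(1) by (auto simp: \<epsilon>_def)
  define w where "w = (\<lambda>t. fst (parallel \<epsilon> (z t) 1))"
  have w: "cmod (w t) < 1" "parallel \<epsilon> (z t) (cis \<phi>) = solid_torus_param (w t, \<phi>)"
    "solid_torus_param (w t, \<phi>) \<in> S3 - hopf_circle" for t \<phi>
    using parallel_properties[OF \<epsilon>(1,2) \<gamma>(2)[of t], of 1] solid_torus_param_in[of "w t" \<phi>] by (auto simp: w_def)
  have zC: "continuous_on T z" for T
  proof -
    have "continuous_on T \<gamma>"
      using D by (intro continuous_at_imp_continuous_on ballI has_vector_derivative_continuous)
    then have "continuous_on T (\<lambda>t. fst (\<gamma> t))" by (rule continuous_on_fst)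
    then show ?thesis by (simp add: \<gamma>(1))
  qed
  have wC: "continuous_on {0..2 * pi} (\<lambda>t. (w t, \<psi> t))"
    unfolding w_def parallel_def by (simp, intro continuous_intros zC \<psi>)
  have spC: "continuous_on {0..2 * pi} (\<lambda>t. solid_torus_param (w t, \<psi> t))"
    unfolding w(2)[symmetric] parallel_def by (intro continuous_intros zC \<psi>)
  have slit: "crossing_map S N (solid_torus_param (w t, \<psi> t)) \<notin> \<real>\<^sub>\<le>\<^sub>0" if "t \<in> {0..2 * pi}" for t
    using crossing_map_nonpos_Reals(1)[OF w(3)] e(2)[OF that \<epsilon>(1,3)] unfolding w(2) by simp
  have "G (w (2 * pi), \<psi> (2 * pi)) - G (w 0, \<psi> 0) =
      Ln (crossing_map S N (solid_torus_param (w (2 * pi), \<psi> (2 * pi)))) - Ln (crossing_map S N (solid_torus_param (w 0, \<psi> 0)))"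
  proof (rule continuous_logs_differ_by_constant[where T = "{0..2 * pi}" and a = "\<lambda>t. G (w t, \<psi> t)"
        and b = "\<lambda>t. Ln (crossing_map S N (solid_torus_param (w t, \<psi> t)))"])
    show "continuous_on {0..2 * pi} (\<lambda>t. G (w t, \<psi> t))"
      using w(1) by (intro continuous_on_compose2[OF G(1) wC]) auto
    show "continuous_on {0..2 * pi} (\<lambda>t. Ln (crossing_map S N (solid_torus_param (w t, \<psi> t))))"
      using slit w(3) by (intro continuous_on_Ln' continuous_on_compose2[OF continuous_on_crossing_map spC]) auto
    show "exp (G (w t, \<psi> t)) = exp (Ln (crossing_map S N (solid_torus_param (w t, \<psi> t))))" for t
      using G(2)[OF w(1)] crossing_map_nonpos_Reals(2)[OF w(3)] by simp
  qed auto
  also have "\<dots> = 0" unfolding w(2)[symmetric] per by simp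
  finally have same: "G (w 0, \<psi> (2 * pi)) = G (w 0, \<psi> 0)" by (simp add: w_def per)
  obtain m :: int where m: "\<psi> (2 * pi) = \<psi> 0 + 2 * pi * m"
    using per(1) sin_cos_eq_iff[of "\<psi> (2 * pi)" "\<psi> 0"] by (auto simp: complex_eq_iff)
  have "of_int m * \<kappa> = 0" using same G(3)[OF w(1), of 0 "\<psi> 0" m] unfolding m by simp
  then show ?thesis using \<open>\<kappa> \<noteq> 0\<close> m by simp
qed

end

section \<open>The standard disc\<close>

text \<open>The page of the standard open book of the sphere whose boundary is the Hopf circle.\<close>

definition disc_page :: "(complex \<times> complex) set" where
  "disc_page = {x \<in> S3. Im (snd x) = 0 \<and> Re (snd x) \<ge> 0}"

definition hopf_path :: "real \<Rightarrow> complex \<times> complex" where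
  "hopf_path t = (cis t, 0)"

definition hopf_velocity :: "real \<Rightarrow> complex \<times> complex" where
  "hopf_velocity t = (\<i> * cis t, 0)"

lemma range_hopf_path: "range hopf_path = hopf_circle"
proof (intro equalityI subsetI)
  fix x assume "x \<in> hopf_circle"
  then have "cmod (fst x) = 1" "snd x = 0" by (auto simp: hopf_circle_def)
  then have "hopf_path (Arg (fst x)) = x"
    using rcis_cmod_Arg[of "fst x"] by (auto simp: hopf_path_def rcis_def prod_eq_iff)
  then show "x \<in> range hopf_path" by (metis rangeI)
qed (auto simp: hopf_path_def hopf_circle_def)

lemma hopf_path_has_vector_derivative: "(hopf_path has_vector_derivative hopf_velocity t) (at t within A)"
proof -
  have "((\<lambda>t. exp (\<i> * of_real t)) has_vector_derivative \<i> * 1 * exp (\<i> * of_real t)) (at t within A)"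
    by (rule has_vector_derivative_exp[where B = of_real])
      (use has_vector_derivative_of_real[OF DERIV_ident] in simp)
  then have "((\<lambda>t. (exp (\<i> * of_real t), 0)) has_vector_derivative (\<i> * 1 * exp (\<i> * of_real t), 0)) (at t within A)"
    by (intro has_vector_derivative_Pair has_vector_derivative_const)
  then show ?thesis by (simp add: hopf_path_def[abs_def] hopf_velocity_def cis_conv_exp)
qed

lemma closed_leaf_parametrisation_hopf_path:
  assumes "n \<ge> 1"
  shows "closed_leaf_parametrisation (omega n) hopf_path hopf_velocity"
  unfolding closed_leaf_parametrisation_def C1_path_with_velocity_def
proof (intro conjI allI ballI)
  show "hopf_path (t + 2 * pi) = hopf_path t" for t by (simp add: hopf_path_def complex_eq_iff)
  show "inj_on hopf_path {0..<2 * pi}"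
  proof (rule inj_onI)
    fix s t assume st: "s \<in> {0..<2 * pi}" "t \<in> {0..<2 * pi}" "hopf_path s = hopf_path t"
    then have "sin s = sin t \<and> cos s = cos t" by (auto simp: hopf_path_def complex_eq_iff)
    then obtain m :: int where m: "s = t + 2 * pi * m" using sin_cos_eq_iff by auto
    then have "\<bar>2 * pi * m\<bar> < 2 * pi" using st by auto
    then have "\<bar>real_of_int m\<bar> < 1" by (simp add: abs_mult)
    then show "s = t" using m by simp
  qed
  show "continuous_on UNIV hopf_velocity"
    unfolding hopf_velocity_def[abs_def] by (intro continuous_intros)
  show "(hopf_path has_vector_derivative hopf_velocity t) (at t)" for t
    by (rule hopf_path_has_vector_derivative)
  show "hopf_path t \<in> S3" for t by (simp add: hopf_path_def S3_iff)
  show "positive_leaf_vector (omega n) (hopf_path t) (hopf_velocity t)" for t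
    unfolding hopf_path_def hopf_velocity_def positive_leaf_vector_hopf_circle[OF assms norm_cis]
    by (intro exI[of _ 1]) simp
qed

lemma seifert_surface_disc_page:
  "seifert_surface hopf_path hopf_velocity disc_page (\<lambda>_. (0, \<i>))"
proof -
  have img: "disc_page = (\<lambda>w. (w, of_real (sqrt (1 - (cmod w)\<^sup>2)))) ` cball 0 1"
  proof (intro equalityI subsetI)
    fix x assume x: "x \<in> disc_page"
    then have eq: "(cmod (fst x))\<^sup>2 + (cmod (snd x))\<^sup>2 = 1" and s: "Im (snd x) = 0" "Re (snd x) \<ge> 0"
      by (cases x; auto simp: disc_page_def S3_iff)+
    have "snd x = of_real (cmod (snd x))" using s by (simp add: complex_eq_iff cmod_def)
    moreover have "cmod (snd x) = sqrt (1 - (cmod (fst x))\<^sup>2)" using eq by (intro real_sqrt_unique[symmetric]) auto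
    moreover have "(cmod (fst x))\<^sup>2 \<le> 1" using eq zero_le_power2[of "cmod (snd x)"] by linarith
    ultimately show "x \<in> (\<lambda>w. (w, of_real (sqrt (1 - (cmod w)\<^sup>2)))) ` cball 0 1"
      by (intro image_eqI[of _ _ "fst x"]) (auto simp: prod_eq_iff abs_square_le_1)
  next
    fix x :: "complex \<times> complex" assume "x \<in> (\<lambda>w. (w, of_real (sqrt (1 - (cmod w)\<^sup>2)))) ` cball 0 1"
    then obtain w :: complex where w: "cmod w \<le> 1" "x = (w, of_real (sqrt (1 - (cmod w)\<^sup>2)))" by auto
    then have "(cmod w)\<^sup>2 \<le> 1" by (simp add: abs_square_le_1)
    then show "x \<in> disc_page" unfolding w(2) by (simp add: disc_page_def S3_iff)
  qed
  have cont: "continuous_on (cball 0 1) (\<lambda>w::complex. (w, of_real (sqrt (1 - (cmod w)\<^sup>2)) :: complex))"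
    by (intro continuous_intros)
  have Cf: "C1_with_gradient U (\<lambda>x. Im (snd x)) (\<lambda>_. (0, \<i>))" for U
    unfolding C1_with_gradient_def gderiv_def
    by (auto intro!: derivative_eq_intros simp: inner_prod_def inner_complex_def)
  have Cg: "C1_with_gradient U (\<lambda>x. Re (snd x)) (\<lambda>_. (0, 1))" for U
    unfolding C1_with_gradient_def gderiv_def
    by (auto intro!: derivative_eq_intros simp: inner_prod_def inner_complex_def)
  have pc: "positive_conormal (\<lambda>_. (0, \<i>)) (\<lambda>_. (0, \<i>)) x" for x
    unfolding positive_conormal_def by (intro exI[of _ 1]) simp
  have hopf: "hopf_circle = {x \<in> S3. Im (snd x) = 0 \<and> Re (snd x) = 0}"
  proof -
    have "(z1, z2) \<in> hopf_circle \<longleftrightarrow> (z1, z2) \<in> S3 \<and> Im z2 = 0 \<and> Re z2 = 0" for z1 z2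
    proof -
      have "Im z2 = 0 \<and> Re z2 = 0 \<longleftrightarrow> z2 = 0" by (auto simp: complex_eq_iff)
      then show ?thesis unfolding hopf_circle_def S3_def by (auto simp: norm_prod_def abs_square_eq_1)
    qed
    then show ?thesis by auto
  qed
  show ?thesis
    unfolding seifert_surface_def range_hopf_path
  proof (intro conjI ballI)
    show "compact disc_page" unfolding img by (intro compact_continuous_image cont) auto
    show "connected disc_page" unfolding img by (intro connected_continuous_image cont) auto
    show "hopf_circle \<subseteq> disc_page" unfolding hopf disc_page_def by auto
    show "disc_page \<subseteq> S3" by (auto simp: disc_page_def)
    show "continuous_on disc_page (\<lambda>_. (0, \<i>))" by (rule continuous_on_const)
    show "(0, \<i>) \<in> tangent_S3 p" "norm ((0::complex), \<i>) = 1" if "p \<in> disc_page" for p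
      using that by (auto simp: disc_page_def tangent_S3_def inner_pair norm_prod_def)
    show "\<exists>U f F. open U \<and> p \<in> U \<and> C1_with_gradient U f F \<and> disc_page \<inter> U = {x \<in> S3 \<inter> U. f x = 0} \<and>
        (\<forall>x\<in>disc_page \<inter> U. positive_conormal F (\<lambda>_. (0, \<i>)) x)" if p: "p \<in> disc_page - hopf_circle" for p
    proof (intro exI[of _ "{x. Re (snd x) > 0}"] exI[of _ "\<lambda>x. Im (snd x)"] exI[of _ "\<lambda>_. (0, \<i>)"] conjI ballI)
      show "open {x :: complex \<times> complex. Re (snd x) > 0}"
        by (intro open_Collect_less continuous_intros)
      show "p \<in> {x. Re (snd x) > 0}" using p unfolding hopf disc_page_def by auto
      show "disc_page \<inter> {x. Re (snd x) > 0} = {x \<in> S3 \<inter> {x. Re (snd x) > 0}. Im (snd x) = 0}"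
        unfolding disc_page_def by auto
    qed (rule Cf pc)+
    show "\<exists>U f F g G. open U \<and> p \<in> U \<and> C1_with_gradient U f F \<and> C1_with_gradient U g G \<and>
        disc_page \<inter> U = {x \<in> S3 \<inter> U. f x = 0 \<and> g x \<ge> 0} \<and>
        hopf_circle \<inter> U = {x \<in> S3 \<inter> U. f x = 0 \<and> g x = 0} \<and>
        (\<forall>x\<in>disc_page \<inter> U. positive_conormal F (\<lambda>_. (0, \<i>)) x) \<and>
        (\<forall>t. hopf_path t \<in> U \<longrightarrow>
           (\<exists>w\<in>surface_tangent (\<lambda>_. (0, \<i>)) (hopf_path t). inner (G (hopf_path t)) w < 0) \<and>
           (\<forall>w\<in>surface_tangent (\<lambda>_. (0, \<i>)) (hopf_path t). inner (G (hopf_path t)) w < 0 \<longrightarrow>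
              det4 (hopf_path t) (0, \<i>) w (hopf_velocity t) > 0))" for p
    proof (rule exI[of _ UNIV], rule exI[of _ "\<lambda>x. Im (snd x)"], rule exI[of _ "\<lambda>_. (0, \<i>)"],
        rule exI[of _ "\<lambda>x. Re (snd x)"], rule exI[of _ "\<lambda>_. (0, 1)"], intro conjI ballI allI impI)
      show "disc_page \<inter> UNIV = {x \<in> S3 \<inter> UNIV. Im (snd x) = 0 \<and> Re (snd x) \<ge> 0}" by (auto simp: disc_page_def)
      show "hopf_circle \<inter> UNIV = {x \<in> S3 \<inter> UNIV. Im (snd x) = 0 \<and> Re (snd x) = 0}" by (simp add: hopf)
      show "\<exists>w\<in>surface_tangent (\<lambda>_. (0, \<i>)) (hopf_path t). inner (0, 1) w < 0" for t
        by (intro bexI[of _ "(0, - 1)"]) (auto simp: surface_tangent_def tangent_S3_def inner_pair hopf_path_def)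
      fix t w assume w: "w \<in> surface_tangent (\<lambda>_. (0, \<i>)) (hopf_path t)" "inner (0, 1) w < 0"
      obtain w1 w2 where ww: "w = (w1, w2)" by force
      have s: "Re (cnj (cis t) * w1) = 0" "Im w2 = 0" "Re w2 < 0"
        using w unfolding ww by (auto simp: surface_tangent_def tangent_S3_def inner_pair hopf_path_def)
      have "w1 = of_real (Im (cnj (cis t) * w1)) * (\<i> * cis t)"
      proof -
        have "w1 = (cis t * cnj (cis t)) * w1" by (simp add: cis_cnj cis_mult)
        also have "\<dots> = cis t * (cnj (cis t) * w1)" by simp
        also have "cnj (cis t) * w1 = of_real (Im (cnj (cis t) * w1)) * \<i>" using s(1) by (simp add: complex_eq_iff)
        finally show ?thesis by (simp add: mult_ac)
      qed
      then obtain b where b: "w1 = of_real b * (\<i> * cis t)" by blast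
      have "det4 (hopf_path t) (0, \<i>) w (hopf_velocity t) = - Re w2"
      proof -
        define x y where "x = cos t" and "y = sin t"
        have c: "cis t = Complex x y" and xy: "x * x + y * y = 1"
          by (auto simp: x_def y_def complex_eq_iff power2_eq_square[symmetric])
        have e: "hopf_path t = (Complex x y, Complex 0 0)" "(0, \<i>) = (Complex 0 0, Complex 0 1)"
          "w = (Complex (- (b * y)) (b * x), Complex (Re w2) 0)" "hopf_velocity t = (Complex (- y) x, Complex 0 0)"
          using s(2) by (auto simp: hopf_path_def hopf_velocity_def c ww b complex_eq_iff)
        have "det4 (hopf_path t) (0, \<i>) w (hopf_velocity t) = - Re w2 * (x * x + y * y)"
          unfolding e det4_expansion by (simp add: algebra_simps)
        then show ?thesis using xy by simp
      qed
      then show "det4 (hopf_path t) (0, \<i>) w (hopf_velocity t) > 0" using s(3) by simp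
    qed (simp_all add: Cf Cg pc)
  qed
qed

lemma seifert_framing_disc_page:
  "seifert_framing hopf_path hopf_velocity (\<lambda>_. (0, \<i>)) (\<lambda>_. (0, 1))"
  by (auto simp: seifert_framing_def surface_tangent_def tangent_S3_def inner_pair hopf_path_def
      hopf_velocity_def span_singleton)

section \<open>Leaves near the Hopf circle\<close>

text \<open>The implicit function rule in the plane for a given continuous solution. The nonzero partial
  derivative first bounds the increments of \<open>\<sigma>\<close> by those of the variable, and then determines their
  quotient.\<close>

lemma implicit_function_derivative:
  fixes \<Psi> :: "real \<times> real \<Rightarrow> real" and \<sigma> :: "real \<Rightarrow> real"
  assumes D: "(\<Psi> has_derivative D) (at (t, \<sigma> t))" and q: "D (0, 1) \<noteq> 0" and cont: "isCont \<sigma> t"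
    and zero: "eventually (\<lambda>u. \<Psi> (u, \<sigma> u) = 0) (nhds t)"
  shows "(\<sigma> has_real_derivative - D (1, 0) / D (0, 1)) (at t)"
proof -
  define p where "p = D (1, 0)"
  define m where "m = D (0, 1)"
  have lin: "D (a, b) = p * a + m * b" for a b
  proof -
    have "linear D" using D has_derivative_linear by blast
    moreover have "(a, b) = a *\<^sub>R (1, 0) + b *\<^sub>R (0, 1)" by simp
    ultimately show ?thesis
      unfolding p_def m_def by (simp only: linear_add linear_scale) simp
  qed
  have m: "m \<noteq> 0" using q by (simp add: m_def)
  have z0: "\<Psi> (t, \<sigma> t) = 0" using zero eventually_nhds_x_imp_x by blast
  have est: "eventually (\<lambda>u. \<bar>p * (u - t) + m * (\<sigma> u - \<sigma> t)\<bar> \<le> e * (\<bar>u - t\<bar> + \<bar>\<sigma> u - \<sigma> t\<bar>)) (nhds t)"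
    if e: "e > 0" for e
  proof -
    obtain d where d: "d > 0" "\<And>y. norm (y - (t, \<sigma> t)) < d \<Longrightarrow>
        norm (\<Psi> y - \<Psi> (t, \<sigma> t) - D (y - (t, \<sigma> t))) \<le> e * norm (y - (t, \<sigma> t))"
      using D e unfolding has_derivative_at_alt by blast
    have "((\<lambda>u. (u, \<sigma> u)) \<longlongrightarrow> (t, \<sigma> t)) (nhds t)"
      using cont by (intro tendsto_Pair filterlim_ident) (simp add: isCont_def tendsto_at_iff_tendsto_nhds)
    then have "eventually (\<lambda>u. dist (u, \<sigma> u) (t, \<sigma> t) < d) (nhds t)"
      using d(1) by (rule tendstoD)
    then show ?thesis using zero
    proof eventually_elim
      case (elim u)
      have "\<bar>D ((u, \<sigma> u) - (t, \<sigma> t))\<bar> \<le> e * norm ((u, \<sigma> u) - (t, \<sigma> t))"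
        using d(2)[of "(u, \<sigma> u)"] elim z0 by (simp add: dist_norm)
      also have "\<dots> \<le> e * (\<bar>u - t\<bar> + \<bar>\<sigma> u - \<sigma> t\<bar>)"
        using norm_Pair_le[of "u - t" "\<sigma> u - \<sigma> t"] e by (intro mult_left_mono) auto
      finally show ?case by (simp add: lin)
    qed
  qed
  define K where "K = 2 * (\<bar>p\<bar> + \<bar>m\<bar>) / \<bar>m\<bar>"
  have K: "K \<ge> 0" by (simp add: K_def)
  have m2: "\<bar>m\<bar> / 2 > 0" using m by simp
  have lip: "eventually (\<lambda>u. \<bar>\<sigma> u - \<sigma> t\<bar> \<le> K * \<bar>u - t\<bar>) (nhds t)"
    using est[OF m2]
  proof eventually_elim
    case (elim u)
    have "\<bar>m\<bar> * \<bar>\<sigma> u - \<sigma> t\<bar> = \<bar>m * (\<sigma> u - \<sigma> t)\<bar>" by (simp add: abs_mult)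
    also have "\<dots> \<le> \<bar>p * (u - t) + m * (\<sigma> u - \<sigma> t)\<bar> + \<bar>p * (u - t)\<bar>" by linarith
    also have "\<dots> \<le> \<bar>m\<bar> / 2 * (\<bar>u - t\<bar> + \<bar>\<sigma> u - \<sigma> t\<bar>) + \<bar>p\<bar> * \<bar>u - t\<bar>"
      using elim by (simp add: abs_mult)
    finally have "\<bar>m\<bar> / 2 * \<bar>\<sigma> u - \<sigma> t\<bar> \<le> (\<bar>m\<bar> / 2 + \<bar>p\<bar>) * \<bar>u - t\<bar>" by (simp add: algebra_simps)
    also have "\<dots> \<le> (\<bar>m\<bar> + \<bar>p\<bar>) * \<bar>u - t\<bar>" by (intro mult_right_mono) auto
    finally show ?case using m by (simp add: K_def field_simps)
  qed
  have "((\<lambda>u. (\<sigma> u - \<sigma> t) / (u - t)) \<longlongrightarrow> - p / m) (at t)"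
  proof (rule tendstoI)
    fix e :: real assume e: "e > 0"
    define e' where "e' = e * \<bar>m\<bar> / (2 * (1 + K))"
    have e': "e' > 0" using e m K by (simp add: e'_def add_pos_nonneg)
    have "eventually (\<lambda>u. u \<noteq> t \<longrightarrow> dist ((\<sigma> u - \<sigma> t) / (u - t)) (- p / m) < e) (nhds t)"
      using est[OF e'] lip
    proof (eventually_elim, intro impI)
      case (elim u)
      assume ut: "u \<noteq> t"
      have "e' * (\<bar>u - t\<bar> + \<bar>\<sigma> u - \<sigma> t\<bar>) \<le> e' * ((1 + K) * \<bar>u - t\<bar>)"
        using elim(2) e' by (intro mult_left_mono) (auto simp: algebra_simps)
      also have "\<dots> = (e * \<bar>m\<bar> / 2) * \<bar>u - t\<bar>" using K by (simp add: e'_def add_pos_nonneg field_simps)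
      finally have le: "\<bar>p * (u - t) + m * (\<sigma> u - \<sigma> t)\<bar> \<le> (e * \<bar>m\<bar> / 2) * \<bar>u - t\<bar>" using elim(1) by linarith
      have "(\<sigma> u - \<sigma> t) / (u - t) - (- p / m) = (p * (u - t) + m * (\<sigma> u - \<sigma> t)) / (m * (u - t))"
        using ut m by (simp add: field_simps)
      then have "\<bar>(\<sigma> u - \<sigma> t) / (u - t) - (- p / m)\<bar> = \<bar>p * (u - t) + m * (\<sigma> u - \<sigma> t)\<bar> / (\<bar>m\<bar> * \<bar>u - t\<bar>)"
        by (simp add: abs_mult)
      also have "\<dots> \<le> (e * \<bar>m\<bar> / 2) * \<bar>u - t\<bar> / (\<bar>m\<bar> * \<bar>u - t\<bar>)"
        using le by (intro divide_right_mono) auto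
      also have "\<dots> = e / 2" using ut m by simp
      finally show "dist ((\<sigma> u - \<sigma> t) / (u - t)) (- p / m) < e" using e by (simp add: dist_real_def)
    qed
    then show "eventually (\<lambda>u. dist ((\<sigma> u - \<sigma> t) / (u - t)) (- p / m) < e) (at t)"
      by (simp add: eventually_at_filter)
  qed
  then show ?thesis unfolding has_field_derivative_iff p_def m_def by simp
qed

text \<open>The squared norm, minus \<open>1\<close>, of the point with parameter \<open>B = \<sigma> + \<i> t\<close> on the holomorphic leaf through
  \<open>(1, s)\<close>, that is, of \<open>(e\<^sup>n\<^sup>B (1 + s\<^sup>n B), s e\<^sup>B)\<close>. Its zeros are the points of the leaf on the sphere.\<close>

definition sphere_defect :: "nat \<Rightarrow> real \<Rightarrow> real \<Rightarrow> real \<Rightarrow> real" where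
  "sphere_defect n s t \<sigma> =
     exp (2 * n * \<sigma>) * ((1 + \<sigma> * s ^ n)\<^sup>2 + (t * s ^ n)\<^sup>2) + s\<^sup>2 * exp (2 * \<sigma>) - 1"

text \<open>The partial derivative of \<open>sphere_defect\<close> in \<open>\<sigma>\<close>.\<close>

definition sphere_defect_rate :: "nat \<Rightarrow> real \<Rightarrow> real \<Rightarrow> real \<Rightarrow> real" where
  "sphere_defect_rate n s t \<sigma> =
     2 * n * exp (2 * n * \<sigma>) * ((1 + \<sigma> * s ^ n)\<^sup>2 + (t * s ^ n)\<^sup>2) +
     exp (2 * n * \<sigma>) * (2 * (1 + \<sigma> * s ^ n) * s ^ n) + 2 * s\<^sup>2 * exp (2 * \<sigma>)"

definition height_correction :: "nat \<Rightarrow> real \<Rightarrow> real \<Rightarrow> real" where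
  "height_correction n s t = (THE \<sigma>. \<bar>\<sigma>\<bar> \<le> 1 / 2 \<and> sphere_defect n s t \<sigma> = 0)"

lemma abs_power_small:
  assumes "\<bar>s::real\<bar> \<le> 1 / 32" "n \<ge> 1"
  shows "\<bar>s ^ n\<bar> \<le> 1 / 32"
proof -
  have "\<bar>s\<bar> ^ n \<le> \<bar>s\<bar> ^ 1" using assms by (intro power_decreasing) auto
  then show ?thesis using assms by (simp add: power_abs)
qed

lemma sphere_defect_rate_pos:
  assumes s: "\<bar>s\<bar> \<le> 1 / 32" and n: "n \<ge> 1" and \<sigma>: "\<bar>\<sigma>\<bar> \<le> 1 / 2"
  shows "sphere_defect_rate n s t \<sigma> > 0"
proof -
  define q where "q = s ^ n"
  define u where "u = 1 + \<sigma> * q"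
  have q: "\<bar>q\<bar> \<le> 1 / 32" using abs_power_small[OF s n] by (simp add: q_def)
  have "\<bar>\<sigma> * q\<bar> \<le> 1 / 2 * (1 / 32)" unfolding abs_mult using q \<sigma> by (intro mult_mono) auto
  then have u: "u \<ge> 1 / 2" by (simp add: u_def)
  have "real n * u \<ge> 1 * u" using n u by (intro mult_right_mono) auto
  then have "u * (n * u + q) > 0" using u q by (intro mult_pos_pos) linarith+
  moreover have "n * (t * q)\<^sup>2 \<ge> 0" by simp
  ultimately have "n * (u\<^sup>2 + (t * q)\<^sup>2) + u * q > 0"
    by (simp add: power2_eq_square algebra_simps)
  then have "2 * exp (2 * n * \<sigma>) * (n * (u\<^sup>2 + (t * q)\<^sup>2) + u * q) > 0" by simp
  moreover have "2 * s\<^sup>2 * exp (2 * \<sigma>) \<ge> 0" by simp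
  moreover have "sphere_defect_rate n s t \<sigma> =
      2 * exp (2 * n * \<sigma>) * (n * (u\<^sup>2 + (t * q)\<^sup>2) + u * q) + 2 * s\<^sup>2 * exp (2 * \<sigma>)"
    unfolding sphere_defect_rate_def q_def[symmetric] u_def[symmetric] by (simp add: algebra_simps)
  ultimately show ?thesis by linarith
qed

lemma sphere_defect_has_derivative_height:
  "((\<lambda>(t, \<sigma>). sphere_defect n s t \<sigma>) has_derivative
     (\<lambda>(a, b). exp (2 * n * \<sigma>) * (2 * (t * s ^ n) * s ^ n) * a + sphere_defect_rate n s t \<sigma> * b))
   (at (t, \<sigma>))"
  unfolding sphere_defect_def sphere_defect_rate_def case_prod_unfold
  by (auto intro!: derivative_eq_intros simp: algebra_simps power2_eq_square)

lemma sphere_defect_has_derivative_parameter: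
  "((\<lambda>(s, \<sigma>). sphere_defect n s t \<sigma>) has_derivative
     (\<lambda>(a, b). (exp (2 * n * \<sigma>) * (2 * (1 + \<sigma> * s ^ n) * \<sigma> + 2 * (t * s ^ n) * t) * (n * s ^ (n - 1)) +
        2 * s * exp (2 * \<sigma>)) * a + sphere_defect_rate n s t \<sigma> * b))
   (at (s, \<sigma>))"
  unfolding sphere_defect_def sphere_defect_rate_def case_prod_unfold
  by (auto intro!: derivative_eq_intros simp: algebra_simps power2_eq_square)

text \<open>The constants only have to leave room: \<open>s\<close> is so small that the leaf is almost the cylinder
  \<open>|z\<^sub>1| = e\<^sup>n\<^sup>\<sigma>\<close>, and \<open>7 > 2\<pi>\<close>, so that the range of times is a neighbourhood of a full turn.\<close>

lemma sphere_defect_endpoints: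
  assumes s: "\<bar>s\<bar> \<le> 1 / 32" and n: "n \<ge> 1" and t: "\<bar>t\<bar> \<le> 7"
  shows "sphere_defect n s t (1 / 2) > 0" "sphere_defect n s t (- 1 / 2) < 0"
proof -
  define q where "q = s ^ n"
  have q: "\<bar>q\<bar> \<le> 1 / 32" using abs_power_small[OF s n] by (simp add: q_def)
  have e: "exp (real n) \<ge> 2" using exp_ge_add_one_self[of "real n"] n by linarith
  have "(63 / 64)\<^sup>2 \<le> (1 + 1 / 2 * q)\<^sup>2" using q by (intro power_mono) auto
  then have "2 * (63 / 64)\<^sup>2 \<le> exp (real n) * ((1 + 1 / 2 * q)\<^sup>2 + (t * q)\<^sup>2)"
    using e by (intro mult_mono) (auto simp: add_increasing2)
  moreover have "2 * (63 / 64)\<^sup>2 > (1::real)" by (simp add: power2_eq_square)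
  moreover have "s\<^sup>2 * exp 1 \<ge> 0" by simp
  moreover have "sphere_defect n s t (1 / 2) =
      exp (real n) * ((1 + 1 / 2 * q)\<^sup>2 + (t * q)\<^sup>2) + s\<^sup>2 * exp 1 - 1"
    by (simp add: sphere_defect_def q_def)
  ultimately show "sphere_defect n s t (1 / 2) > 0" by linarith
  have e': "exp (- real n) \<le> 1 / 2" using e by (simp add: exp_minus field_simps)
  have 1: "(1 + (- 1 / 2) * q)\<^sup>2 \<le> (65 / 64)\<^sup>2" using q by (intro power_mono) auto
  have "\<bar>t * q\<bar> \<le> 7 * (1 / 32)"
    unfolding abs_mult using t q by (intro mult_mono) auto
  then have 2: "(t * q)\<^sup>2 \<le> (7 / 32)\<^sup>2" by (intro abs_le_square_iff[THEN iffD1]) auto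
  have "exp (- real n) * ((1 + (- 1 / 2) * q)\<^sup>2 + (t * q)\<^sup>2) \<le> 1 / 2 * ((65 / 64)\<^sup>2 + (7 / 32)\<^sup>2)"
    using e' 1 2 by (intro mult_mono add_mono) auto
  moreover have "s\<^sup>2 * exp (- 1) \<le> (1 / 32)\<^sup>2 * 1"
    using s by (intro mult_mono abs_le_square_iff[THEN iffD1]) auto
  ultimately show "sphere_defect n s t (- 1 / 2) < 0"
    unfolding sphere_defect_def q_def[symmetric] by (simp add: power2_eq_square)
qed

lemma height_correction:
  assumes s: "\<bar>s\<bar> \<le> 1 / 32" and n: "n \<ge> 1" and t: "\<bar>t\<bar> \<le> 7"
  shows "\<bar>height_correction n s t\<bar> \<le> 1 / 2" "sphere_defect n s t (height_correction n s t) = 0"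
    "\<And>\<sigma>. \<bar>\<sigma>\<bar> \<le> 1 / 2 \<Longrightarrow> sphere_defect n s t \<sigma> = 0 \<Longrightarrow> height_correction n s t = \<sigma>"
proof -
  have D: "(sphere_defect n s t has_real_derivative sphere_defect_rate n s t \<sigma>) (at \<sigma>)" for \<sigma>
    unfolding sphere_defect_def sphere_defect_rate_def
    by (auto intro!: derivative_eq_intros simp: algebra_simps power2_eq_square)
  have C: "continuous_on A (sphere_defect n s t)" for A
    using D DERIV_isCont continuous_at_imp_continuous_on by blast
  have strict: "sphere_defect n s t a < sphere_defect n s t b" if "a < b" "\<bar>a\<bar> \<le> 1 / 2" "\<bar>b\<bar> \<le> 1 / 2" for a b
  proof (rule DERIV_pos_imp_increasing[OF that(1)])
    fix x assume "a \<le> x" "x \<le> b"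
    then have "\<bar>x\<bar> \<le> 1 / 2" using that by auto
    then show "\<exists>y. DERIV (sphere_defect n s t) x :> y \<and> y > 0"
      using D sphere_defect_rate_pos[OF s n] by blast
  qed
  obtain \<sigma> where "- 1 / 2 \<le> \<sigma>" "\<sigma> \<le> 1 / 2" "sphere_defect n s t \<sigma> = 0"
    using IVT'[of "sphere_defect n s t" "- 1 / 2" 0 "1 / 2"] sphere_defect_endpoints[OF s n t] C by auto
  then have ex: "\<bar>\<sigma>\<bar> \<le> 1 / 2 \<and> sphere_defect n s t \<sigma> = 0" by auto
  have uniq: "x = y" if "\<bar>x\<bar> \<le> 1 / 2 \<and> sphere_defect n s t x = 0" "\<bar>y\<bar> \<le> 1 / 2 \<and> sphere_defect n s t y = 0" for x y
    using strict[of x y] strict[of y x] that by (cases x y rule: linorder_cases) auto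
  have "\<bar>height_correction n s t\<bar> \<le> 1 / 2 \<and> sphere_defect n s t (height_correction n s t) = 0"
    unfolding height_correction_def by (rule theI[where P = "\<lambda>\<sigma>. \<bar>\<sigma>\<bar> \<le> 1 / 2 \<and> sphere_defect n s t \<sigma> = 0"]) (use ex uniq in blast)+
  then show "\<bar>height_correction n s t\<bar> \<le> 1 / 2" "sphere_defect n s t (height_correction n s t) = 0"
    "\<And>\<sigma>. \<bar>\<sigma>\<bar> \<le> 1 / 2 \<Longrightarrow> sphere_defect n s t \<sigma> = 0 \<Longrightarrow> height_correction n s t = \<sigma>"
    using uniq by blast+
qed

text \<open>The graph is closed, and the values lie in a compact interval.\<close>

lemma continuous_on_height_correction:
  assumes n: "n \<ge> 1"
  shows "continuous_on ({- 1 / 32..1 / 32} \<times> {- 7..7}) (\<lambda>(s, t). height_correction n s t)"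
proof (rule continuous_from_closed_graph[where T = "{- 1 / 2..1 / 2}"])
  let ?D = "{- 1 / 32..1 / 32} \<times> {- 7..7::real}"
  have hc: "\<bar>height_correction n (fst x) (snd x)\<bar> \<le> 1 / 2"
    "sphere_defect n (fst x) (snd x) (height_correction n (fst x) (snd x)) = 0"
    "\<And>\<sigma>. \<bar>\<sigma>\<bar> \<le> 1 / 2 \<Longrightarrow> sphere_defect n (fst x) (snd x) \<sigma> = 0 \<Longrightarrow> height_correction n (fst x) (snd x) = \<sigma>"
    if "x \<in> ?D" for x using that by (intro height_correction[OF _ n]; force)+
  show "compact {- 1 / 2..1 / 2::real}" by simp
  show "(\<lambda>(s, t). height_correction n s t) \<in> ?D \<rightarrow> {- 1 / 2..1 / 2}"
    using hc(1) by (force simp: abs_le_iff)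
  have "(\<lambda>x. (x, case x of (s, t) \<Rightarrow> height_correction n s t)) ` ?D =
      (?D \<times> {- 1 / 2..1 / 2}) \<inter> {y. sphere_defect n (fst (fst y)) (snd (fst y)) (snd y) = 0}"
  proof (intro equalityI subsetI)
    fix y assume "y \<in> (\<lambda>x. (x, case x of (s, t) \<Rightarrow> height_correction n s t)) ` ?D"
    then obtain x where x: "x \<in> ?D" "y = (x, height_correction n (fst x) (snd x))" by (auto simp: case_prod_unfold)
    then show "y \<in> (?D \<times> {- 1 / 2..1 / 2}) \<inter> {y. sphere_defect n (fst (fst y)) (snd (fst y)) (snd y) = 0}"
      using hc(1,2)[OF x(1)] by (auto simp: abs_le_iff)
  next
    fix y assume y: "y \<in> (?D \<times> {- 1 / 2..1 / 2}) \<inter> {y. sphere_defect n (fst (fst y)) (snd (fst y)) (snd y) = 0}"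
    then have "height_correction n (fst (fst y)) (snd (fst y)) = snd y"
      by (intro hc(3)) auto
    then show "y \<in> (\<lambda>x. (x, case x of (s, t) \<Rightarrow> height_correction n s t)) ` ?D"
      using y by (intro image_eqI[of _ _ "fst y"]) (auto simp: case_prod_unfold prod_eq_iff)
  qed
  moreover have "closed \<dots>"
    unfolding sphere_defect_def
    by (intro closed_Int closed_Times closed_Collect_eq continuous_intros)
  ultimately show "closed ((\<lambda>x. (x, case x of (s, t) \<Rightarrow> height_correction n s t)) ` ?D)" by simp
qed

text \<open>The derivative of \<open>height_correction\<close> in time, by the implicit function rule.\<close>

definition height_speed :: "nat \<Rightarrow> real \<Rightarrow> real \<Rightarrow> real" where
  "height_speed n s t = - (exp (2 * n * height_correction n s t) * (2 * (t * s ^ n) * s ^ n)) /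
     sphere_defect_rate n s t (height_correction n s t)"

text \<open>The parameter has imaginary part \<open>t / n\<close>, so that the first coordinate \<open>e\<^sup>n\<^sup>B (1 + s\<^sup>n B)\<close> turns at unit
  speed up to an error that disappears with \<open>s\<close>.\<close>

definition leaf_parameter :: "nat \<Rightarrow> real \<Rightarrow> real \<Rightarrow> complex" where
  "leaf_parameter n s t = Complex (height_correction n s (t / n)) (t / n)"

definition leaf_family :: "nat \<Rightarrow> real \<Rightarrow> real \<Rightarrow> complex \<times> complex" where
  "leaf_family n s t = (let B = leaf_parameter n s t in
     (exp (of_nat n * B) * (1 + B * of_real (s ^ n)), of_real s * exp B))"

context
  fixes n :: nat
  assumes n: "n \<ge> 1"
begin

lemma scaled_time: "\<bar>t / n\<bar> \<le> \<bar>t\<bar>"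
  using n divide_left_mono[of 1 "real n" "\<bar>t\<bar>"] by simp

lemma height_correction_0: "\<bar>t\<bar> \<le> 7 \<Longrightarrow> height_correction n 0 t = 0"
  using n by (intro height_correction(3)) (auto simp: sphere_defect_def power_0_left)

lemma leaf_family_0: "\<bar>t\<bar> \<le> 7 \<Longrightarrow> leaf_family n 0 t = hopf_path t"
proof -
  assume "\<bar>t\<bar> \<le> 7"
  then have "leaf_parameter n 0 t = \<i> * of_real (t / n)"
    using height_correction_0[OF order.trans[OF scaled_time]] by (simp add: leaf_parameter_def complex_eq_iff)
  moreover have "of_nat n * (\<i> * of_real (t / n)) = \<i> * of_real t" using n by (simp add: field_simps)
  ultimately show ?thesis
    using n by (simp add: leaf_family_def hopf_path_def cis_conv_exp power_0_left)
qed

lemma leaf_family_in_S3: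
  assumes s: "\<bar>s\<bar> \<le> 1 / 32" and t: "\<bar>t\<bar> \<le> 7"
  shows "leaf_family n s t \<in> S3"
proof -
  define \<sigma> where "\<sigma> = height_correction n s (t / n)"
  define B where "B = leaf_parameter n s t"
  have B: "B = Complex \<sigma> (t / n)" by (simp add: B_def leaf_parameter_def \<sigma>_def)
  have "cmod (exp (of_nat n * B)) = exp (n * \<sigma>)" "cmod (exp B) = exp \<sigma>" by (simp_all add: B)
  moreover have "(cmod (1 + B * of_real (s ^ n)))\<^sup>2 = (1 + \<sigma> * s ^ n)\<^sup>2 + (t / n * s ^ n)\<^sup>2"
    unfolding cmod_power2 by (simp add: B)
  ultimately have "(cmod (exp (of_nat n * B) * (1 + B * of_real (s ^ n))))\<^sup>2 + (cmod (of_real s * exp B))\<^sup>2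
      = (exp (n * \<sigma>))\<^sup>2 * ((1 + \<sigma> * s ^ n)\<^sup>2 + (t / n * s ^ n)\<^sup>2) + s\<^sup>2 * (exp \<sigma>)\<^sup>2"
    by (simp only: norm_mult power_mult_distrib norm_of_real power2_abs)
  also have "\<dots> = sphere_defect n s (t / n) \<sigma> + 1"
    by (simp add: sphere_defect_def exp_double mult.assoc)
  also have "\<dots> = 1" using height_correction(2)[OF s n order.trans[OF scaled_time t]] by (simp add: \<sigma>_def)
  finally show ?thesis by (simp add: leaf_family_def Let_def B_def[symmetric] S3_iff)
qed

lemma continuous_on_leaf_parameter:
  "continuous_on ({- 1 / 32..1 / 32} \<times> {- 7..7}) (\<lambda>(s, t). leaf_parameter n s t)"
proof -
  have "continuous_on ({- 1 / 32..1 / 32} \<times> {- 7..7}) (\<lambda>x. (\<lambda>(s, t). height_correction n s t) (fst x, snd x / n))"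
  proof (rule continuous_on_compose2[OF continuous_on_height_correction[OF n]])
    show "continuous_on ({- 1 / 32..1 / 32::real} \<times> {- 7..7}) (\<lambda>x. (fst x, snd x / real n))"
      using n by (intro continuous_intros) auto
    have "t / n \<in> {- 7..7}" if "t \<in> {- 7..7}" for t :: real using scaled_time[of t] that
      by (simp only: atLeastAtMost_iff abs_le_iff) linarith
    then show "(\<lambda>x. (fst x, snd x / real n)) ` ({- 1 / 32..1 / 32::real} \<times> {- 7..7}) \<subseteq> {- 1 / 32..1 / 32} \<times> {- 7..7}"
      by auto
  qed
  then have hc: "continuous_on ({- 1 / 32..1 / 32} \<times> {- 7..7}) (\<lambda>x. height_correction n (fst x) (snd x / n))"
    by simp
  show ?thesis unfolding leaf_parameter_def case_prod_unfold using n
    by (intro continuous_on_Complex hc continuous_intros) auto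
qed

lemma isCont_height_correction:
  assumes "\<bar>s\<bar> < 1 / 32" "\<bar>t\<bar> < 7"
  shows "isCont (\<lambda>t. height_correction n s t) t" "isCont (\<lambda>s. height_correction n s t) s"
proof -
  have C: "isCont (\<lambda>(s, t). height_correction n s t) (s, t)"
  proof (rule continuous_on_interior[OF continuous_on_height_correction[OF n]])
    show "(s, t) \<in> interior ({- 1 / 32..1 / 32} \<times> {- 7..7})"
      using assms by (auto simp: interior_Times abs_less_iff)
  qed
  show "isCont (\<lambda>t. height_correction n s t) t"
    using isCont_o2[of t "\<lambda>t. (s, t)" "\<lambda>(s, t). height_correction n s t"] C by simp
  show "isCont (\<lambda>s. height_correction n s t) s"
    using isCont_o2[of s "\<lambda>s. (s, t)" "\<lambda>(s, t). height_correction n s t"] C by simp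
qed

lemma height_correction_deriv_time:
  assumes s: "\<bar>s\<bar> < 1 / 32" and t: "\<bar>t\<bar> < 7"
  shows "((\<lambda>t. height_correction n s t) has_real_derivative height_speed n s t) (at t)"
proof -
  have s': "\<bar>s\<bar> \<le> 1 / 32" and t': "\<bar>t\<bar> \<le> 7" using s t by auto
  have pos: "sphere_defect_rate n s t (height_correction n s t) > 0"
    using sphere_defect_rate_pos[OF s' n] height_correction(1)[OF s' n t'] by blast
  have "eventually (\<lambda>u. u \<in> {-7<..<7}) (nhds t)"
    using t by (intro eventually_nhds_in_open) (auto simp: abs_less_iff)
  then have "eventually (\<lambda>u. (\<lambda>(t, \<sigma>). sphere_defect n s t \<sigma>) (u, height_correction n s u) = 0) (nhds t)"
    by eventually_elim (use height_correction(2)[OF s' n] in \<open>auto simp: abs_le_iff\<close>)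
  from implicit_function_derivative[OF sphere_defect_has_derivative_height _ isCont_height_correction(1)[OF s t] this]
  show ?thesis using pos by (simp add: height_speed_def)
qed

lemma height_correction_differentiable_0:
  assumes t: "\<bar>t\<bar> < 7"
  shows "(\<lambda>s. height_correction n s t) differentiable (at 0)"
proof -
  let ?\<sigma> = "height_correction n 0 t"
  have t': "\<bar>t\<bar> \<le> 7" using t by auto
  have rate: "sphere_defect_rate n 0 t ?\<sigma> \<noteq> 0"
    using sphere_defect_rate_pos[of 0 n ?\<sigma> t] n height_correction(1)[of 0 n t] t' by auto
  have "eventually (\<lambda>u. u \<in> {-1/32<..<1/32}) (nhds (0::real))"
    by (intro eventually_nhds_in_open) auto
  then have "eventually (\<lambda>u. (\<lambda>(s, \<sigma>). sphere_defect n s t \<sigma>) (u, height_correction n u t) = 0) (nhds 0)"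
    by eventually_elim (use height_correction(2)[OF _ n t'] in \<open>auto simp: abs_le_iff\<close>)
  from implicit_function_derivative[OF sphere_defect_has_derivative_parameter _ isCont_height_correction(2)[OF _ t] this]
  show ?thesis using rate unfolding has_field_derivative_def differentiable_def by auto
qed

text \<open>The velocity is the complex multiple \<open>B'\<close> of the kernel field, so the form vanishes on it, and it is
  tangent to the sphere since the path stays there.\<close>

lemma leaf_path_leaf_family:
  assumes s: "\<bar>s\<bar> < 1 / 32"
  shows "leaf_path (omega n) {0..2 * pi} (leaf_family n s)"
proof -
  have pi7: "2 * pi < 7" using pi_approx by simp
  define v where "v = (\<lambda>t. Complex (height_speed n s (t / n) / n) (1 / n))"
  define c' where "c' = (\<lambda>t. (v t * fst (omega_kernel n (leaf_family n s t)), v t * snd (omega_kernel n (leaf_family n s t))))"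
  have small: "\<bar>t / n\<bar> < 7" if "t \<in> {0..2 * pi}" for t
    using scaled_time[of t] that pi7 by auto
  have Bd: "((\<lambda>t. leaf_parameter n s t) has_vector_derivative v t) (at t)" if t: "t \<in> {0..2 * pi}" for t
  proof -
    have "((\<lambda>t. height_correction n s (t / n)) has_real_derivative height_speed n s (t / n) * (1 / n)) (at t)"
      by (rule DERIV_chain2[where f = "\<lambda>t. height_correction n s t" and g = "\<lambda>t. t / n",
            OF height_correction_deriv_time[OF s small[OF t]]]) (use n in \<open>auto intro!: derivative_eq_intros\<close>)
    then have "((\<lambda>t. of_real (height_correction n s (t / n)) + \<i> * of_real (t / n)) has_vector_derivative
        of_real (height_speed n s (t / n) * (1 / n)) + \<i> * of_real (1 / n)) (at t)"
      using n by (intro has_vector_derivative_add has_vector_derivative_mult_right has_vector_derivative_of_real)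
        (auto intro!: derivative_eq_intros)
    then show ?thesis by (simp add: leaf_parameter_def[abs_def] v_def Complex_eq)
  qed
  have cd: "(leaf_family n s has_vector_derivative c' t) (at t)" if t: "t \<in> {0..2 * pi}" for t
  proof -
    let ?B = "leaf_parameter n s"
    have e: "exp (of_nat n * ?B t) * of_real (s ^ n) = (of_real s * exp (?B t)) ^ n"
      by (simp add: power_mult_distrib exp_of_nat_mult mult.commute)
    have "((\<lambda>t. (exp (of_nat n * ?B t) * (1 + ?B t * of_real (s ^ n)), of_real s * exp (1 * ?B t))) has_vector_derivative
        (exp (of_nat n * ?B t) * (0 + v t * of_real (s ^ n)) + of_nat n * v t * exp (of_nat n * ?B t) * (1 + ?B t * of_real (s ^ n)),
         of_real s * (1 * v t * exp (1 * ?B t)))) (at t)"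
      by (intro has_vector_derivative_Pair has_vector_derivative_mult has_vector_derivative_add has_vector_derivative_const
          has_vector_derivative_mult_left has_vector_derivative_mult_right has_vector_derivative_exp Bd t)
    moreover have "(exp (of_nat n * ?B t) * (0 + v t * of_real (s ^ n)) + of_nat n * v t * exp (of_nat n * ?B t) * (1 + ?B t * of_real (s ^ n)),
         of_real s * (1 * v t * exp (1 * ?B t))) = c' t"
      using e by (simp add: c'_def omega_kernel_def leaf_family_def Let_def algebra_simps)
    moreover have "leaf_family n s = (\<lambda>t. (exp (of_nat n * ?B t) * (1 + ?B t * of_real (s ^ n)), of_real s * exp (1 * ?B t)))"
      by (simp add: leaf_family_def[abs_def] Let_def)
    ultimately show ?thesis by metis
  qed
  have S3: "leaf_family n s t \<in> S3" if "\<bar>t\<bar> \<le> 7" for t using leaf_family_in_S3[of s t] s that by simp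
  have tangent: "inner (leaf_family n s t) (c' t) = 0" if t: "t \<in> {0..2 * pi}" for t
  proof -
    have "((\<lambda>t. inner (leaf_family n s t) (leaf_family n s t)) has_derivative
        (\<lambda>h. inner (leaf_family n s t) (h *\<^sub>R c' t) + inner (h *\<^sub>R c' t) (leaf_family n s t))) (at t)"
      using cd[OF t] unfolding has_vector_derivative_def by (intro has_derivative_inner)
    moreover have "(\<lambda>h. inner (leaf_family n s t) (h *\<^sub>R c' t) + inner (h *\<^sub>R c' t) (leaf_family n s t)) =
        (*) (2 * inner (leaf_family n s t) (c' t))"
      by (auto simp: fun_eq_iff inner_commute[of "c' t"])
    ultimately have d: "((\<lambda>t. inner (leaf_family n s t) (leaf_family n s t)) has_real_derivative
        2 * inner (leaf_family n s t) (c' t)) (at t)"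
      unfolding has_field_derivative_def by simp
    have "2 * inner (leaf_family n s t) (c' t) = 0"
    proof (rule DERIV_local_const[OF d])
      show "0 < 7 - t" using t pi7 by simp
      show "\<forall>y. \<bar>t - y\<bar> < 7 - t \<longrightarrow>
          inner (leaf_family n s t) (leaf_family n s t) = inner (leaf_family n s y) (leaf_family n s y)"
        using S3 t pi7 by (auto simp: S3_def dot_square_norm abs_le_iff abs_less_iff)
    qed
    then show ?thesis by simp
  qed
  have cC: "continuous_on {0..2 * pi} (leaf_family n s)"
    using cd by (intro continuous_at_imp_continuous_on ballI has_vector_derivative_continuous)
  have hC: "continuous_on {0..2 * pi} (\<lambda>t. height_correction n s (t / n))"
  proof (rule continuous_at_imp_continuous_on, rule ballI)
    fix t assume t: "t \<in> {0..2 * pi}"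
    have "isCont (\<lambda>t. t / n) t" using n by (intro continuous_intros) auto
    from isCont_o2[OF this isCont_height_correction(1)[OF s small[OF t]]]
    show "isCont (\<lambda>t. height_correction n s (t / n)) t" .
  qed
  have rate: "sphere_defect_rate n s (t / n) (height_correction n s (t / n)) \<noteq> 0" if "t \<in> {0..2 * pi}" for t
    using sphere_defect_rate_pos[of s n "height_correction n s (t / n)" "t / n"] s n
      height_correction(1)[of s n "t / n"] small[OF that] by auto
  have "continuous_on {0..2 * pi} (\<lambda>t. height_speed n s (t / n))"
    unfolding height_speed_def using rate n
    by (intro continuous_intros hC; auto simp: sphere_defect_rate_def intro!: continuous_intros hC)
  then have "continuous_on {0..2 * pi} v"
    unfolding v_def using n by (intro continuous_on_Complex continuous_intros) auto
  then have "continuous_on {0..2 * pi} c'"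
    unfolding c'_def omega_kernel_def by (simp, intro continuous_intros cC)
  moreover have "c' t \<in> leaf_direction (omega n) (leaf_family n s t)" if "t \<in> {0..2 * pi}" for t
    using tangent[OF that] by (simp add: leaf_direction_def tangent_S3_def omega_eq c'_def omega_kernel_def algebra_simps)
  moreover have "leaf_family n s t \<in> S3" if "t \<in> {0..2 * pi}" for t using that pi7 by (intro S3) auto
  ultimately show ?thesis
    unfolding leaf_path_def C1_path_with_velocity_def
    using cd has_vector_derivative_at_within by blast
qed

text \<open>The second coordinate of the family is \<open>s e\<^sup>B\<close>; its derivative at \<open>s = 0\<close> is \<open>e\<^sup>B\<close>, where \<open>B\<close> has become
  \<open>\<i> t / n\<close>. For the derivative of the first coordinate existence is enough, as the form ignores it on the circle.\<close>

lemma linear_holonomy_hopf_path: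
  "linear_holonomy (omega n) hopf_path (\<lambda>_. (0, 1)) (\<lambda>t. exp (\<i> * of_real (t / n)))"
proof -
  have pi7: "2 * pi < 7" using pi_approx by simp
  define W where "W = (\<lambda>t. vector_derivative (\<lambda>s. leaf_family n s t) (at 0))"
  have W: "((\<lambda>s. leaf_family n s t) has_vector_derivative W t) (at 0)"
    and W2: "snd (W t) = exp (\<i> * of_real (t / n))" if t: "t \<in> {0..2 * pi}" for t
  proof -
    have small: "\<bar>t / n\<bar> < 7" using scaled_time[of t] t pi7 by auto
    obtain b where "((\<lambda>s. height_correction n s (t / n)) has_real_derivative b) (at 0)"
      using height_correction_differentiable_0[OF small] real_differentiable_def by blast
    then have "((\<lambda>s. of_real (height_correction n s (t / n)) + \<i> * of_real (t / n)) has_vector_derivative of_real b + 0) (at 0)"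
      by (intro has_vector_derivative_add has_vector_derivative_of_real has_vector_derivative_const)
    then have B: "((\<lambda>s. leaf_parameter n s t) has_vector_derivative of_real b) (at 0)"
      by (simp add: leaf_parameter_def Complex_eq)
    have pw: "((\<lambda>s. of_real (s ^ n) :: complex) has_vector_derivative of_real (n * 0 ^ (n - 1))) (at 0)"
      by (intro has_vector_derivative_of_real) (auto intro!: derivative_eq_intros)
    have id: "((\<lambda>s. of_real s :: complex) has_vector_derivative 1) (at 0)"
      using has_vector_derivative_of_real[OF DERIV_ident] by simp
    have e: "((\<lambda>s. exp (1 * leaf_parameter n s t)) has_vector_derivative 1 * of_real b * exp (1 * leaf_parameter n 0 t)) (at 0)"
      by (rule has_vector_derivative_exp[OF B])
    obtain d where d: "((\<lambda>s. exp (of_nat n * leaf_parameter n s t) * (1 + leaf_parameter n s t * of_real (s ^ n))) has_vector_derivative d) (at 0)"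
      using has_vector_derivative_mult[OF has_vector_derivative_exp[OF B, of "of_nat n"]
          has_vector_derivative_add[OF has_vector_derivative_const[of 1] has_vector_derivative_mult[OF B pw]]] by blast
    have 2: "((\<lambda>s. of_real s * exp (1 * leaf_parameter n s t)) has_vector_derivative exp (leaf_parameter n 0 t)) (at 0)"
      using has_vector_derivative_mult[OF id e] by simp
    have fam: "((\<lambda>s. leaf_family n s t) has_vector_derivative (d, exp (leaf_parameter n 0 t))) (at 0)"
      using has_vector_derivative_Pair[OF d 2] by (simp add: leaf_family_def Let_def)
    then have "W t = (d, exp (leaf_parameter n 0 t))" unfolding W_def by (rule vector_derivative_at)
    moreover have "leaf_parameter n 0 t = \<i> * of_real (t / n)"
      using height_correction_0[of "t / n"] small by (simp add: leaf_parameter_def complex_eq_iff)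
    ultimately show "((\<lambda>s. leaf_family n s t) has_vector_derivative W t) (at 0)"
      "snd (W t) = exp (\<i> * of_real (t / n))" using fam by simp_all
  qed
  have "holonomy_transport (omega n) hopf_path W"
    unfolding holonomy_transport_def
  proof (intro exI[of _ "leaf_family n"] exI[of _ "1 / 32"] conjI ballI)
    have "continuous_on ({- (1 / 32)<..<1 / 32} \<times> {0..2 * pi}) (\<lambda>(s, t). leaf_parameter n s t)"
      using pi7 by (intro continuous_on_subset[OF continuous_on_leaf_parameter]) auto
    then show "continuous_on ({- (1 / 32)<..<1 / 32} \<times> {0..2 * pi}) (\<lambda>(s, t). leaf_family n s t)"
      unfolding leaf_family_def Let_def case_prod_unfold by (intro continuous_intros)
    show "leaf_path (omega n) {0..2 * pi} (leaf_family n s)" if "s \<in> {- (1 / 32)<..<1 / 32}" for s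
      using that by (intro leaf_path_leaf_family) (auto simp: abs_less_iff)
    show "leaf_family n 0 t = hopf_path t" if "t \<in> {0..2 * pi}" for t
      using that pi7 by (intro leaf_family_0) auto
  qed (use W in auto)
  then show ?thesis
    unfolding linear_holonomy_def using W2 n
    by (intro exI[of _ W]) (auto simp: hopf_path_def omega_hopf_circle)
qed

end

section \<open>The logarithmic monodromy\<close>

text \<open>The vector field \<open>Z\<close> is orthogonal to the normal of the surface, so its second coordinate, rotated by
  a quarter turn, is \<open>\<plusminus>N\<close> up to length. Since \<open>N\<close> does not turn around the circle, the logarithm of that coordinate
  is periodic and does not contribute to the monodromy.\<close>

lemma log_monodromy_unique:
  assumes n: "n \<ge> 1" and mono: "has_log_monodromy (omega n) hopf_circle \<mu>"
  shows "\<mu> = 2 * complex_of_real pi * \<i> / of_nat n"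
proof -
  obtain \<gamma> \<gamma>' S N Z h L where leaf: "closed_leaf_parametrisation (omega n) \<gamma> \<gamma>'"
    and range: "range \<gamma> = hopf_circle" and seifert: "seifert_surface \<gamma> \<gamma>' S N"
    and framing: "seifert_framing \<gamma> \<gamma>' N Z" and hol: "linear_holonomy (omega n) \<gamma> Z h"
    and L: "continuous_on {0..2 * pi} L" "L 0 = 0" "\<forall>t\<in>{0..2 * pi}. exp (L t) = h t" "\<mu> = L (2 * pi)"
    using mono unfolding has_log_monodromy_def by (elim conjE exE) (rule that)
  obtain l where l: "continuous_on {0..2 * pi} l" "l 0 = 0" "l (2 * pi) = 2 * of_real pi * \<i>"
    "\<And>t. t \<in> {0..2 * pi} \<Longrightarrow> \<gamma> t = (fst (\<gamma> 0) * exp (l t), 0)"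
    using closed_leaf_winds_once[OF n leaf range] by blast
  define z where "z = (\<lambda>t. fst (\<gamma> t))"
  have \<gamma>: "\<gamma> t = (z t, 0)" "cmod (z t) = 1" for t
  proof -
    have "\<gamma> t \<in> hopf_circle" using range by blast
    then show "\<gamma> t = (z t, 0)" "cmod (z t) = 1" by (auto simp: hopf_circle_def z_def)
  qed
  have \<gamma>': "\<exists>a>0. \<gamma>' t = (of_real a * \<i> * z t, 0)" for t
  proof -
    have "positive_leaf_vector (omega n) (z t, 0) (\<gamma>' t)"
      using leaf \<gamma>(1) by (simp add: closed_leaf_parametrisation_def)
    then show ?thesis by (simp add: positive_leaf_vector_hopf_circle[OF n \<gamma>(2)])
  qed
  have D: "(\<gamma> has_vector_derivative \<gamma>' t) (at t)" for t
    using leaf by (auto simp: closed_leaf_parametrisation_def C1_path_with_velocity_def)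
  have per: "\<gamma> (2 * pi) = \<gamma> 0"
    using leaf unfolding closed_leaf_parametrisation_def by (metis add_0)
  interpret hopf_seifert_surface \<gamma> \<gamma>' S N z
    by unfold_locales (fact seifert range \<gamma> \<gamma>' D)+
  define \<zeta> where "\<zeta> = (\<lambda>t. snd (Z t))"
  have Z: "continuous_on UNIV Z" "Z (2 * pi) = Z 0"
    "\<And>t. Z t \<in> tangent_S3 (\<gamma> t)" "\<And>t. inner (N (\<gamma> t)) (Z t) = 0" "\<And>t. Z t \<notin> span {\<gamma>' t}"
    using framing unfolding seifert_framing_def surface_tangent_def by (auto, metis add_0)
  have \<zeta>0: "\<zeta> t \<noteq> 0" for t
  proof
    assume 0: "\<zeta> t = 0"
    obtain a where a: "a > 0" "\<gamma>' t = (of_real a * \<i> * z t, 0)" using \<gamma>' by blast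
    define b where "b = Im (cnj (z t) * fst (Z t))"
    have "Re (cnj (z t) * fst (Z t)) = 0"
      using Z(3)[of t] by (simp add: tangent_S3_def \<gamma>(1) inner_pair)
    then have b: "cnj (z t) * fst (Z t) = of_real b * \<i>" by (simp add: b_def complex_eq_iff)
    have "z t * cnj (z t) = 1" using \<gamma>(2)[of t] by (simp add: complex_norm_square[symmetric])
    then have "fst (Z t) = z t * (cnj (z t) * fst (Z t))" by (metis mult.assoc mult_1)
    also have "\<dots> = of_real (b / a) * (of_real a * \<i> * z t)" unfolding b using a(1) by simp
    finally have "Z t = (b / a) *\<^sub>R \<gamma>' t"
      using 0 by (simp add: a(2) prod_eq_iff \<zeta>_def scaleR_conv_of_real)
    then show False using Z(5)[of t] by (metis insertI1 span_base span_scale)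
  qed
  have \<zeta>C: "continuous_on A \<zeta>" for A
    unfolding \<zeta>_def by (intro continuous_intros continuous_on_subset[OF Z(1)]) auto
  obtain k where k: "continuous_on {0..2 * pi} k" "\<And>t. t \<in> {0..2 * pi} \<Longrightarrow> \<zeta> t = exp (k t)"
    using continuous_logarithm_on_contractible[OF \<zeta>C[of "{0..2 * pi}"]]
      convex_imp_contractible[OF convex_real_interval(5)] \<zeta>0 by metis
  have "Im (k (2 * pi)) - pi / 2 = Im (k 0) - pi / 2"
  proof (rule seifert_normal_unlinked)
    show "continuous_on {0..2 * pi} (\<lambda>t. Im (k t) - pi / 2)" by (intro continuous_intros k)
    show "z (2 * pi) = z 0" using per by (simp add: z_def)
    have rot: "cis (Im (k t) - pi / 2) = - \<i> * (\<zeta> t / of_real (cmod (\<zeta> t)))" if "t \<in> {0..2 * pi}" for t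
    proof -
      have "\<zeta> t / of_real (cmod (\<zeta> t)) = cis (Im (k t))"
        unfolding k(2)[OF that] norm_exp_eq_Re by (simp add: exp_eq_polar)
      then show ?thesis by (simp add: complex_eq_iff cos_diff sin_diff)
    qed
    show "cis (Im (k (2 * pi)) - pi / 2) = cis (Im (k 0) - pi / 2)"
      using rot[of 0] rot[of "2 * pi"] Z(2) by (simp add: \<zeta>_def)
    fix t assume t: "t \<in> {0..2 * pi}"
    define \<nu> where "\<nu> = snd (N (\<gamma> t))"
    define u where "u = \<zeta> t / of_real (cmod (\<zeta> t))"
    have \<nu>: "cmod \<nu> = 1" using seifert_normal_on_boundary by (simp add: \<nu>_def)
    have u1: "cmod u = 1" using \<zeta>0[of t] by (simp add: u_def norm_divide)
    have "Re (cnj \<nu> * \<zeta> t) = 0"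
      using Z(4)[of t] seifert_normal_on_boundary(1)[of t] unfolding inner_pair by (simp add: \<nu>_def \<zeta>_def)
    then have "Re (cnj \<nu> * u) = 0" by (simp add: u_def)
    moreover have "cmod (cnj \<nu> * u) = 1" using \<nu> u1 by (simp add: norm_mult)
    ultimately have "cnj \<nu> * u = \<i> \<or> cnj \<nu> * u = - \<i>"
      by (auto simp: complex_eq_iff cmod_def)
    moreover have "\<nu> * cnj \<nu> = 1" using \<nu> by (simp add: complex_norm_square[symmetric])
    then have "u = \<nu> * (cnj \<nu> * u)" by (metis mult.assoc mult_1)
    ultimately have "u = \<nu> * \<i> \<or> u = \<nu> * (- \<i>)" by metis
    then have "- \<i> * u = \<nu> \<or> - \<i> * u = - \<nu>" by (auto simp: complex_eq_iff)
    then show "cis (Im (k t) - pi / 2) = snd (N (\<gamma> t)) \<or> cis (Im (k t) - pi / 2) = - snd (N (\<gamma> t))"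
      unfolding rot[OF t] \<nu>_def u_def .
  qed
  moreover have "exp (Re (k (2 * pi))) = exp (Re (k 0))"
    using k(2)[of 0] k(2)[of "2 * pi"] Z(2) by (simp add: \<zeta>_def flip: norm_exp_eq_Re)
  ultimately have kper: "k (2 * pi) = k 0" by (simp add: complex_eq_iff)
  obtain W where W: "holonomy_transport (omega n) \<gamma> W" "omega n (\<gamma> 0) (W 0) = omega n (\<gamma> 0) (Z 0)"
    "\<forall>t\<in>{0..2 * pi}. omega n (\<gamma> t) (W t) = h t * omega n (\<gamma> t) (Z t)"
    using hol unfolding linear_holonomy_def by blast
  have z0: "z t \<noteq> 0" for t using \<gamma>(2)[of t] by auto
  have W0: "snd (W 0) = \<zeta> 0"
    using W(2) z0[of 0] n by (simp add: \<gamma>(1) omega_hopf_circle \<zeta>_def)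
  have Wt: "snd (W t) = h t * \<zeta> t" if "t \<in> {0..2 * pi}" for t
    using W(3)[rule_format, OF that] z0[of t] n by (simp add: \<gamma>(1) omega_hopf_circle \<zeta>_def)
  \<comment> \<open>\<open>l / n\<close> is the logarithm of the holonomy in the coordinate frame, and \<open>k\<close> that of the frame \<open>Z\<close>\<close>
  have "L (2 * pi) - L 0 = (l (2 * pi) / of_nat n + (k 0 - k (2 * pi))) - (l 0 / of_nat n + (k 0 - k 0))"
  proof (rule continuous_logs_differ_by_constant[where T = "{0..2 * pi}" and a = L
        and b = "\<lambda>t. l t / of_nat n + (k 0 - k t)"])
    show "continuous_on {0..2 * pi} (\<lambda>t. l t / of_nat n + (k 0 - k t))"
      using n by (intro continuous_intros l k) auto
    fix t assume t: "t \<in> {0..2 * pi}"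
    have "snd (W t) = snd (W 0) * exp (l t / of_nat n)"
    proof (rule holonomy_transport_hopf_circle[OF n W(1) l(1,2,4)])
      show "\<gamma> t \<in> S3" for t using leaf by (simp add: closed_leaf_parametrisation_def)
      show "snd (W 0) \<noteq> 0" using W0 \<zeta>0 by simp
    qed (use t in auto)
    then have "h t * exp (k t) = exp (k 0) * exp (l t / of_nat n)"
      using Wt[OF t] W0 k(2)[OF t] k(2)[of 0] by simp
    then have "h t = exp (l t / of_nat n + (k 0 - k t))" by (simp add: exp_add exp_diff field_simps)
    then show "exp (L t) = exp (l t / of_nat n + (k 0 - k t))" using L(3) t by simp
  qed (use L in auto)
  then show ?thesis using L(2,4) l(2,3) kper by simp
qed

lemma log_monodromy_exists:
  assumes n: "n \<ge> 1"
  shows "has_log_monodromy (omega n) hopf_circle (2 * complex_of_real pi * \<i> / of_nat n)"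
proof -
  have "continuous_on {0..2 * pi} (\<lambda>t. \<i> * of_real (t / n) :: complex)"
    using n by (intro continuous_intros) auto
  moreover have "\<i> * complex_of_real (2 * pi / real n) = 2 * complex_of_real pi * \<i> / of_nat n" by simp
  ultimately show ?thesis
    unfolding has_log_monodromy_def
    using transversely_holomorphic_form_omega[OF n] closed_leaf_parametrisation_hopf_path[OF n] range_hopf_path
      seifert_surface_disc_page seifert_framing_disc_page linear_holonomy_hopf_path[OF n]
    by (intro conjI exI[of _ hopf_path] exI[of _ hopf_velocity] exI[of _ disc_page] exI[of _ "\<lambda>_. (0, \<i>)"]
        exI[of _ "\<lambda>_. (0, 1)"] exI[of _ "\<lambda>t. exp (\<i> * of_real (t / n))"] exI[of _ "\<lambda>t. \<i> * of_real (t / n)"]) simp_all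
qed

theorem proposition5p6:
  fixes n :: nat and \<mu> :: complex
  assumes "n \<ge> 1"
  shows "has_log_monodromy (omega n) hopf_circle \<mu> \<longleftrightarrow> \<mu> = 2 * complex_of_real pi * \<i> / of_nat n"
  using log_monodromy_unique log_monodromy_exists assms by blast

end
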